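(* Let $\Phi$ be a finite root system of rank $d$ with Weyl group $W$. The number of facets of the cone $\mathrm{SF}_\Phi\subseteq\mathbb{R}^{\mathscr{R}}$ of $\Phi$-submodular functions is $$\sum_{i=1}^d\frac{|W|}{|W_{[d]\setminus N(i)}|},$$ and these facets come in $d$ orbits under the action of $W$ on $\mathbb{R}^{\mathscr{R}}$ given by $(w\cdot h)(\lambda)=h(w^{-1}\lambda)$. For the classical root systems these numbers are: $d(d-1)2^{d-3}$ for $A_{d-1}$; $2d(d-1)3^{d-2}+d2^{d-1}$ for $B_d$ and $C_d$; and $2d(d-1)3^{d-2}-d(d-1)2^{d-2}$ for $D_d$.
   Context: $V$ is a finite-dimensional real inner product space; $\Phi\subset V$ a finite root system (spans $V$, only multiples of $\alpha\in\Phi$ in $\Phi$ are $\pm\alpha$, closed under reflections $s_\alpha(x)=x-\frac{2\langle x,\alpha\rangle}{\langle\alpha,\alpha\rangle}\alpha$); $W$ the group generated by the $s_\alpha$. The Coxeter complex $\Sigma_\Phi$ is the fan whose chambers are closures of components of $V\setminus\bigcup_\alpha\alpha^\perp$. Fix a chamber $D$ with simple roots $\alpha_1,\dots,\alpha_d$, $s_i=s_{\alpha_i}$, coroots $\alpha^\vee=2\alpha/\langle\alpha,\alpha\rangle$, Cartan matrix $A_{ij}=\langle\alpha_i^\vee,\alpha_j\rangle$, fundamental weights $\lambda_i$ with $\langle\lambda_i,\alpha_j^\vee\rangle=\delta_{ij}$, and $\mathscr{R}=W\{\lambda_1,\dots,\lambda_d\}$ (each ray of $\Sigma_\Phi$ contains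 exactly one element of $\mathscr{R}$). $N(i)$ is the set of neighbors of $i$ in the Dynkin diagram, i.e., $j\ne i$ with $A_{ij}\neq0$. For $I\subseteq[d]$, $W_I$ is the subgroup generated by $\{s_i:i\in I\}$. A function $h:\mathscr{R}\to\mathbb{R}$ is $\Phi$-submodular if its continuous extension to $V$ linear on each cone of $\Sigma_\Phi$ is convex (equivalently, it is the restriction of the support function of a polytope whose normal fan coarsens $\Sigma_\Phi$). The classical root systems in $\mathbb{R}^d$ with standard basis $e_i$: $A_{d-1}=\{\pm(e_i-e_j):i\ne j\}$ (in $\{x:\sum x_i=0\}$), $B_d=\{\pm e_i\pm e_j: i\neq j\}\cup\{\pm e_i\}$, $C_d=\{\pm e_i\pm e_j:i\ne j\}\cup\{\pm2e_i\}$, $D_d=\{\pm e_i\pm e_j:i\ne j\}$. *)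

theory Defs
  imports
    "HOL-Analysis.Analysis"
    "HOL-Library.Function_Algebras"
    "HOL-Algebra.Generated_Groups"
    "HOL-Algebra.Group_Action"
begin

text \<open>Real-valued functions on a set are added and scaled pointwise, so that the library
  notions \<open>convex\<close>, \<open>face_of\<close> and \<open>dim\<close> apply to sets of functions.\<close>

instantiation "fun" :: (type, real_vector) real_vector
begin

definition scaleR_fun :: "real \<Rightarrow> ('a \<Rightarrow> 'b) \<Rightarrow> 'a \<Rightarrow> 'b"
  where "scaleR_fun c f = (\<lambda>x. c *\<^sub>R f x)"

instance
  by standard (simp_all add: scaleR_fun_def fun_eq_iff scaleR_add_right scaleR_add_left)

end


text \<open>The space \<open>V\<close> is always \<open>span \<Phi>\<close>, a subspace of an ambient Euclidean space. This covers
  \<open>A\<^bsub>d-1\<^esub>\<close>, which lives in a hyperplane, and the root system of rank 0.\<close>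

definition reflection :: "'v::euclidean_space \<Rightarrow> 'v \<Rightarrow> 'v"
  where "reflection \<alpha> x = x - (2 * (x \<bullet> \<alpha>) / (\<alpha> \<bullet> \<alpha>)) *\<^sub>R \<alpha>"

definition root_system :: "'v::euclidean_space set \<Rightarrow> bool"
  where "root_system \<Phi> \<longleftrightarrow>
    finite \<Phi> \<and> 0 \<notin> \<Phi> \<and>
    (\<forall>\<alpha>\<in>\<Phi>. \<Phi> \<inter> range (\<lambda>c. c *\<^sub>R \<alpha>) = {\<alpha>, - \<alpha>}) \<and>
    (\<forall>\<alpha>\<in>\<Phi>. reflection \<alpha> ` \<Phi> \<subseteq> \<Phi>)"

text \<open>The group acts on the whole ambient space, but fixes the orthogonal complement of \<open>span S\<close>
  pointwise; restricting to \<open>span S\<close> is therefore injective.\<close>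

definition reflection_group :: "'v::euclidean_space set \<Rightarrow> ('v \<Rightarrow> 'v) monoid"
  where "reflection_group S =
    (BijGroup UNIV)\<lparr>carrier := generate (BijGroup UNIV) (reflection ` S)\<rparr>"

definition chambers :: "'v::euclidean_space set \<Rightarrow> 'v set set"
  where "chambers \<Phi> = closure ` components (span \<Phi> - (\<Union>\<alpha>\<in>\<Phi>. {x. x \<bullet> \<alpha> = 0}))"

definition coxeter_complex :: "'v::euclidean_space set \<Rightarrow> 'v set set"
  where "coxeter_complex \<Phi> = {C. C \<noteq> {} \<and> (\<exists>D\<in>chambers \<Phi>. C face_of D)}"

text \<open>The simple roots of a chamber are the roots that are inner normals of its facets.\<close>

definition simple_roots :: "'v::euclidean_space set \<Rightarrow> 'v set \<Rightarrow> 'v set"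
  where "simple_roots \<Phi> D =
    {\<alpha>\<in>\<Phi>. (\<forall>x\<in>D. x \<bullet> \<alpha> \<ge> 0) \<and> (D \<inter> {x. x \<bullet> \<alpha> = 0}) facet_of D}"

text \<open>\<open>\<Phi>\<close> has rank \<open>d\<close>, and \<open>\<alpha> 1, \<dots>, \<alpha> d\<close> are the simple roots of the chamber \<open>D\<close>.\<close>

definition chamber_with_simple_roots ::
    "'v::euclidean_space set \<Rightarrow> nat \<Rightarrow> 'v set \<Rightarrow> (nat \<Rightarrow> 'v) \<Rightarrow> bool"
  where "chamber_with_simple_roots \<Phi> d D \<alpha> \<longleftrightarrow>
    dim (span \<Phi>) = d \<and> D \<in> chambers \<Phi> \<and> bij_betw \<alpha> {1..d} (simple_roots \<Phi> D)"

definition coroot :: "'v::euclidean_space \<Rightarrow> 'v"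
  where "coroot \<alpha> = (2 / (\<alpha> \<bullet> \<alpha>)) *\<^sub>R \<alpha>"

definition cartan :: "(nat \<Rightarrow> 'v::euclidean_space) \<Rightarrow> nat \<Rightarrow> nat \<Rightarrow> real"
  where "cartan \<alpha> i j = coroot (\<alpha> i) \<bullet> \<alpha> j"

definition dynkin_neighbors :: "nat \<Rightarrow> (nat \<Rightarrow> 'v::euclidean_space) \<Rightarrow> nat \<Rightarrow> nat set"
  where "dynkin_neighbors d \<alpha> i = {j\<in>{1..d}. j \<noteq> i \<and> cartan \<alpha> i j \<noteq> 0}"

text \<open>The weight is required to lie in \<open>V\<close>; as the simple roots form a basis of \<open>V\<close>, this
  determines it uniquely.\<close>

definition fundamental_weight ::
    "'v::euclidean_space set \<Rightarrow> nat \<Rightarrow> (nat \<Rightarrow> 'v) \<Rightarrow> nat \<Rightarrow> 'v"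
  where "fundamental_weight \<Phi> d \<alpha> i =
    (THE x. x \<in> span \<Phi> \<and> (\<forall>j\<in>{1..d}. x \<bullet> coroot (\<alpha> j) = (if j = i then 1 else 0)))"

definition weight_orbit ::
    "'v::euclidean_space set \<Rightarrow> nat \<Rightarrow> (nat \<Rightarrow> 'v) \<Rightarrow> 'v set"
  where "weight_orbit \<Phi> d \<alpha> =
    {w (fundamental_weight \<Phi> d \<alpha> i) | w i. w \<in> carrier (reflection_group \<Phi>) \<and> i \<in> {1..d}}"

definition piecewise_linear_on_fan :: "'v::euclidean_space set \<Rightarrow> ('v \<Rightarrow> real) \<Rightarrow> bool"
  where "piecewise_linear_on_fan \<Phi> f \<longleftrightarrow>
    continuous_on (span \<Phi>) f \<and>
    (\<forall>C\<in>coxeter_complex \<Phi>. \<exists>g. linear g \<and> (\<forall>x\<in>C. f x = g x))"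

text \<open>The piecewise linear extension \<open>f\<close> of \<open>h\<close> is unique on \<open>span \<Phi>\<close>, since the rays of the
  fan are spanned by the elements of the weight orbit; its values off \<open>span \<Phi>\<close> are irrelevant.\<close>

definition submodular ::
    "'v::euclidean_space set \<Rightarrow> nat \<Rightarrow> (nat \<Rightarrow> 'v) \<Rightarrow> ('v \<Rightarrow> real) \<Rightarrow> bool"
  where "submodular \<Phi> d \<alpha> h \<longleftrightarrow>
    (\<exists>f. piecewise_linear_on_fan \<Phi> f \<and> (\<forall>x\<in>weight_orbit \<Phi> d \<alpha>. f x = h x) \<and>
      convex_on (span \<Phi>) f)"

text \<open>A function on the weight orbit is represented by its extension by zero to the whole type.\<close>

definition SF ::
    "'v::euclidean_space set \<Rightarrow> nat \<Rightarrow> (nat \<Rightarrow> 'v) \<Rightarrow> ('v \<Rightarrow> real) set"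
  where "SF \<Phi> d \<alpha> = {h. (\<forall>x. x \<notin> weight_orbit \<Phi> d \<alpha> \<longrightarrow> h x = 0) \<and> submodular \<Phi> d \<alpha> h}"

text \<open>For convex cones only: \<open>facet_of\<close> is restricted to Euclidean spaces. A nonempty face of a
  convex cone contains 0, so its affine dimension is the dimension of its linear span.\<close>

definition cone_facets :: "'a::real_vector set \<Rightarrow> 'a set set"
  where "cone_facets K = {F. F face_of K \<and> F \<noteq> {} \<and> dim F + 1 = dim K}"

text \<open>The action of \<open>w\<close> on functions is \<open>(w \<cdot> h) \<lambda> = h (w\<^sup>-\<^sup>1 \<lambda>)\<close>, and on sets of functions it
  is elementwise.\<close>

definition act :: "('v \<Rightarrow> 'v) \<Rightarrow> ('v \<Rightarrow> real) \<Rightarrow> ('v \<Rightarrow> real)"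
  where "act w h = (\<lambda>x. h (inv_into UNIV w x))"

definition act_set :: "('v \<Rightarrow> 'v) \<Rightarrow> ('v \<Rightarrow> real) set \<Rightarrow> ('v \<Rightarrow> real) set"
  where "act_set w F = act w ` F"


text \<open>The classical root systems, with \<open>d\<close> the cardinality of the index type.
  For \<open>d = 1\<close> the sets \<open>roots_A\<close> and \<open>roots_D\<close> are empty, of rank 0.\<close>

abbreviation std_basis :: "'n::finite \<Rightarrow> real ^ 'n"
  where "std_basis i \<equiv> axis i 1"

definition roots_A :: "(real ^ 'n) set"
  where "roots_A = {s *\<^sub>R (std_basis i - std_basis j) | s i j. s \<in> {1, -1} \<and> i \<noteq> j}"

definition roots_D :: "(real ^ 'n) set"
  where "roots_D = {s *\<^sub>R std_basis i + t *\<^sub>R std_basis j | s t i j.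
    s \<in> {1, -1} \<and> t \<in> {1, -1} \<and> i \<noteq> j}"

definition roots_B :: "(real ^ 'n) set"
  where "roots_B = roots_D \<union> {s *\<^sub>R std_basis i | s i. s \<in> {1, -1}}"

definition roots_C :: "(real ^ 'n) set"
  where "roots_C = roots_D \<union> {(2 * s) *\<^sub>R std_basis i | s i. s \<in> {1, -1}}"

end

theory Submission
  imports Defs
begin

text \<open>The piecewise linear extension of \<open>h\<close> is the maximum of its linear pieces, hence convex, iff it
  is convex across every wall of the fan. For the wall \<open>w D \<inter> w (s i D)\<close> this is the inequality
  \<open>h (w \<omega>\<^sub>i) + h (w s\<^sub>i \<omega>\<^sub>i) + \<Sum>\<^bsub>j\<in>N(i)\<^esub> A\<^bsub>ji\<^esub> h (w \<omega>\<^sub>j) \<ge> 0\<close>, whose left-hand side determines \<open>i\<close> and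
  the images under \<open>w\<close> of the weights \<open>\<omega>\<^sub>j\<close> with \<open>j \<in> N(i)\<close>, that is, a coset of the parabolic
  subgroup \<open>W\<^bsub>[d] - N(i)\<^esub>\<close>. None of these inequalities is redundant: adding a small dent to the
  support function of the orbit polytope of \<open>\<Sum>\<^bsub>m\<noteq>i\<^esub> \<omega>\<^sub>m\<close> yields a function for which exactly one of
  them is an equality. In the classical types the cosets are counted as vectors with prescribed
  coordinate values, whose dominant representatives correspond to the simple roots.\<close>

section \<open>Reflections and the groups they generate\<close>

text \<open>Each wall inequality comes from one relation: \<omega> i + s i (\<omega> i) = 2 \<omega>
  i - \<alpha> i, and \<alpha> i has the coordinates \<open>A j i\<close> in the weight basis, so
  this sum is a nonnegative combination of the weights \<omega> j with j in N(i). That walls suffice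
  for convexity follows from a walk: each step across a wall towards x raises the linear piece
  evaluated at x. The count rests on the fact that the stabilizer of a dominant vector is generated
  by the simple reflections fixing it, which is obtained by shortening words. Simple roots are given
  as facet normals of an arbitrary chamber, so a positive system is first recovered from a regular
  point of that chamber. The cone lies in an infinite-dimensional space of functions; its faces are
  therefore studied abstractly, for cones inside the span of a finite set. In the classical types an
  arbitrary chamber is put into standard form by reordering the standard basis according to its
  regular point, with sign changes in types B, C and D.\<close>

lemma reflection_coroot: "reflection a x = x - (x \<bullet> coroot a) *\<^sub>R a"
  by (simp add: reflection_def coroot_def)

lemma linear_reflection: "linear (reflection a)"
  by (rule linearI) (simp_all add: reflection_coroot inner_add_left scaleR_add_left scaleR_diff_right)

lemma inner_coroot_self: "a \<noteq> 0 \<Longrightarrow> a \<bullet> coroot a = 2"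
  by (simp add: coroot_def)

lemma reflection_self: "reflection a a = - a"
  by (cases "a = 0") (simp_all add: reflection_coroot inner_coroot_self scaleR_2)

lemma reflection_inner_coroot: "a \<noteq> 0 \<Longrightarrow> reflection a x \<bullet> coroot a = - (x \<bullet> coroot a)"
  by (simp add: reflection_coroot inner_diff_left inner_coroot_self)

lemma reflection_involution [simp]: "reflection a (reflection a x) = x"
proof (cases "a = 0")
  case False
  then show ?thesis
    unfolding reflection_coroot[of a "reflection a x"] reflection_inner_coroot[OF False]
    by (simp add: reflection_coroot)
qed (simp add: reflection_def)

lemma reflection_inner: "reflection a x \<bullet> reflection a y = x \<bullet> y"
proof (cases "a = 0")
  case False
  define c where "c z = 2 * (z \<bullet> a) / (a \<bullet> a)" for z
  have c: "c z * (a \<bullet> a) = 2 * (z \<bullet> a)" for z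
    using False by (simp add: c_def)
  have "reflection a x \<bullet> reflection a y
      = x \<bullet> y - c y * (x \<bullet> a) - c x * (y \<bullet> a) + c x * (c y * (a \<bullet> a))"
    by (simp add: reflection_def c_def inner_diff_left inner_diff_right inner_commute[of a y])
  also have "c x * (c y * (a \<bullet> a)) = c x * (y \<bullet> a) + c y * (x \<bullet> a)"
    by (simp add: c c_def)
  finally show ?thesis by simp
qed (simp add: reflection_def)

lemma reflection_inner_commute: "reflection a x \<bullet> y = x \<bullet> reflection a y"
  by (metis reflection_inner reflection_involution)

lemma reflection_minus: "reflection (- a) = reflection a"
  by (simp add: reflection_def fun_eq_iff)

lemma reflection_fixes: "x \<bullet> a = 0 \<Longrightarrow> reflection a x = x"
  by (simp add: reflection_def)

lemma reflection_image:
  assumes "linear u" "\<And>x y. u x \<bullet> u y = x \<bullet> y"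
  shows "u (reflection a x) = reflection (u a) (u x)"
  using assms by (simp add: reflection_def linear_diff linear_scale)

lemma inner_coroot_eq_0_iff: "x \<bullet> coroot a = 0 \<longleftrightarrow> x \<bullet> a = 0"
  by (auto simp: coroot_def)

text \<open>Words supply the induction variable for \<open>deletion\<close> and
  \<open>W0_dominant\<close>, where their length decreases.\<close>

primrec reflection_word :: "'v::euclidean_space list \<Rightarrow> 'v \<Rightarrow> 'v" where
  "reflection_word [] = id"
| "reflection_word (a # as) = reflection a \<circ> reflection_word as"

lemma reflection_word_append:
  "reflection_word (as @ bs) = reflection_word as \<circ> reflection_word bs"
  by (induction as) (simp_all add: comp_assoc)

lemma reflection_word_rev: "reflection_word (rev as) \<circ> reflection_word as = id"
proof (induction as)
  case (Cons a as)
  then show ?case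
    by (simp add: reflection_word_append fun_eq_iff)
qed simp

lemma bij_reflection: "bij (reflection a)"
  by (rule involuntory_imp_bij) simp

abbreviation refl_grp :: "'v::euclidean_space set \<Rightarrow> ('v \<Rightarrow> 'v) set"
  where "refl_grp S \<equiv> carrier (reflection_group S)"

lemma reflection_in_Bij: "reflection a \<in> Bij UNIV"
  using bij_reflection by (simp add: Bij_def)

lemma inv_reflection_BijGroup: "inv\<^bsub>BijGroup UNIV\<^esub> (reflection a) = reflection a"
  by (rule group.inv_equality[OF group_BijGroup])
    (auto simp: BijGroup_def reflection_in_Bij fun_eq_iff compose_def)

lemma refl_grp_words: "refl_grp S = {reflection_word as | as. set as \<subseteq> S}"
proof -
  have mult: "f \<otimes>\<^bsub>BijGroup UNIV\<^esub> g = f \<circ> g" if "f \<in> Bij UNIV" "g \<in> Bij UNIV" for f g :: "'a \<Rightarrow> 'a"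
    using that by (simp add: BijGroup_def compose_def fun_eq_iff)
  have word_Bij: "reflection_word as \<in> Bij UNIV" for as :: "'a list"
  proof -
    have "bij (reflection_word as)"
      by (induction as) (metis reflection_word.simps bij_id bij_comp bij_reflection)+
    then show ?thesis by (simp add: Bij_def)
  qed
  have one: "\<one>\<^bsub>BijGroup UNIV\<^esub> = (id :: 'a \<Rightarrow> 'a)"
    by (simp add: BijGroup_def fun_eq_iff)
  have "w \<in> {reflection_word as | as. set as \<subseteq> S}"
    if "w \<in> generate (BijGroup UNIV) (reflection ` S)" for w
    using that
  proof (induction rule: generate.induct)
    case one
    show ?case by (auto simp: \<open>\<one>\<^bsub>BijGroup UNIV\<^esub> = id\<close> intro!: exI[of _ "[]"])
  next
    case (incl h)
    then obtain a where "a \<in> S" "h = reflection a" by auto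
    then show ?case by (auto intro!: exI[of _ "[a]"])
  next
    case (inv h)
    then obtain a where "a \<in> S" "h = reflection a" by auto
    then show ?case by (auto intro!: exI[of _ "[a]"] simp: inv_reflection_BijGroup)
  next
    case (eng h1 h2)
    then obtain as bs where "h1 = reflection_word as" "h2 = reflection_word bs"
      "set as \<subseteq> S" "set bs \<subseteq> S" by auto
    then show ?case
      by (auto intro!: exI[of _ "as @ bs"] simp: reflection_word_append mult word_Bij)
  qed
  moreover have "reflection_word as \<in> generate (BijGroup UNIV) (reflection ` S)"
    if "set as \<subseteq> S" for as
    using that
  proof (induction as)
    case Nil
    show ?case using generate.one[of "BijGroup UNIV" "reflection ` S"] by (simp add: one id_def)
  next
    case (Cons a as)
    then show ?case
      using generate.eng[OF generate.incl[of "reflection a" "reflection ` S" "BijGroup UNIV"], of "reflection_word as"]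
      by (simp add: mult reflection_in_Bij word_Bij comp_def)
  qed
  ultimately show ?thesis
    by (auto simp: reflection_group_def)
qed

lemma refl_grp_id: "id \<in> refl_grp S"
  unfolding refl_grp_words by (auto intro!: exI[of _ "[]"])

lemma refl_grp_comp: "u \<in> refl_grp S \<Longrightarrow> w \<in> refl_grp S \<Longrightarrow> u \<circ> w \<in> refl_grp S"
  unfolding refl_grp_words
  by clarify (metis reflection_word_append set_append Un_subset_iff)

lemma refl_grp_reflection: "a \<in> S \<Longrightarrow> reflection a \<in> refl_grp S"
  unfolding refl_grp_words by (auto intro!: exI[of _ "[a]"])

lemma refl_grp_mono: "S \<subseteq> T \<Longrightarrow> refl_grp S \<subseteq> refl_grp T"
  unfolding refl_grp_words by blast

lemma refl_grp_induct [consumes 1, case_names id comp]: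
  assumes "w \<in> refl_grp S" "P id"
    and "\<And>a w. a \<in> S \<Longrightarrow> w \<in> refl_grp S \<Longrightarrow> P w \<Longrightarrow> P (reflection a \<circ> w)"
  shows "P w"
proof -
  have "P (reflection_word as)" if "set as \<subseteq> S" for as
    using that assms(2,3) by (induction as) (auto simp: refl_grp_words)
  then show ?thesis using assms(1) by (auto simp: refl_grp_words)
qed

lemma refl_grp_bij: "w \<in> refl_grp S \<Longrightarrow> bij w"
  by (induction rule: refl_grp_induct) (blast intro: bij_id bij_comp bij_reflection)+

lemma refl_grp_inv:
  assumes "w \<in> refl_grp S"
  shows "inv_into UNIV w \<in> refl_grp S"
proof -
  obtain as where as: "w = reflection_word as" "set as \<subseteq> S"
    using assms by (auto simp: refl_grp_words)
  have "reflection_word as \<circ> reflection_word (rev as) = id"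
    using reflection_word_rev[of "rev as"] by simp
  then have "inv_into UNIV w = reflection_word (rev as)"
    using reflection_word_rev[of as] by (auto simp: as intro: inv_unique_comp)
  then show ?thesis unfolding refl_grp_words using as(2)
    by (intro CollectI exI[of _ "rev as"]) simp
qed

lemma refl_grp_linear: "w \<in> refl_grp S \<Longrightarrow> linear w"
  by (induction rule: refl_grp_induct)
    (blast intro: linear_compose linear_reflection linear_id)+

lemma refl_grp_inner: "w \<in> refl_grp S \<Longrightarrow> w x \<bullet> w y = x \<bullet> y"
  by (induction rule: refl_grp_induct) (auto simp: reflection_inner)

lemma refl_grp_inner_inv: "w \<in> refl_grp S \<Longrightarrow> w x \<bullet> y = x \<bullet> inv_into UNIV w y"
  by (metis bij_inv_eq_iff refl_grp_bij refl_grp_inner)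

lemma refl_grp_fixes: "w \<in> refl_grp S \<Longrightarrow> (\<And>a. a \<in> S \<Longrightarrow> x \<bullet> a = 0) \<Longrightarrow> w x = x"
  by (induction rule: refl_grp_induct) (auto simp: reflection_fixes)

lemma refl_grp_conj_reflection:
  assumes "w \<in> refl_grp S"
  shows "w \<circ> reflection a = reflection (w a) \<circ> w"
  using reflection_image[of w a] refl_grp_linear[OF assms] refl_grp_inner[OF assms]
  by (auto simp: fun_eq_iff)

lemma refl_grp_stable:
  assumes "w \<in> refl_grp S" "\<And>a x. a \<in> S \<Longrightarrow> x \<in> T \<Longrightarrow> reflection a x \<in> T" "x \<in> T"
  shows "w x \<in> T"
  using assms by (induction rule: refl_grp_induct) auto

lemma card_refl_grp_pos: "finite (refl_grp S) \<Longrightarrow> card (refl_grp S) > 0"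
  using refl_grp_id[of S] by (auto simp: card_gt_0_iff)

text \<open>Orbit-stabilizer counting: the fibre of \<open>F\<close> through \<open>u\<close> is the
  left translate of \<open>H\<close> by \<open>u\<close>, so all fibres have the size of
  \<open>H\<close>. It is applied to wall functionals and to orbits of vectors.\<close>

lemma card_image_cosets:
  assumes fin: "finite (refl_grp S)" and sub: "H \<subseteq> refl_grp S"
    and F: "\<And>u w. u \<in> refl_grp S \<Longrightarrow> w \<in> refl_grp S \<Longrightarrow> F u = F w \<longleftrightarrow> inv_into UNIV u \<circ> w \<in> H"
  shows "card (refl_grp S) = card (F ` refl_grp S) * card H"
proof -
  have fibre: "card {w \<in> refl_grp S. F w = y} = card H" if "y \<in> F ` refl_grp S" for y
  proof -
    obtain u where u: "u \<in> refl_grp S" "y = F u" using \<open>y \<in> F ` refl_grp S\<close> by auto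
    have b': "inv_into UNIV u \<circ> (u \<circ> h) = h" "u \<circ> (inv_into UNIV u \<circ> h) = h" for h
      using refl_grp_bij[OF u(1)] by (simp_all add: fun_eq_iff bij_is_inj bij_is_surj surj_f_inv_f)
    have "bij_betw (\<lambda>h. u \<circ> h) H {w \<in> refl_grp S. F w = y}"
    proof (rule bij_betwI[where g = "\<lambda>w. inv_into UNIV u \<circ> w"])
      show "(\<lambda>h. u \<circ> h) \<in> H \<rightarrow> {w \<in> refl_grp S. F w = y}"
        using sub u refl_grp_comp[OF u(1)] F[OF u(1) refl_grp_comp[OF u(1)], unfolded b', symmetric]
        by (auto simp del: o_apply dest: subsetD)
      show "(\<lambda>w. inv_into UNIV u \<circ> w) \<in> {w \<in> refl_grp S. F w = y} \<rightarrow> H"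
        using u F[OF u(1)] by force
    qed (use b' in auto)
    then show ?thesis by (rule bij_betw_same_card[symmetric])
  qed
  have "card (refl_grp S) = (\<Sum>y\<in>F ` refl_grp S. card {w \<in> refl_grp S. F w = y})"
    using sum.image_gen[OF fin, of "\<lambda>_. 1 :: nat" F] by simp
  then show ?thesis using fibre by simp
qed

section \<open>Chambers and simple roots\<close>

text \<open>A nonnegative product encodes weakly equal signs. For \<open>x\<close> off all root
  hyperplanes this is the closed chamber around \<open>x\<close>.\<close>

definition sign_cell :: "'v::euclidean_space set \<Rightarrow> 'v \<Rightarrow> 'v set"
  where "sign_cell \<Phi> x = {y \<in> span \<Phi>. \<forall>\<beta>\<in>\<Phi>. 0 \<le> (x \<bullet> \<beta>) * (y \<bullet> \<beta>)}"

text \<open>A point of the closed cell enters the open one when a small positive multiple of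
  \<open>x\<close> is added.\<close>

lemma sign_cell_eq_closure:
  assumes x: "x \<in> span \<Phi>" "\<And>\<beta>. \<beta> \<in> \<Phi> \<Longrightarrow> x \<bullet> \<beta> \<noteq> 0"
  shows "closure {y \<in> span \<Phi>. \<forall>\<beta>\<in>\<Phi>. 0 < (x \<bullet> \<beta>) * (y \<bullet> \<beta>)} = sign_cell \<Phi> x"
    (is "closure ?U = _")
proof
  have "closed (sign_cell \<Phi> x)"
  proof -
    have "sign_cell \<Phi> x = span \<Phi> \<inter> (\<Inter>\<beta>\<in>\<Phi>. {y. 0 \<le> (x \<bullet> \<beta>) * (y \<bullet> \<beta>)})"
      by (auto simp: sign_cell_def)
    moreover have "closed {y. 0 \<le> (x \<bullet> \<beta>) * (y \<bullet> \<beta>)}" for \<beta>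
      by (intro closed_Collect_le continuous_intros)
    ultimately show ?thesis
      by (simp only:) (intro closed_Int closed_INT ballI closed_span)
  qed
  then show "closure ?U \<subseteq> sign_cell \<Phi> x"
    by (intro closure_minimal) (auto simp: sign_cell_def less_imp_le)
next
  show "sign_cell \<Phi> x \<subseteq> closure ?U"
  proof
    fix y assume y: "y \<in> sign_cell \<Phi> x"
    show "y \<in> closure ?U"
      unfolding closure_approachable
    proof (intro allI impI)
      fix e :: real assume "e > 0"
      \<comment> \<open>The summand 1 keeps the denominator positive even if \<open>x\<close> is 0,
        as happens in rank 0.\<close>
      define \<epsilon> where "\<epsilon> = e / (norm x + 1)"
      have "\<epsilon> > 0" unfolding \<epsilon>_def using \<open>e > 0\<close> by (simp add: add_nonneg_pos)
      have "\<epsilon> * norm x < e"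
        unfolding \<epsilon>_def using \<open>e > 0\<close> by (simp add: divide_less_eq add_nonneg_pos)
      moreover have "y + \<epsilon> *\<^sub>R x \<in> ?U"
      proof -
        have "0 < (x \<bullet> \<beta>) * ((y + \<epsilon> *\<^sub>R x) \<bullet> \<beta>)" if "\<beta> \<in> \<Phi>" for \<beta>
        proof -
          have "0 < \<epsilon> * ((x \<bullet> \<beta>) * (x \<bullet> \<beta>))"
            using x(2)[OF that] \<open>\<epsilon> > 0\<close> by (auto simp: zero_less_mult_iff linorder_neq_iff)
          moreover have "0 \<le> (x \<bullet> \<beta>) * (y \<bullet> \<beta>)"
            using y that by (auto simp: sign_cell_def)
          ultimately show ?thesis by (simp add: inner_add_left distrib_left mult.left_commute)
        qed
        then show ?thesis
          using y x(1) by (simp add: sign_cell_def span_add span_scale)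
      qed
      ultimately show "\<exists>z\<in>?U. dist z y < e"
        using \<open>\<epsilon> > 0\<close> by (intro bexI[of _ "y + \<epsilon> *\<^sub>R x"]) (auto simp: dist_norm)
    qed
  qed
qed

text \<open>Open sign cells are convex, hence connected; conversely, a connected set with points on
  both sides of a root hyperplane meets that hyperplane.\<close>

lemma chambers_eq_sign_cells:
  "chambers \<Phi> = {sign_cell \<Phi> x | x. x \<in> span \<Phi> \<and> (\<forall>\<beta>\<in>\<Phi>. x \<bullet> \<beta> \<noteq> 0)}"
proof -
  define U where "U = span \<Phi> - (\<Union>\<alpha>\<in>\<Phi>. {x. x \<bullet> \<alpha> = 0})"
  have comp: "connected_component_set U x = {y \<in> span \<Phi>. \<forall>\<beta>\<in>\<Phi>. 0 < (x \<bullet> \<beta>) * (y \<bullet> \<beta>)}"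
    (is "_ = ?C") if "x \<in> U" for x
  proof
    show "?C \<subseteq> connected_component_set U x"
    proof (rule connected_component_maximal)
      show "x \<in> ?C" using that by (auto simp: U_def simp flip: power2_eq_square)
      have "?C = span \<Phi> \<inter> (\<Inter>\<beta>\<in>\<Phi>. {y. ((x \<bullet> \<beta>) *\<^sub>R \<beta>) \<bullet> y > 0})"
        by (auto simp: inner_commute)
      moreover have "convex \<dots>"
        by (intro convex_Int convex_INT convex_halfspace_gt subspace_imp_convex subspace_span)
      ultimately show "connected ?C"
        by (simp add: convex_connected)
      show "?C \<subseteq> U" by (auto simp: U_def)
    qed
  next
    show "connected_component_set U x \<subseteq> ?C"
    proof clarify
      fix y assume "connected_component U x y"
      then have y: "y \<in> connected_component_set U x" by simp
      then have sub: "connected_component_set U x \<subseteq> U" "y \<in> U"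
        using connected_component_subset by auto
      have x: "x \<in> connected_component_set U x" using that by simp
      have "0 < (x \<bullet> \<beta>) * (y \<bullet> \<beta>)" if "\<beta> \<in> \<Phi>" for \<beta>
      proof (rule ccontr)
        assume neg: "\<not> ?thesis"
        have "\<exists>z\<in>connected_component_set U x. \<beta> \<bullet> z = 0"
        proof (cases "x \<bullet> \<beta> \<le> 0")
          case True
          have "y \<bullet> \<beta> \<ge> 0"
          proof (rule ccontr)
            assume "\<not> y \<bullet> \<beta> \<ge> 0"
            moreover have "x \<bullet> \<beta> < 0" using True \<open>x \<in> U\<close> \<open>\<beta> \<in> \<Phi>\<close> by (force simp: U_def)
            ultimately show False using neg by (simp add: mult_neg_neg)
          qed
          with True show ?thesis
            using connected_ivt_hyperplane[OF connected_connected_component x y, of \<beta> 0]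
            by (simp add: inner_commute)
        next
          case False
          then have "y \<bullet> \<beta> \<le> 0"
            using neg by (smt (verit) mult_pos_pos)
          with False show ?thesis
            using connected_ivt_hyperplane[OF connected_connected_component y x, of \<beta> 0]
            by (simp add: inner_commute)
        qed
        then show False
          using sub(1) that by (force simp: U_def inner_commute)
      qed
      then show "y \<in> span \<Phi> \<and> (\<forall>\<beta>\<in>\<Phi>. 0 < (x \<bullet> \<beta>) * (y \<bullet> \<beta>))"
        using sub(2) by (auto simp: U_def)
    qed
  qed
  have "closure (connected_component_set U x) = sign_cell \<Phi> x" if "x \<in> U" for x
    unfolding comp[OF that] using that by (intro sign_cell_eq_closure) (auto simp: U_def)
  moreover have "x \<in> U \<longleftrightarrow> x \<in> span \<Phi> \<and> (\<forall>\<beta>\<in>\<Phi>. x \<bullet> \<beta> \<noteq> 0)" for x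
    by (auto simp: U_def)
  ultimately show ?thesis
    unfolding chambers_def U_def[symmetric] components_def image_image
    by (simp only: image_def) (metis (no_types, lifting))
qed

text \<open>The perturbation argument behind interior points, spans of faces and facet witnesses:
  finitely many positive values, suitably scaled, outweigh any other values.\<close>

lemma ex_scale_pos:
  fixes f g :: "'a \<Rightarrow> real"
  assumes "finite L" "\<And>l. l \<in> L \<Longrightarrow> f l > 0"
  shows "\<exists>C>0. \<forall>l\<in>L. C * f l + g l > 0"
proof (intro exI conjI ballI)
  \<comment> \<open>The summands give \<open>?C * f l \<ge> f l + \<bar>g l\<bar>\<close>; the 1
    makes the result strict and covers an empty \<open>L\<close>.\<close>
  let ?C = "1 + (\<Sum>l\<in>L. \<bar>g l\<bar> / f l)"
  have "0 \<le> (\<Sum>l\<in>L. \<bar>g l\<bar> / f l)"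
    using assms(2) by (intro sum_nonneg divide_nonneg_pos) auto
  then show "?C > 0" by simp
  fix l assume l: "l \<in> L"
  have "\<bar>g l\<bar> / f l \<le> (\<Sum>l\<in>L. \<bar>g l\<bar> / f l)"
    using assms l by (intro member_le_sum divide_nonneg_pos) auto
  then have "(1 + \<bar>g l\<bar> / f l) * f l \<le> ?C * f l"
    using assms(2)[OF l] by (intro mult_right_mono) auto
  moreover have "(1 + \<bar>g l\<bar> / f l) * f l = f l + \<bar>g l\<bar>"
    using assms(2)[OF l] by (simp add: field_simps)
  ultimately show "?C * f l + g l > 0" using assms(2)[OF l] by linarith
qed

lemma orthogonal_span_zero:
  assumes "x \<in> span S" "\<And>y. y \<in> S \<Longrightarrow> x \<bullet> y = 0"
  shows "x = (0 :: 'a::euclidean_space)"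
proof -
  have "orthogonal x x"
    by (rule orthogonal_to_span[OF assms(1)]) (simp add: assms(2) orthogonal_def)
  then show ?thesis by (simp add: orthogonal_def)
qed

locale rooted_chamber =
  fixes \<Phi> :: "'v::euclidean_space set" and d :: nat and D :: "'v set" and \<alpha> :: "nat \<Rightarrow> 'v"
  assumes root_system: "root_system \<Phi>"
    and chamber: "chamber_with_simple_roots \<Phi> d D \<alpha>"
begin

abbreviation "s i \<equiv> reflection (\<alpha> i)"
abbreviation "W \<equiv> refl_grp \<Phi>"

lemma finite_roots: "finite \<Phi>" and zero_not_root: "0 \<notin> \<Phi>"
  and reduced: "\<beta> \<in> \<Phi> \<Longrightarrow> c *\<^sub>R \<beta> \<in> \<Phi> \<Longrightarrow> c *\<^sub>R \<beta> = \<beta> \<or> c *\<^sub>R \<beta> = - \<beta>"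
  and minus_root: "\<beta> \<in> \<Phi> \<Longrightarrow> - \<beta> \<in> \<Phi>"
  and reflection_root: "\<beta> \<in> \<Phi> \<Longrightarrow> \<gamma> \<in> \<Phi> \<Longrightarrow> reflection \<beta> \<gamma> \<in> \<Phi>"
  using root_system unfolding root_system_def by blast+

lemma W_root: "w \<in> W \<Longrightarrow> \<beta> \<in> \<Phi> \<Longrightarrow> w \<beta> \<in> \<Phi>"
  by (rule refl_grp_stable) (auto intro: reflection_root)

lemma W_span: "w \<in> W \<Longrightarrow> x \<in> span \<Phi> \<Longrightarrow> w x \<in> span \<Phi>"
  by (erule refl_grp_stable)
    (auto simp: reflection_coroot intro: span_diff span_scale span_base)

text \<open>A regular point of \<open>D\<close>. It orders the roots into positive and negative
  ones, which the definition of simple roots by facets does not do by itself.\<close>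

definition base_point :: 'v where
  "base_point = (SOME x. x \<in> span \<Phi> \<and> (\<forall>\<beta>\<in>\<Phi>. x \<bullet> \<beta> \<noteq> 0) \<and> D = sign_cell \<Phi> x)"

lemma base_point: "base_point \<in> span \<Phi>" "\<beta> \<in> \<Phi> \<Longrightarrow> base_point \<bullet> \<beta> \<noteq> 0"
  "D = sign_cell \<Phi> base_point"
proof -
  have "\<exists>x. x \<in> span \<Phi> \<and> (\<forall>\<beta>\<in>\<Phi>. x \<bullet> \<beta> \<noteq> 0) \<and> D = sign_cell \<Phi> x"
    using chamber unfolding chamber_with_simple_roots_def chambers_eq_sign_cells by blast
  from someI_ex[OF this, folded base_point_def]
  show "base_point \<in> span \<Phi>" "\<beta> \<in> \<Phi> \<Longrightarrow> base_point \<bullet> \<beta> \<noteq> 0" "D = sign_cell \<Phi> base_point"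
    by auto
qed

definition pos_roots :: "'v set" where "pos_roots = {\<beta> \<in> \<Phi>. base_point \<bullet> \<beta> > 0}"

lemma pos_roots_subset: "pos_roots \<subseteq> \<Phi>" and finite_pos_roots: "finite pos_roots"
  using finite_roots by (auto simp: pos_roots_def)

lemma pos_or_neg: "\<beta> \<in> \<Phi> \<Longrightarrow> \<beta> \<in> pos_roots \<or> - \<beta> \<in> pos_roots"
  using base_point(2)[of \<beta>] minus_root[of \<beta>] by (auto simp: pos_roots_def)

lemma mem_D_pos: "y \<in> D \<longleftrightarrow> y \<in> span \<Phi> \<and> (\<forall>\<beta>\<in>pos_roots. y \<bullet> \<beta> \<ge> 0)"
proof -
  have "(\<forall>\<beta>\<in>\<Phi>. 0 \<le> (base_point \<bullet> \<beta>) * (y \<bullet> \<beta>)) \<longleftrightarrow> (\<forall>\<beta>\<in>pos_roots. y \<bullet> \<beta> \<ge> 0)" for y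
  proof
    assume "\<forall>\<beta>\<in>\<Phi>. 0 \<le> (base_point \<bullet> \<beta>) * (y \<bullet> \<beta>)"
    then show "\<forall>\<beta>\<in>pos_roots. y \<bullet> \<beta> \<ge> 0"
      by (auto simp: pos_roots_def zero_le_mult_iff)
  next
    assume *: "\<forall>\<beta>\<in>pos_roots. y \<bullet> \<beta> \<ge> 0"
    show "\<forall>\<beta>\<in>\<Phi>. 0 \<le> (base_point \<bullet> \<beta>) * (y \<bullet> \<beta>)"
    proof
      fix \<beta> assume "\<beta> \<in> \<Phi>"
      then show "0 \<le> (base_point \<bullet> \<beta>) * (y \<bullet> \<beta>)"
        using pos_or_neg[of \<beta>] bspec[OF *, of \<beta>] bspec[OF *, of "- \<beta>"]
        by (auto simp: pos_roots_def zero_le_mult_iff)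
    qed
  qed
  moreover have "y \<in> D \<longleftrightarrow> y \<in> sign_cell \<Phi> base_point"
    using base_point(3) by blast
  ultimately show ?thesis by (simp add: sign_cell_def)
qed

text \<open>Adding a large multiple of \<open>base_point\<close> moves any vector of the span into
  \<open>D\<close>, so \<open>D\<close> is full-dimensional there. The facet criterion used next is
  stated relative to this hull.\<close>

lemma affine_hull_D: "affine hull D = span \<Phi>"
proof -
  have "0 \<in> D" by (simp add: mem_D_pos span_zero)
  have "span \<Phi> \<subseteq> span D"
  proof
    fix v assume v: "v \<in> span \<Phi>"
    obtain C where "C > 0" "\<forall>\<beta>\<in>pos_roots. C * (base_point \<bullet> \<beta>) + v \<bullet> \<beta> > 0"
      using ex_scale_pos[OF finite_pos_roots, of "\<lambda>\<beta>. base_point \<bullet> \<beta>" "\<lambda>\<beta>. v \<bullet> \<beta>"]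
      by (auto simp: pos_roots_def)
    then have "C *\<^sub>R base_point + v \<in> D"
      using v base_point(1) by (auto simp: mem_D_pos inner_add_left less_imp_le intro!: span_add span_scale)
    moreover have "base_point \<in> D"
      using base_point(1) by (auto simp: mem_D_pos pos_roots_def)
    ultimately have "(C *\<^sub>R base_point + v) - C *\<^sub>R base_point \<in> span D"
      by (intro span_scale span_diff span_base)
    then show "v \<in> span D" by simp
  qed
  moreover have "span D \<subseteq> span \<Phi>"
    by (intro span_minimal subspace_span) (auto simp: mem_D_pos)
  ultimately show ?thesis
    using \<open>0 \<in> D\<close> by (simp add: affine_hull_span_0 hull_inc)
qed

text \<open>An irredundant subfamily of the half spaces of the positive roots still cuts out \<open>D\<close>, and
  its members define facets.\<close>

lemma D_eq_simple_roots: "D = {y \<in> span \<Phi>. \<forall>\<sigma>\<in>simple_roots \<Phi> D. y \<bullet> \<sigma> \<ge> 0}"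
proof
  show "D \<subseteq> {y \<in> span \<Phi>. \<forall>\<sigma>\<in>simple_roots \<Phi> D. y \<bullet> \<sigma> \<ge> 0}"
    by (auto simp: simple_roots_def mem_D_pos)
next
  define cuts where "cuts \<Psi> \<longleftrightarrow> \<Psi> \<subseteq> pos_roots \<and> D = {y \<in> span \<Phi>. \<forall>\<beta>\<in>\<Psi>. y \<bullet> \<beta> \<ge> 0}" for \<Psi>
  \<comment> \<open>Minimal cardinality supplies the irredundancy demanded by
    \<open>facet_of_polyhedron_explicit\<close>.\<close>
  define \<Psi> where "\<Psi> = arg_min card cuts"
  have "cuts pos_roots" by (auto simp: cuts_def mem_D_pos)
  then have \<Psi>: "cuts \<Psi>" and min: "\<And>\<Psi>'. cuts \<Psi>' \<Longrightarrow> card \<Psi> \<le> card \<Psi>'"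
    unfolding \<Psi>_def using arg_min_nat_lemma[of cuts pos_roots card] by auto
  have fin: "finite \<Psi>" using \<Psi> finite_pos_roots by (auto simp: cuts_def intro: finite_subset)
  define h where "h \<beta> = {x. (- \<beta>) \<bullet> x \<le> 0}" for \<beta> :: 'v
  \<comment> \<open>The facet criterion is indexed by half spaces with outer normals, so a root is
    chosen back for each half space and its sign reversed.\<close>
  define a where "a H = - (SOME \<beta>. \<beta> \<in> \<Psi> \<and> h \<beta> = H)" for H
  have a: "- a H \<in> \<Psi> \<and> h (- a H) = H" if "H \<in> h ` \<Psi>" for H
    using that someI_ex[of "\<lambda>\<beta>. \<beta> \<in> \<Psi> \<and> h \<beta> = H"] by (auto simp: a_def)
  have D_h: "(D = span \<Phi> \<inter> \<Inter> (h ` \<Psi>')) \<longleftrightarrow> D = {y \<in> span \<Phi>. \<forall>\<beta>\<in>\<Psi>'. y \<bullet> \<beta> \<ge> 0}" for \<Psi>'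
    by (simp add: h_def inner_commute Int_def)
  have facet: "C facet_of D \<longleftrightarrow> (\<exists>H. H \<in> h ` \<Psi> \<and> C = D \<inter> {x. a H \<bullet> x = 0})" for C
  proof (rule facet_of_polyhedron_explicit)
    show "finite (h ` \<Psi>)" using fin by simp
    show "D = affine hull D \<inter> \<Inter> (h ` \<Psi>)"
      using \<Psi> D_h[of \<Psi>] unfolding affine_hull_D cuts_def by blast
    show "a H \<noteq> 0 \<and> H = {x. a H \<bullet> x \<le> 0}" if "H \<in> h ` \<Psi>" for H
      using a[OF that] \<Psi> zero_not_root pos_roots_subset by (auto simp: h_def cuts_def)
    show "D \<subset> affine hull D \<inter> \<Inter> F'" if "F' \<subset> h ` \<Psi>" for F'
    proof -
      define \<Psi>' where "\<Psi>' = {\<beta> \<in> \<Psi>. h \<beta> \<in> F'}"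
      have F': "F' = h ` \<Psi>'" using that by (auto simp: \<Psi>'_def)
      have "\<Psi>' \<subset> \<Psi>" using that unfolding \<Psi>'_def by blast
      then have "card \<Psi>' < card \<Psi>" using fin by (rule psubset_card_mono[rotated])
      then have "\<not> cuts \<Psi>'" using min by (meson not_less)
      then have "D \<noteq> span \<Phi> \<inter> \<Inter> F'"
        using \<Psi> \<open>\<Psi>' \<subset> \<Psi>\<close> D_h[of \<Psi>'] unfolding F' cuts_def by auto
      moreover have "D \<subseteq> span \<Phi> \<inter> \<Inter> F'"
        using \<Psi> \<open>\<Psi>' \<subset> \<Psi>\<close> D_h[of \<Psi>] unfolding F' cuts_def by auto
      ultimately show ?thesis by (auto simp: affine_hull_D)
    qed
  qed
  have "\<Psi> \<subseteq> simple_roots \<Phi> D"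
  proof
    fix \<beta> assume \<beta>: "\<beta> \<in> \<Psi>"
    have \<beta>D: "\<forall>x\<in>D. x \<bullet> \<beta> \<ge> 0" using \<beta> \<Psi> by (auto simp: cuts_def)
    have aH: "- a (h \<beta>) \<in> \<Psi>" "h (- a (h \<beta>)) = h \<beta>" using a \<beta> by auto
    \<comment> \<open>Equal half spaces have equal boundaries: compare the signs at \<open>x\<close>
      and at \<open>- x\<close>.\<close>
    have "x \<bullet> \<beta> = 0 \<longleftrightarrow> a (h \<beta>) \<bullet> x = 0" for x
    proof -
      have *: "x \<bullet> \<beta> \<ge> 0 \<longleftrightarrow> x \<bullet> (- a (h \<beta>)) \<ge> 0" for x
        using aH(2) unfolding h_def by (auto simp: set_eq_iff inner_commute)
      show ?thesis using *[of x] *[of "- x"] by (auto simp: inner_commute)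
    qed
    then have "D \<inter> {x. x \<bullet> \<beta> = 0} facet_of D"
      using facet \<beta> by auto
    then show "\<beta> \<in> simple_roots \<Phi> D"
      using \<beta> \<Psi> \<beta>D pos_roots_subset by (auto simp: simple_roots_def cuts_def)
  qed
  then show "{y \<in> span \<Phi>. \<forall>\<sigma>\<in>simple_roots \<Phi> D. y \<bullet> \<sigma> \<ge> 0} \<subseteq> D"
    using \<Psi> by (auto simp: cuts_def)
qed

lemma simple_roots_eq: "simple_roots \<Phi> D = \<alpha> ` {1..d}" and inj_\<alpha>: "inj_on \<alpha> {1..d}"
  and rank: "dim (span \<Phi>) = d"
  using chamber by (auto simp: chamber_with_simple_roots_def bij_betw_def)

lemma D_eq: "D = {x \<in> span \<Phi>. \<forall>i\<in>{1..d}. x \<bullet> \<alpha> i \<ge> 0}"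
  using D_eq_simple_roots unfolding simple_roots_eq by simp

lemma simple_is_root: "i \<in> {1..d} \<Longrightarrow> \<alpha> i \<in> \<Phi>"
  and simple_nonneg: "i \<in> {1..d} \<Longrightarrow> x \<in> D \<Longrightarrow> x \<bullet> \<alpha> i \<ge> 0"
proof -
  have "\<alpha> i \<in> simple_roots \<Phi> D" if "i \<in> {1..d}" using that simple_roots_eq by auto
  then show "i \<in> {1..d} \<Longrightarrow> \<alpha> i \<in> \<Phi>" "i \<in> {1..d} \<Longrightarrow> x \<in> D \<Longrightarrow> x \<bullet> \<alpha> i \<ge> 0"
    by (auto simp: simple_roots_def)
qed

lemma base_point_in_D: "base_point \<in> D"
  using base_point(1) by (auto simp: mem_D_pos pos_roots_def)

lemma simple_pos: "i \<in> {1..d} \<Longrightarrow> \<alpha> i \<in> pos_roots"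
  using simple_nonneg[OF _ base_point_in_D] base_point(2) simple_is_root
  by (force simp: pos_roots_def)

lemma simple_nonzero: "i \<in> {1..d} \<Longrightarrow> \<alpha> i \<noteq> 0" "i \<in> {1..d} \<Longrightarrow> \<alpha> i \<bullet> \<alpha> i > 0"
  using simple_is_root zero_not_root by fastforce+

text \<open>Such an \<open>x\<close> lies in \<open>D\<close> and in \<open>- D\<close>, so every
  positive root vanishes on it. Hence the simple roots span, and their number makes them a
  basis.\<close>

lemma simple_separate:
  assumes "x \<in> span \<Phi>" "\<And>i. i \<in> {1..d} \<Longrightarrow> x \<bullet> \<alpha> i = 0"
  shows "x = 0"
proof (rule orthogonal_span_zero[OF assms(1)])
  have "x \<in> D" "- x \<in> D" using assms by (auto simp: D_eq span_neg)
  then have "x \<bullet> \<beta> = 0" if "\<beta> \<in> pos_roots" for \<beta>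
    using that by (force simp: mem_D_pos)
  then show "x \<bullet> \<beta> = 0" if "\<beta> \<in> \<Phi>" for \<beta>
    using pos_or_neg[OF that] by force
qed

lemma span_simple: "span (\<alpha> ` {1..d}) = span \<Phi>"
proof (rule ccontr)
  assume "\<not> ?thesis"
  moreover have "span (\<alpha> ` {1..d}) \<subseteq> span \<Phi>"
    using simple_is_root by (intro span_mono) auto
  ultimately have "span (\<alpha> ` {1..d}) \<subset> span \<Phi>" by auto
  then obtain x where "x \<noteq> 0" "x \<in> span \<Phi>"
    and x: "\<And>y. y \<in> span (\<alpha> ` {1..d}) \<Longrightarrow> orthogonal x y"
    by (metis orthogonal_to_subspace_exists_gen)
  have "x \<bullet> \<alpha> i = 0" if "i \<in> {1..d}" for i
    using x[of "\<alpha> i"] that by (auto simp: orthogonal_def span_base)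
  then show False using simple_separate \<open>x \<noteq> 0\<close> \<open>x \<in> span \<Phi>\<close> by blast
qed

lemma independent_simple: "independent (\<alpha> ` {1..d})"
proof (rule card_le_dim_spanning[of _ "span \<Phi>"])
  show "\<alpha> ` {1..d} \<subseteq> span \<Phi>" "span \<Phi> \<subseteq> span (\<alpha> ` {1..d})"
    using span_simple simple_is_root by (auto intro: span_base)
  show "card (\<alpha> ` {1..d}) \<le> dim (span \<Phi>)"
    using card_image_le[of "{1..d}" \<alpha>] rank by simp
qed simp

subsection \<open>Fundamental weights\<close>

abbreviation "\<omega> \<equiv> fundamental_weight \<Phi> d \<alpha>"

text \<open>By independence some nonzero vector of the span is orthogonal to all simple roots but
  \<alpha> i. By \<open>simple_separate\<close> it pairs nontrivially with \<alpha> i, so it can be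
  normalized; the same lemma gives uniqueness.\<close>

lemma fundamental_weight:
  assumes "i \<in> {1..d}"
  shows weight_in_span: "\<omega> i \<in> span \<Phi>"
    and weight_coroot: "j \<in> {1..d} \<Longrightarrow> \<omega> i \<bullet> coroot (\<alpha> j) = (if j = i then 1 else 0)"
proof -
  let ?P = "\<lambda>x. x \<in> span \<Phi> \<and> (\<forall>j\<in>{1..d}. x \<bullet> coroot (\<alpha> j) = (if j = i then 1 else 0))"
  let ?B = "\<alpha> ` ({1..d} - {i})"
  have "\<exists>x. ?P x"
  proof -
    have "?B = \<alpha> ` {1..d} - {\<alpha> i}" 
      by (subst inj_on_image_set_diff[OF inj_\<alpha>]) (use assms in auto)
    then have "\<alpha> i \<notin> span ?B"
      using independent_simple assms by (auto simp: dependent_def)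
    moreover have "\<alpha> i \<in> span \<Phi>" using simple_is_root[OF assms] by (rule span_base)
    moreover have "span ?B \<subseteq> span \<Phi>"
      using simple_is_root by (intro span_mono) auto
    ultimately have "span ?B \<subset> span \<Phi>" by auto
    then obtain x where x: "x \<noteq> 0" "x \<in> span \<Phi>" "\<And>y. y \<in> span ?B \<Longrightarrow> orthogonal x y"
      by (metis orthogonal_to_subspace_exists_gen)
    have x0: "x \<bullet> \<alpha> j = 0" if "j \<in> {1..d} - {i}" for j
      using x(3)[of "\<alpha> j"] that by (auto simp: orthogonal_def span_base)
    then have "x \<bullet> \<alpha> i \<noteq> 0" using simple_separate[of x] x(1,2) by blast
    then have xi: "x \<bullet> coroot (\<alpha> i) \<noteq> 0" by (simp add: inner_coroot_eq_0_iff)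
    have "?P ((1 / (x \<bullet> coroot (\<alpha> i))) *\<^sub>R x)"
      using x(2) xi x0 by (auto simp: span_scale inner_coroot_eq_0_iff)
    then show ?thesis by blast
  qed
  moreover have "x = y" if "?P x" "?P y" for x y
  proof -
    have "x - y = 0"
    proof (rule simple_separate)
      show "(x - y) \<bullet> \<alpha> j = 0" if "j \<in> {1..d}" for j
        using that \<open>?P x\<close> \<open>?P y\<close> by (subst inner_coroot_eq_0_iff[symmetric]) (auto simp: inner_diff_left)
    qed (use that in \<open>auto intro: span_diff\<close>)
    then show ?thesis by simp
  qed
  ultimately have "?P (\<omega> i)"
    unfolding fundamental_weight_def by (rule_tac theI') blast
  then show "\<omega> i \<in> span \<Phi>" "j \<in> {1..d} \<Longrightarrow> \<omega> i \<bullet> coroot (\<alpha> j) = (if j = i then 1 else 0)"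
    by auto
qed

lemma weight_simple: "i \<in> {1..d} \<Longrightarrow> j \<in> {1..d} \<Longrightarrow> j \<noteq> i \<Longrightarrow> \<omega> i \<bullet> \<alpha> j = 0"
  using weight_coroot[of i j] by (simp add: inner_coroot_eq_0_iff)

lemma weight_simple_self:
  assumes "i \<in> {1..d}"
  shows "\<omega> i \<bullet> \<alpha> i = (\<alpha> i \<bullet> \<alpha> i) / 2"
  using weight_coroot[OF assms assms] simple_nonzero[OF assms]
  by (simp add: coroot_def field_simps)

lemma weight_simple_self_pos: "i \<in> {1..d} \<Longrightarrow> \<omega> i \<bullet> \<alpha> i > 0"
  by (simp add: weight_simple_self simple_nonzero)

lemma weight_dominant: "i \<in> {1..d} \<Longrightarrow> j \<in> {1..d} \<Longrightarrow> \<omega> i \<bullet> \<alpha> j \<ge> 0"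
  by (cases "j = i") (simp_all add: weight_simple weight_simple_self)

lemma weight_in_D: "i \<in> {1..d} \<Longrightarrow> \<omega> i \<in> D"
  using weight_in_span weight_dominant by (simp add: D_eq)

lemma weight_expansion:
  assumes "x \<in> span \<Phi>"
  shows "x = (\<Sum>i\<in>{1..d}. (x \<bullet> coroot (\<alpha> i)) *\<^sub>R \<omega> i)"
proof -
  let ?y = "\<Sum>i\<in>{1..d}. (x \<bullet> coroot (\<alpha> i)) *\<^sub>R \<omega> i"
  have "x - ?y = 0"
  proof (rule simple_separate)
    show "x - ?y \<in> span \<Phi>"
      using assms weight_in_span by (intro span_diff span_sum span_scale) auto
    fix j assume j: "j \<in> {1..d}"
    have "?y \<bullet> coroot (\<alpha> j) = (\<Sum>i\<in>{1..d}. (x \<bullet> coroot (\<alpha> i)) * (if j = i then 1 else 0))"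
      using j by (simp add: inner_sum_left weight_coroot)
    also have "\<dots> = x \<bullet> coroot (\<alpha> j)"
      using j by (simp add: if_distrib[of "(*) _"] cong: if_cong)
    finally show "(x - ?y) \<bullet> \<alpha> j = 0"
      by (subst inner_coroot_eq_0_iff[symmetric]) (simp add: inner_diff_left)
  qed
  then show ?thesis by simp
qed

text \<open>Weights and simple coroots are dual bases. A positive root pairs nonnegatively with the
  weights because these lie in \<open>D\<close>, so it has nonnegative coefficients here.\<close>

lemma root_expansion:
  assumes "x \<in> span \<Phi>"
  shows "x = (\<Sum>i\<in>{1..d}. (x \<bullet> \<omega> i) *\<^sub>R coroot (\<alpha> i))"
proof -
  let ?y = "\<Sum>i\<in>{1..d}. (x \<bullet> \<omega> i) *\<^sub>R coroot (\<alpha> i)"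
  have y: "?y \<in> span \<Phi>"
    using simple_is_root by (auto simp: coroot_def intro!: span_sum span_scale intro: span_base)
  have "(x - ?y) \<bullet> z = 0" if "z \<in> span \<Phi>" for z
  proof -
    have "z \<bullet> x = (\<Sum>i\<in>{1..d}. (z \<bullet> coroot (\<alpha> i)) * (\<omega> i \<bullet> x))"
      by (subst weight_expansion[OF that]) (simp add: inner_sum_left)
    also have "\<dots> = z \<bullet> ?y"
      by (simp add: inner_sum_right inner_commute mult.commute)
    finally show ?thesis by (simp add: inner_diff_right inner_commute[of _ z])
  qed
  moreover have "x - ?y \<in> span \<Phi>" using assms y by (rule span_diff)
  ultimately have "x - ?y = 0" by (metis inner_eq_zero_iff)
  then show ?thesis by simp
qed

end

section \<open>The Weyl group\<close>

context rooted_chamber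
begin

text \<open>Membership in \<open>D\<close> without the condition of lying in the span: every point
  of the ambient space then has a dominant image under \<open>W\<close>.\<close>

definition dominant :: "'v \<Rightarrow> bool"
  where "dominant x \<longleftrightarrow> (\<forall>i\<in>{1..d}. x \<bullet> \<alpha> i \<ge> 0)"

lemma mem_D: "x \<in> D \<longleftrightarrow> x \<in> span \<Phi> \<and> dominant x"
  by (subst D_eq) (simp add: dominant_def)

lemma weight_is_dominant: "i \<in> {1..d} \<Longrightarrow> dominant (\<omega> i)"
  by (simp add: dominant_def weight_dominant)

lemma pos_root_weight: "\<beta> \<in> pos_roots \<Longrightarrow> i \<in> {1..d} \<Longrightarrow> \<beta> \<bullet> \<omega> i \<ge> 0"
  using weight_in_D mem_D_pos by (metis inner_commute)

lemma dominant_pos_root: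
  assumes "dominant x" "\<beta> \<in> pos_roots"
  shows "x \<bullet> \<beta> \<ge> 0"
proof -
  have "\<beta> \<in> span \<Phi>" using assms pos_roots_subset by (auto intro: span_base)
  then have "x \<bullet> \<beta> = (\<Sum>i\<in>{1..d}. (\<beta> \<bullet> \<omega> i) * (x \<bullet> coroot (\<alpha> i)))"
    by (subst root_expansion) (simp_all add: inner_sum_right)
  also have "\<dots> \<ge> 0"
    using assms simple_nonzero(2)
    by (intro sum_nonneg mult_nonneg_nonneg pos_root_weight) (auto simp: coroot_def dominant_def)
  finally show ?thesis .
qed

lemma neg_pos_root: "\<beta> \<in> pos_roots \<Longrightarrow> - \<beta> \<notin> pos_roots"
  by (auto simp: pos_roots_def)

lemma s_weight: "i \<in> {1..d} \<Longrightarrow> s i (\<omega> i) = \<omega> i - \<alpha> i"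
  "i \<in> {1..d} \<Longrightarrow> j \<in> {1..d} \<Longrightarrow> j \<noteq> i \<Longrightarrow> s i (\<omega> j) = \<omega> j"
  by (simp_all add: reflection_coroot weight_coroot)

text \<open>The expansion in coroots leaves a multiple of \<alpha> i, and a reduced root system
  contains no multiples other than \<alpha> i and its negative.\<close>

lemma pos_root_eq_simple:
  assumes i: "i \<in> {1..d}" and \<beta>: "\<beta> \<in> pos_roots"
    and zero: "\<And>k. k \<in> {1..d} - {i} \<Longrightarrow> \<beta> \<bullet> \<omega> k = 0"
  shows "\<beta> = \<alpha> i"
proof -
  have \<beta>': "\<beta> \<in> \<Phi>" using \<beta> pos_roots_subset by blast
  have "\<beta> = (\<Sum>k\<in>{1..d}. (\<beta> \<bullet> \<omega> k) *\<^sub>R coroot (\<alpha> k))"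
    by (intro root_expansion span_base \<beta>')
  also have "\<dots> = (\<Sum>k\<in>{i}. (\<beta> \<bullet> \<omega> k) *\<^sub>R coroot (\<alpha> k))"
    using i zero by (intro sum.mono_neutral_right) auto
  finally have "\<beta> = ((\<beta> \<bullet> \<omega> i) * (2 / (\<alpha> i \<bullet> \<alpha> i))) *\<^sub>R \<alpha> i"
    by (simp add: coroot_def)
  then have "\<beta> = \<alpha> i \<or> \<beta> = - \<alpha> i"
    using reduced[OF simple_is_root[OF i]] \<beta>' by metis
  then show ?thesis using \<beta> simple_pos[OF i] neg_pos_root by blast
qed

text \<open>\<open>s i\<close> fixes the other weights, hence changes only one coefficient. If the
  image were negative, all other coefficients would have to vanish.\<close>

lemma simple_reflection_pos:
  assumes i: "i \<in> {1..d}" and \<beta>: "\<beta> \<in> pos_roots" "\<beta> \<noteq> \<alpha> i"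
  shows "s i \<beta> \<in> pos_roots"
proof (rule ccontr)
  assume "s i \<beta> \<notin> pos_roots"
  have "\<beta> \<in> \<Phi>" using \<beta> pos_roots_subset by auto
  then have neg: "- s i \<beta> \<in> pos_roots"
    using \<open>s i \<beta> \<notin> pos_roots\<close> pos_or_neg reflection_root simple_is_root[OF i] by blast
  have zero: "\<beta> \<bullet> \<omega> k = 0" if "k \<in> {1..d} - {i}" for k
  proof -
    have "s i \<beta> \<bullet> \<omega> k = \<beta> \<bullet> \<omega> k"
      using that i by (simp add: reflection_inner_commute s_weight)
    then show ?thesis
      using pos_root_weight[OF \<beta>(1), of k] pos_root_weight[OF neg, of k] that by simp
  qed
  from pos_root_eq_simple[OF i \<beta>(1) zero] show False using \<beta>(2) by blast
qed

text \<open>The root \<open>s i (\<alpha> j)\<close> is positive, and its pairing with \<omega> i is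
  the negative of the inner product in question.\<close>

lemma simple_obtuse:
  assumes "i \<in> {1..d}" "j \<in> {1..d}" "i \<noteq> j"
  shows "\<alpha> i \<bullet> \<alpha> j \<le> 0"
proof -
  have "\<alpha> j \<noteq> \<alpha> i" using inj_onD[OF inj_\<alpha>, of j i] assms by blast
  then have "s i (\<alpha> j) \<in> pos_roots"
    using assms by (intro simple_reflection_pos simple_pos)
  then have "0 \<le> s i (\<alpha> j) \<bullet> \<omega> i" using assms by (intro pos_root_weight)
  also have "\<dots> = \<alpha> j \<bullet> (\<omega> i - \<alpha> i)"
    using assms by (simp add: reflection_inner_commute s_weight)
  also have "\<dots> = - (\<alpha> i \<bullet> \<alpha> j)"
    using assms weight_simple[of i j] by (simp add: inner_diff_right inner_commute)
  finally show ?thesis by simp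
qed

section \<open>Exchange, stabilizers of dominant points, and generation by simple
  reflections\<close>

abbreviation "W\<^sub>0 \<equiv> refl_grp (\<alpha> ` {1..d})"

lemma W0_subset: "W\<^sub>0 \<subseteq> W"
  using simple_is_root by (intro refl_grp_mono) auto

text \<open>The exchange condition. Reading the word from the right, the image of \<alpha> i turns
  negative at some letter \<open>s j\<close>. The only positive root made negative by
  \<open>s j\<close> is \<alpha> j, so the image just before is \<alpha> j, and conjugation cancels
  this letter against \<open>s i\<close>.\<close>

lemma deletion:
  assumes "set ws \<subseteq> \<alpha> ` {1..d}" "i \<in> {1..d}" "- reflection_word ws (\<alpha> i) \<in> pos_roots"
  shows "\<exists>ws'. set ws' \<subseteq> \<alpha> ` {1..d} \<and> length ws' < length ws \<and>
    reflection_word ws \<circ> s i = reflection_word ws'"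
  using assms(1,3)
proof (induction ws)
  case Nil
  then show ?case using simple_pos[OF assms(2)] neg_pos_root by force
next
  case (Cons a ws)
  then obtain j where j: "j \<in> {1..d}" "a = \<alpha> j" by auto
  define \<gamma> where "\<gamma> = reflection_word ws (\<alpha> i)"
  have w: "reflection_word ws \<in> W\<^sub>0" using Cons.prems by (auto simp: refl_grp_words)
  then have "\<gamma> \<in> \<Phi>"
    unfolding \<gamma>_def using W_root W0_subset simple_is_root assms(2) by blast
  show ?case
  proof (cases "- \<gamma> \<in> pos_roots")
    case True
    then obtain ws' where "set ws' \<subseteq> \<alpha> ` {1..d}" "length ws' < length ws"
      "reflection_word ws \<circ> s i = reflection_word ws'"
      using Cons unfolding \<gamma>_def by (metis insert_subset list.simps(15))
    then show ?thesis
      using Cons.prems unfolding reflection_word.simps(2) comp_assoc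
      by (intro exI[of _ "a # ws'"]) (auto simp del: o_apply)
  next
    case False
    then have "\<gamma> \<in> pos_roots" using pos_or_neg[OF \<open>\<gamma> \<in> \<Phi>\<close>] by blast
    moreover have "s j \<gamma> \<notin> pos_roots"
      using Cons.prems(2) neg_pos_root[of "s j \<gamma>"] by (auto simp: \<gamma>_def j(2))
    ultimately have "\<gamma> = \<alpha> j" using simple_reflection_pos j by blast
    have "reflection_word (a # ws) \<circ> s i = s j \<circ> (reflection_word ws \<circ> s i)"
      by (simp add: j(2) comp_assoc)
    also have "reflection_word ws \<circ> s i = reflection \<gamma> \<circ> reflection_word ws"
      unfolding \<gamma>_def by (rule refl_grp_conj_reflection[OF w])
    also have "s j \<circ> \<dots> = reflection_word ws"
      by (simp add: \<open>\<gamma> = \<alpha> j\<close> fun_eq_iff)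
    finally show ?thesis using Cons.prems by (intro exI[of _ ws]) auto
  qed
qed

text \<open>Consider the last letter \<open>s i\<close>. If the word sends \<alpha> i to a positive
  root, \<open>deletion\<close> applies to the word without this letter and gives a shorter word for
  the same element. Otherwise dominance of \<open>x\<close> and of its image forces
  \<open>x \<bullet> \<alpha> i = 0\<close>: the letter belongs to the stabilizer and can be split
  off.\<close>

lemma W0_dominant:
  assumes "w \<in> W\<^sub>0" "dominant x" "dominant (w x)"
  shows "w \<in> refl_grp (\<alpha> ` {k\<in>{1..d}. x \<bullet> \<alpha> k = 0})"
proof -
  have "reflection_word ws \<in> refl_grp (\<alpha> ` {k\<in>{1..d}. x \<bullet> \<alpha> k = 0})"
    if "set ws \<subseteq> \<alpha> ` {1..d}" "dominant (reflection_word ws x)" for ws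
    using that
  proof (induction ws rule: length_induct)
    case (1 ws)
    show ?case
    proof (cases ws rule: rev_cases)
      case Nil
      then show ?thesis unfolding Nil reflection_word.simps by (intro refl_grp_id)
    next
      case (snoc ws' a)
      then obtain i where i: "i \<in> {1..d}" "a = \<alpha> i" using "1.prems" by auto
      have ws': "set ws' \<subseteq> \<alpha> ` {1..d}" using "1.prems" snoc by auto
      have ws: "reflection_word ws = reflection_word ws' \<circ> s i"
        by (simp add: snoc reflection_word_append i)
      define \<gamma> where "\<gamma> = reflection_word ws (\<alpha> i)"
      have w: "reflection_word ws \<in> W\<^sub>0" "reflection_word ws' \<in> W\<^sub>0"
        using "1.prems" ws' by (auto simp: refl_grp_words)
      then have "\<gamma> \<in> \<Phi>"
        unfolding \<gamma>_def using W_root W0_subset simple_is_root i by blast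
      have neg: "reflection_word ws' (\<alpha> i) = - \<gamma>"
        using linear_neg[OF refl_grp_linear[OF w(2)]] by (simp add: \<gamma>_def ws reflection_self)
      show ?thesis
      proof (cases "\<gamma> \<in> pos_roots")
        case True
        then obtain ws'' where "set ws'' \<subseteq> \<alpha> ` {1..d}" "length ws'' < length ws'"
          "reflection_word ws = reflection_word ws''"
          using deletion[OF ws' i(1)] neg ws by auto
        then show ?thesis using 1 snoc by auto
      next
        case False
        then have "- \<gamma> \<in> pos_roots" using pos_or_neg \<open>\<gamma> \<in> \<Phi>\<close> by blast
        then have "reflection_word ws x \<bullet> (- \<gamma>) \<ge> 0"
          using "1.prems" by (intro dominant_pos_root)
        moreover have "reflection_word ws x \<bullet> \<gamma> = x \<bullet> \<alpha> i"
          unfolding \<gamma>_def by (rule refl_grp_inner[OF w(1)])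
        ultimately have x: "x \<bullet> \<alpha> i = 0"
          using assms(2) i(1) unfolding dominant_def by force
        then have "reflection_word ws x = reflection_word ws' x"
          by (simp add: ws reflection_fixes)
        then have "reflection_word ws' \<in> refl_grp (\<alpha> ` {k\<in>{1..d}. x \<bullet> \<alpha> k = 0})"
          using 1 snoc ws' by auto
        moreover have "s i \<in> refl_grp (\<alpha> ` {k\<in>{1..d}. x \<bullet> \<alpha> k = 0})"
          using i x by (intro refl_grp_reflection) auto
        ultimately show ?thesis unfolding ws by (rule refl_grp_comp)
      qed
    qed
  qed
  then show ?thesis using assms by (auto simp: refl_grp_words)
qed

text \<open>A strictly dominant vector that \<open>s i\<close> lowers by exactly \<alpha> i. It
  measures the height of roots and the progress of walks, and \<open>level \<rho>\<close> will be an
  interior point of the cone.\<close>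

definition \<rho> :: 'v where "\<rho> = (\<Sum>i\<in>{1..d}. \<omega> i)"

lemma \<rho>_coroot: "i \<in> {1..d} \<Longrightarrow> \<rho> \<bullet> coroot (\<alpha> i) = 1"
  by (simp add: \<rho>_def inner_sum_left weight_coroot)

lemma s_\<rho>: "i \<in> {1..d} \<Longrightarrow> s i \<rho> = \<rho> - \<alpha> i"
  using \<rho>_coroot by (simp add: reflection_coroot)

lemma \<rho>_simple: "i \<in> {1..d} \<Longrightarrow> \<rho> \<bullet> \<alpha> i > 0"
  using \<rho>_coroot[of i] simple_nonzero[of i] by (simp add: coroot_def field_simps)

text \<open>A positive root of minimal height in a \<open>W\<^sub>0\<close>-orbit is simple.\<close>

lemma reflection_in_W0:
  assumes "\<beta> \<in> \<Phi>"
  shows "reflection \<beta> \<in> W\<^sub>0"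
proof -
  have "reflection \<beta> \<in> W\<^sub>0" if "\<beta> \<in> pos_roots" for \<beta>
  proof -
    define X where "X = {w \<beta> | w. w \<in> W\<^sub>0} \<inter> pos_roots"
    have "finite X" using finite_pos_roots by (simp add: X_def)
    moreover have "\<beta> \<in> X" using that unfolding X_def
      by (intro IntI CollectI exI[of _ id] conjI refl_grp_id) simp_all
    ultimately obtain \<gamma> where \<gamma>: "\<gamma> \<in> X" "\<not> (\<exists>\<gamma>'\<in>X. \<rho> \<bullet> \<gamma>' < \<rho> \<bullet> \<gamma>)"
      using arg_min_if_finite[of X "\<lambda>\<gamma>. \<rho> \<bullet> \<gamma>"] by blast
    obtain w where w: "w \<in> W\<^sub>0" "\<gamma> = w \<beta>" using \<gamma>(1) by (auto simp: X_def)
    have \<gamma>_pos: "\<gamma> \<in> pos_roots" using \<gamma>(1) by (auto simp: X_def)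
    then have \<gamma>_root: "\<gamma> \<in> \<Phi>" using pos_roots_subset by auto
    \<comment> \<open>Otherwise the expansion of \<gamma> in coroots, with nonnegative coefficients,
      would give a nonpositive square norm. Reflecting in such a \<open>k\<close> lowers the height,
      so minimality leaves only \<gamma> = \<alpha> k.\<close>
    have "\<exists>k\<in>{1..d}. \<gamma> \<bullet> coroot (\<alpha> k) > 0"
    proof (rule ccontr)
      assume neg: "\<not> ?thesis"
      have "\<gamma> \<bullet> \<gamma> = (\<Sum>i\<in>{1..d}. (\<gamma> \<bullet> \<omega> i) * (\<gamma> \<bullet> coroot (\<alpha> i)))"
        by (subst root_expansion[of \<gamma>, OF span_base[OF \<gamma>_root]], subst inner_commute)
          (simp add: inner_sum_right)
      also have "\<dots> \<le> 0"
        using neg pos_root_weight[OF \<gamma>_pos] by (intro sum_nonpos mult_nonneg_nonpos) (auto simp: not_less)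
      finally have "\<gamma> = 0" by (metis inner_eq_zero_iff inner_ge_zero order_antisym)
      then show False using \<gamma>_root zero_not_root by auto
    qed
    then obtain k where k: "k \<in> {1..d}" "\<gamma> \<bullet> coroot (\<alpha> k) > 0" by blast
    have "\<gamma> = \<alpha> k"
    proof (rule ccontr)
      assume "\<gamma> \<noteq> \<alpha> k"
      then have "s k \<gamma> \<in> pos_roots" using simple_reflection_pos k \<gamma>_pos by blast
      moreover have "s k \<circ> w \<in> W\<^sub>0" using w k by (intro refl_grp_comp refl_grp_reflection) auto
      then have "s k \<gamma> \<in> {w \<beta> | w. w \<in> W\<^sub>0}" using w(2) by (auto intro!: exI[of _ "s k \<circ> w"])
      ultimately have "s k \<gamma> \<in> X" by (simp add: X_def)
      then have "\<rho> \<bullet> \<gamma> \<le> \<rho> \<bullet> s k \<gamma>" using \<gamma>(2) by (auto simp: not_less)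
      moreover have "(\<gamma> \<bullet> coroot (\<alpha> k)) * (\<rho> \<bullet> \<alpha> k) > 0" using k \<rho>_simple by simp
      ultimately show False by (simp add: reflection_coroot inner_diff_right)
    qed
    then have "w \<circ> reflection \<beta> = s k \<circ> w"
      using refl_grp_conj_reflection[OF w(1)] w(2) by simp
    then have "reflection \<beta> = inv_into UNIV w \<circ> (s k \<circ> w)"
      using refl_grp_bij[OF w(1)] by (metis bij_is_inj comp_assoc comp_id id_comp inv_o_cancel)
    then show ?thesis
      using w k by (auto intro!: refl_grp_comp refl_grp_inv refl_grp_reflection)
  qed
  then show ?thesis using pos_or_neg[OF assms] reflection_minus by metis
qed

lemma W0_eq: "W\<^sub>0 = W"
proof
  show "W \<subseteq> W\<^sub>0"
  proof
    fix w assume "w \<in> W"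
    then show "w \<in> W\<^sub>0"
      by (induction rule: refl_grp_induct) (blast intro: refl_grp_id refl_grp_comp reflection_in_W0)+
  qed
qed (rule W0_subset)

lemma W_dominant:
  assumes "w \<in> W" "dominant x" "dominant (w x)"
  shows "w \<in> refl_grp (\<alpha> ` {k\<in>{1..d}. x \<bullet> \<alpha> k = 0})" "w x = x"
proof -
  show *: "w \<in> refl_grp (\<alpha> ` {k\<in>{1..d}. x \<bullet> \<alpha> k = 0})"
    using W0_dominant assms unfolding W0_eq by blast
  show "w x = x" by (rule refl_grp_fixes[OF *]) auto
qed

lemma s_in_W: "i \<in> {1..d} \<Longrightarrow> s i \<in> W"
  by (intro refl_grp_reflection simple_is_root)

text \<open>An element is determined by its permutation of the roots, because it fixes the
  orthogonal complement of their span.\<close>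

lemma finite_W: "finite W"
proof -
  have "inj_on (\<lambda>w. restrict w \<Phi>) W"
  proof (rule inj_onI)
    fix u w assume uw: "u \<in> W" "w \<in> W" "restrict u \<Phi> = restrict w \<Phi>"
    show "u = w"
    proof
      fix x
      obtain y z where yz: "y \<in> span \<Phi>" "\<And>v. v \<in> span \<Phi> \<Longrightarrow> orthogonal z v" "x = y + z"
        using orthogonal_subspace_decomp_exists by metis
      have z: "v z = z" if "v \<in> W" for v
        using that yz(2) by (intro refl_grp_fixes[of v \<Phi>]) (auto simp: orthogonal_def span_base)
      have "u y = w y"
      proof (rule linear_eq_on_span[OF refl_grp_linear[OF uw(1)] refl_grp_linear[OF uw(2)] _ yz(1)])
        show "u b = w b" if "b \<in> \<Phi>" for b
          using fun_cong[OF uw(3), of b] that by simp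
      qed
      then show "u x = w x"
        using z[OF uw(1)] z[OF uw(2)] linear_add[OF refl_grp_linear[OF uw(1)]]
          linear_add[OF refl_grp_linear[OF uw(2)]] by (simp add: yz(3))
    qed
  qed
  moreover have "(\<lambda>w. restrict w \<Phi>) ` W \<subseteq> \<Phi> \<rightarrow>\<^sub>E \<Phi>"
    using W_root by auto
  moreover have "finite (\<Phi> \<rightarrow>\<^sub>E \<Phi>)" using finite_roots by (intro finite_PiE)
  ultimately show ?thesis by (meson finite_imageD finite_subset)
qed

text \<open>Walking from the chamber \<open>u D\<close> towards \<open>x\<close> across walls separating the current chamber from
  \<open>x\<close> terminates, since the pairing of \<open>x\<close> with the image of \<open>\<rho>\<close> increases.\<close>

lemma chamber_descent:
  assumes "u \<in> W" "P u"
    and step: "\<And>w i. w \<in> W \<Longrightarrow> i \<in> {1..d} \<Longrightarrow> P w \<Longrightarrow> x \<bullet> w (\<alpha> i) < 0 \<Longrightarrow> P (w \<circ> s i)"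
  shows "\<exists>w\<in>W. P w \<and> dominant (inv_into UNIV w x)"
proof -
  let ?X = "{w \<in> W. P w}"
  \<comment> \<open>The end of the walk is picked directly, as an element satisfying
    \<open>P\<close> with the largest pairing; one more separating wall would contradict maximality.
    \<open>P\<close> is an invariant of the walk, trivial in \<open>ex_dominant\<close> and a
    growing chart value in \<open>chart_le_pl_ext\<close>.\<close>
  have "finite ?X" "?X \<noteq> {}" using finite_W assms by auto
  from arg_min_if_finite[OF this, of "\<lambda>w. - (x \<bullet> w \<rho>)"]
  obtain w where w: "w \<in> W" "P w" "\<And>v. v \<in> W \<Longrightarrow> P v \<Longrightarrow> x \<bullet> v \<rho> \<le> x \<bullet> w \<rho>"
    by (metis (no_types, lifting) mem_Collect_eq neg_less_iff_less not_less)
  have "inv_into UNIV w x \<bullet> \<alpha> i \<ge> 0" if i: "i \<in> {1..d}" for i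
  proof (rule ccontr)
    assume "\<not> ?thesis"
    then have neg: "x \<bullet> w (\<alpha> i) < 0"
      using refl_grp_inner_inv[OF w(1), of "\<alpha> i" x] by (simp add: inner_commute)
    have "x \<bullet> (w \<circ> s i) \<rho> \<le> x \<bullet> w \<rho>"
      using step[OF w(1) i w(2) neg] w(1) i by (intro w(3) refl_grp_comp s_in_W)
    then show False
      using neg i linear_diff[OF refl_grp_linear[OF w(1)]] by (simp add: s_\<rho> inner_diff_right)
  qed
  then show ?thesis using w by (auto simp: dominant_def)
qed

lemma ex_dominant: "\<exists>w\<in>W. dominant (inv_into UNIV w x)"
  using chamber_descent[of id "\<lambda>_. True" x] refl_grp_id by auto

text \<open>An orbit contains only one dominant vector, and all fundamental weights are
  dominant.\<close>

lemma weight_orbits_disjoint: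
  assumes "u \<in> W" "w \<in> W" "i \<in> {1..d}" "k \<in> {1..d}" "u (\<omega> i) = w (\<omega> k)"
  shows "i = k"
proof -
  have "(inv_into UNIV w \<circ> u) (\<omega> i) = \<omega> k"
    using assms refl_grp_bij[OF assms(2)] by (simp add: bij_is_inj)
  then have "\<omega> i = \<omega> k"
    using W_dominant(2)[of "inv_into UNIV w \<circ> u" "\<omega> i"] assms
    by (metis refl_grp_comp refl_grp_inv weight_is_dominant)
  then show ?thesis using weight_coroot[of i i] weight_coroot[of k i] assms by (auto split: if_splits)
qed

end

section \<open>Facets of polyhedral cones\<close>

text \<open>The functions to be studied form an infinite-dimensional space, so dimension is compared
  only for subsets of the span of a finite set.\<close>

lemma finite_basis_exists:
  fixes U :: "'a::real_vector set"
  assumes "finite B" "U \<subseteq> span B"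
  obtains b where "finite b" "b \<subseteq> U" "independent b" "U \<subseteq> span b" "card b = dim U"
proof -
  obtain b where b: "b \<subseteq> U" "independent b" "U \<subseteq> span b" "card b = dim U"
    by (rule basis_exists)
  then have "finite b"
    using independent_span_bound[OF assms(1), of b] assms(2) by auto
  with b show ?thesis using that by blast
qed

lemma dim_le_of_subset_span:
  fixes U :: "'a::real_vector set"
  assumes "finite B" "U' \<subseteq> span B" "U \<subseteq> span U'"
  shows "dim U \<le> dim U'"
proof -
  have "U \<subseteq> span B" using assms by (meson order_trans span_minimal subspace_span)
  then obtain b where b: "b \<subseteq> U" "independent b" "card b = dim U"
    using finite_basis_exists[OF assms(1)] by metis
  obtain b' where b': "finite b'" "U' \<subseteq> span b'" "card b' = dim U'"
    using finite_basis_exists[OF assms(1,2)] by metis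
  have "b \<subseteq> span b'"
    using b(1) b'(2) assms(3) by (meson order_trans span_minimal subspace_span)
  then show ?thesis
    using independent_span_bound[OF b'(1) b(2)] b(3) b'(3) by simp
qed

lemma dim_insert_fin:
  fixes U :: "'a::real_vector set"
  assumes "finite B" "U \<subseteq> span B" "x \<notin> span U"
  shows "dim (insert x U) = dim U + 1"
proof -
  obtain b where b: "finite b" "b \<subseteq> U" "independent b" "U \<subseteq> span b" "card b = dim U"
    using finite_basis_exists[OF assms(1,2)] by metis
  have "span b = span U" using b by (metis span_minimal span_mono subset_antisym subspace_span)
  then have "x \<notin> span b" using assms(3) by simp
  then have "independent (insert x b)" using b(3) by (rule independent_insertI)
  moreover have "span (insert x b) = span (insert x U)"
    using \<open>span b = span U\<close> by (metis span_insert)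
  ultimately have "dim (insert x U) = card (insert x b)" using dim_eq_card by metis
  moreover have "x \<notin> b" using \<open>x \<notin> span b\<close> span_base by blast
  ultimately show ?thesis using b by simp
qed

text \<open>\<open>p\<close> is an interior point relative to \<open>E\<close>, and
  \<open>wit l\<close> lies on the hyperplane of \<open>l\<close> but strictly inside all others.
  Together they express that the description of the cone by \<open>L\<close> is full-dimensional and
  irredundant.\<close>

locale polyhedral_cone =
  fixes E :: "'a::real_vector set" and B :: "'a set" and L :: "('a \<Rightarrow> real) set"
    and p :: 'a and wit :: "('a \<Rightarrow> real) \<Rightarrow> 'a"
  assumes subspace_E: "subspace E" and fin_B: "finite B" and E_B: "E \<subseteq> span B"
    and fin_L: "finite L" and lin: "\<And>l. l \<in> L \<Longrightarrow> linear l"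
    and p: "p \<in> E" "\<And>l. l \<in> L \<Longrightarrow> l p > 0"
    and wit: "\<And>l. l \<in> L \<Longrightarrow> wit l \<in> E" "\<And>l. l \<in> L \<Longrightarrow> l (wit l) = 0"
      "\<And>l l'. l \<in> L \<Longrightarrow> l' \<in> L \<Longrightarrow> l' \<noteq> l \<Longrightarrow> l' (wit l) > 0"
begin

definition "K = {h \<in> E. \<forall>l\<in>L. 0 \<le> l h}"

text \<open>\<open>q\<close> is a relative interior point of the face: a large multiple of it
  absorbs any vector of the flat, which is thus a difference of two points of the face.\<close>

lemma span_face:
  assumes Z: "Z \<subseteq> L" and q: "q \<in> E" "\<And>l. l \<in> Z \<Longrightarrow> l q = 0" "\<And>l. l \<in> L - Z \<Longrightarrow> l q > 0"
  shows "span {h \<in> K. \<forall>l\<in>Z. l h = 0} = {h \<in> E. \<forall>l\<in>Z. l h = 0}" (is "span ?F = ?E")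
proof
  have "subspace ?E"
    using subspace_E lin Z
    by (auto simp: subspace_def linear_add linear_scale linear_0 subset_iff)
  then show "span ?F \<subseteq> ?E"
    by (intro span_minimal) (auto simp: K_def)
  show "?E \<subseteq> span ?F"
  proof
    fix e assume e: "e \<in> ?E"
    obtain C where C: "C > 0" "\<forall>l\<in>L - Z. C * l q + l e > 0"
      using ex_scale_pos[of "L - Z" "\<lambda>l. l q" "\<lambda>l. l e"] fin_L q(3) by blast
    have val: "l (C *\<^sub>R q + e) = C * l q + l e" if "l \<in> L" for l
      using lin[OF that] by (simp add: linear_add linear_scale)
    have "l (C *\<^sub>R q + e) \<ge> 0" if "l \<in> L" for l
      using C q(2)[of l] e that val[OF that] by (cases "l \<in> Z") (auto simp: less_imp_le)
    moreover have "C *\<^sub>R q + e \<in> E"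
      using subspace_E e q(1) by (simp add: subspace_add subspace_scale)
    moreover have "l (C *\<^sub>R q + e) = 0" if "l \<in> Z" for l
      using val[OF subsetD[OF Z that]] q(2)[OF that] e that by simp
    ultimately have "C *\<^sub>R q + e \<in> ?F"
      by (auto simp: K_def)
    moreover have "q \<in> ?F"
      using q Z by (auto simp: K_def) (metis DiffI less_eq_real_def)
    ultimately have "(C *\<^sub>R q + e) - C *\<^sub>R q \<in> span ?F"
      by (intro span_diff span_scale) (auto intro: span_base)
    then show "e \<in> span ?F" by simp
  qed
qed

lemma span_K: "span K = E"
  using span_face[of "{}" p] p by simp

lemma facet_span: "l \<in> L \<Longrightarrow> span {h \<in> K. l h = 0} = {h \<in> E. l h = 0}"
  using span_face[of "{l}" "wit l"] wit by force

text \<open>The point \<open>p\<close> lies off the hyperplane of \<open>l\<close>, and adjoining it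
  recovers all of \<open>E\<close>.\<close>

lemma facet_dim:
  assumes l: "l \<in> L"
  shows "dim {h \<in> K. l h = 0} + 1 = dim K"
proof -
  let ?H = "{h \<in> E. l h = 0}"
  have sub: "subspace ?H"
    using subspace_E lin[OF l] by (auto simp: subspace_def linear_add linear_scale linear_0)
  have "p \<notin> span ?H" using p l sub by (force simp: span_eq_iff[THEN iffD2])
  moreover have "?H \<subseteq> span B" using E_B by auto
  ultimately have "dim (insert p ?H) = dim ?H + 1" using fin_B by (intro dim_insert_fin)
  moreover have "span (insert p ?H) = span K"
  proof
    show "span (insert p ?H) \<subseteq> span K"
      unfolding span_K using p by (intro span_minimal subspace_E) auto
    show "span K \<subseteq> span (insert p ?H)"
      unfolding span_K
    proof
      fix e assume e: "e \<in> E"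
      define c where "c = l e / l p"
      have "l (e - c *\<^sub>R p) = 0"
        using lin[OF l] p l by (simp add: linear_diff linear_scale c_def less_imp_neq[symmetric])
      then have "e - c *\<^sub>R p \<in> ?H" using e p subspace_E by (simp add: subspace_diff subspace_scale)
      then have "(e - c *\<^sub>R p) + c *\<^sub>R p \<in> span (insert p ?H)"
        by (intro span_add span_scale) (auto intro: span_base)
      then show "e \<in> span (insert p ?H)" by simp
    qed
  qed
  ultimately have "dim K = dim ?H + 1" by (metis dim_span)
  moreover have "dim ?H = dim {h \<in> K. l h = 0}" using facet_span[OF l] by (metis dim_span)
  ultimately show ?thesis by simp
qed

lemma zero_in_K: "0 \<in> K"
  using subspace_E lin by (auto simp: K_def subspace_0 linear_0)

lemma facet_face:
  assumes l: "l \<in> L"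
  shows "{h \<in> K. l h = 0} face_of K"
  unfolding face_of_def
proof (intro conjI ballI impI)
  show "{h \<in> K. l h = 0} \<subseteq> K" by auto
  show "convex {h \<in> K. l h = 0}"
    using subspace_E lin l
    by (auto simp: convex_def K_def linear_add linear_scale subspace_add subspace_scale)
next
  fix a b x assume ab: "a \<in> K" "b \<in> K" "x \<in> {h \<in> K. l h = 0}" "x \<in> open_segment a b"
  then obtain u where u: "0 < u" "u < 1" "x = (1 - u) *\<^sub>R a + u *\<^sub>R b"
    by (auto simp: in_segment)
  have "(1 - u) * l a + u * l b = 0"
    using ab(3) lin[OF l] by (simp add: u(3) linear_add linear_scale)
  moreover have "l a \<ge> 0" "l b \<ge> 0" using ab l by (auto simp: K_def)
  ultimately have "(1 - u) * l a = 0" "u * l b = 0"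
    using u by (simp_all add: add_nonneg_eq_0_iff)
  then show "a \<in> {h \<in> K. l h = 0}" "b \<in> {h \<in> K. l h = 0}" using u ab by auto
qed

text \<open>If a face contains a point of the relative interior of a flat section of \<open>K\<close>, it contains
  the whole section.\<close>

lemma face_eq:
  assumes F: "F face_of K" "F \<noteq> {}"
  defines "Z \<equiv> {l \<in> L. \<forall>f\<in>F. l f = 0}"
  shows "F = {h \<in> K. \<forall>l\<in>Z. l h = 0}"
proof
  show "F \<subseteq> {h \<in> K. \<forall>l\<in>Z. l h = 0}"
    using face_of_imp_subset[OF F(1)] by (auto simp: Z_def)
next
  have FK: "F \<subseteq> K" and cF: "convex F" using F(1) by (auto simp: face_of_def)
  \<comment> \<open>Each functional outside \<open>Z\<close> is positive somewhere on
    \<open>F\<close>; averaging such points makes all of them positive at once.\<close>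
  have "\<exists>x\<in>F. \<forall>l\<in>M. l x > 0" if "finite M" "M \<subseteq> L - Z" for M
    using that
  proof (induction M rule: finite_induct)
    case empty
    then show ?case using F(2) by auto
  next
    case (insert l M)
    then obtain x where x: "x \<in> F" "\<forall>l\<in>M. l x > 0" by auto
    obtain y where y: "y \<in> F" "l y \<noteq> 0" using insert.prems by (auto simp: Z_def)
    let ?z = "(1/2) *\<^sub>R x + (1/2) *\<^sub>R y"
    have z: "?z \<in> F" using convexD[OF cF x(1) y(1)] by simp
    have nonneg: "m x \<ge> 0" "m y \<ge> 0" if "m \<in> L" for m using x(1) y(1) FK that by (auto simp: K_def)
    have val: "m ?z = m x / 2 + m y / 2" if "m \<in> L" for m
      using lin[OF that] by (simp add: linear_add linear_scale)
    have "m ?z > 0" if m: "m \<in> insert l M" for m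
    proof -
      have "m \<in> L" using m insert.prems by auto
      have "m x > 0 \<or> m y > 0"
        using m x(2) y(2) nonneg[OF \<open>m \<in> L\<close>] by auto
      then show ?thesis using val[OF \<open>m \<in> L\<close>] nonneg[OF \<open>m \<in> L\<close>] by auto
    qed
    then show ?case using z by blast
  qed
  from this[of "L - Z"] fin_L obtain x where x: "x \<in> F" "\<And>l. l \<in> L - Z \<Longrightarrow> l x > 0" by auto
  show "{h \<in> K. \<forall>l\<in>Z. l h = 0} \<subseteq> F"
  proof
    fix y assume y: "y \<in> {h \<in> K. \<forall>l\<in>Z. l h = 0}"
    show "y \<in> F"
    proof (cases "y = x")
      case False
      \<comment> \<open>For large \<open>C\<close> the segment from \<open>y\<close> to
        \<open>x\<close> can be prolonged beyond \<open>x\<close> by the fraction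
        \<open>1 / C\<close> without leaving \<open>K\<close>. Then \<open>x\<close> is interior to
        a segment ending in \<open>y\<close>, and the face property applies.\<close>
      obtain C where C: "C > 0" "\<forall>l\<in>L - Z. C * l x + (l x - l y) > 0"
        using ex_scale_pos[of "L - Z" "\<lambda>l. l x" "\<lambda>l. l x - l y"] fin_L x(2) by auto
      define z where "z = x + (1 / C) *\<^sub>R (x - y)"
      have xK: "x \<in> K" using x FK by auto
      have "l z \<ge> 0" if l: "l \<in> L" for l
      proof -
        have val: "C * l z = C * l x + (l x - l y)"
          using lin[OF l] C(1) by (simp add: z_def linear_add linear_scale linear_diff distrib_left)
        have "C * l z \<ge> 0"
        proof (cases "l \<in> Z")
          case True
          then have "l x = 0" "l y = 0" using x(1) y by (auto simp: Z_def)
          then show ?thesis unfolding val by simp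
        next
          case False
          then show ?thesis using C(2) l unfolding val by (simp add: less_imp_le)
        qed
        then show ?thesis using C(1) by (simp add: zero_le_mult_iff)
      qed
      moreover have "z \<in> E"
        using xK y subspace_E by (simp add: z_def K_def subspace_add subspace_diff subspace_scale)
      ultimately have "z \<in> K" by (simp add: K_def)
      have "x \<in> open_segment y z"
      proof -
        have "x = (1 - C / (C + 1)) *\<^sub>R y + (C / (C + 1)) *\<^sub>R z"
        proof -
          have "(C / (C + 1)) *\<^sub>R z = (C / (C + 1)) *\<^sub>R x + (1 / (C + 1)) *\<^sub>R (x - y)"
            using C(1) by (simp add: z_def scaleR_add_right)
          also have "\<dots> = (C / (C + 1) + 1 / (C + 1)) *\<^sub>R x - (1 / (C + 1)) *\<^sub>R y"
            by (simp add: scaleR_diff_right scaleR_add_left)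
          also have "C / (C + 1) + 1 / (C + 1) = 1"
            using C(1) by (simp add: add_divide_distrib[symmetric])
          finally have "(C / (C + 1)) *\<^sub>R z = x - (1 / (C + 1)) *\<^sub>R y" by simp
          moreover have "1 - C / (C + 1) = 1 / (C + 1)" using C(1) by (simp add: field_simps)
          ultimately show ?thesis by simp
        qed
        moreover have "y \<noteq> z"
        proof
          assume "y = z"
          then have "(1 + 1 / C) *\<^sub>R (x - y) = 0"
            by (simp add: z_def algebra_simps)
          moreover have "1 + 1 / C > 0" using C(1) by (simp add: add_pos_pos)
          ultimately show False using False by auto
        qed
        ultimately show ?thesis using C(1) by (auto simp: in_segment intro!: exI[of _ "C / (C + 1)"])
      qed
      then show ?thesis using F(1) \<open>z \<in> K\<close> y x(1) unfolding face_of_def by blast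
    qed (use x in simp)
  qed
qed

text \<open>By \<open>face_eq\<close> a facet is determined by the functionals vanishing on it. If
  there were two, \<open>l\<close> and \<open>l'\<close>, then \<open>wit l\<close> would lie in the
  facet of \<open>l\<close> but outside the span of \<open>F\<close>, making the dimension of
  \<open>F\<close> too small.\<close>

lemma cone_facets_K: "cone_facets K = (\<lambda>l. {h \<in> K. l h = 0}) ` L"
proof
  show "(\<lambda>l. {h \<in> K. l h = 0}) ` L \<subseteq> cone_facets K"
    using facet_face facet_dim zero_in_K linear_0[OF lin] by (fastforce simp: cone_facets_def)
next
  show "cone_facets K \<subseteq> (\<lambda>l. {h \<in> K. l h = 0}) ` L"
  proof
    fix F assume "F \<in> cone_facets K"
    then have F: "F face_of K" "F \<noteq> {}" "dim F + 1 = dim K" by (auto simp: cone_facets_def)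
    define Z where "Z = {l \<in> L. \<forall>f\<in>F. l f = 0}"
    have FZ: "F = {h \<in> K. \<forall>l\<in>Z. l h = 0}" unfolding Z_def using F by (intro face_eq)
    have "Z \<noteq> {}" using F(3) FZ by auto
    then obtain l where l: "l \<in> Z" "l \<in> L" by (auto simp: Z_def)
    have "Z = {l}"
    proof (rule ccontr)
      assume "Z \<noteq> {l}"
      then obtain l' where l': "l' \<in> Z" "l' \<noteq> l" "l' \<in> L" using l by (auto simp: Z_def)
      have F_E: "F \<subseteq> {h \<in> E. l h = 0 \<and> l' h = 0}" (is "_ \<subseteq> ?H")
        using FZ l l' by (auto simp: K_def)
      have sub: "subspace ?H"
        using subspace_E lin[OF l(2)] lin[OF l'(3)]
        by (auto simp: subspace_def linear_add linear_scale linear_0)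
      have "wit l \<notin> span F"
        using span_minimal[OF F_E sub] wit(3)[OF l(2) l'(3,2)] by auto
      moreover have "F \<subseteq> span B" using F_E E_B by auto
      ultimately have "dim (insert (wit l) F) = dim F + 1" using fin_B by (intro dim_insert_fin)
      moreover have "dim (insert (wit l) F) \<le> dim {h \<in> K. l h = 0}"
      proof (rule dim_le_of_subset_span[OF fin_B])
        show "{h \<in> K. l h = 0} \<subseteq> span B" using E_B by (auto simp: K_def)
        show "insert (wit l) F \<subseteq> span {h \<in> K. l h = 0}"
          unfolding facet_span[OF l(2)] using F_E wit l by auto
      qed
      ultimately show False using facet_dim[OF l(2)] F(3) by simp
    qed
    then show "F \<in> (\<lambda>l. {h \<in> K. l h = 0}) ` L" using FZ l by auto
  qed
qed

lemma inj_facets: "inj_on (\<lambda>l. {h \<in> K. l h = 0}) L"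
proof (rule inj_onI, rule ccontr)
  fix l l' assume ll': "l \<in> L" "l' \<in> L" "{h \<in> K. l h = 0} = {h \<in> K. l' h = 0}" "l \<noteq> l'"
  have "wit l \<in> {h \<in> K. l h = 0}"
    using wit ll'(1) unfolding K_def by (force intro: less_imp_le)
  then show False using ll' wit(3)[of l l'] by auto
qed

end

section \<open>Wall inequalities\<close>

context rooted_chamber
begin

abbreviation "R \<equiv> weight_orbit \<Phi> d \<alpha>"
abbreviation "N \<equiv> dynkin_neighbors d \<alpha>"
abbreviation "A \<equiv> cartan \<alpha>"

lemma N_subset: "N i \<subseteq> {1..d}" and finite_N: "finite (N i)" and not_self_N: "i \<notin> N i"
  by (auto simp: dynkin_neighbors_def)

lemma N_iff: "i \<in> {1..d} \<Longrightarrow> j \<in> N i \<longleftrightarrow> j \<in> {1..d} \<and> j \<noteq> i \<and> \<alpha> i \<bullet> \<alpha> j \<noteq> 0"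
  using simple_nonzero(1)[of i] by (auto simp: dynkin_neighbors_def cartan_def coroot_def)

lemma cartan_eq: "A j i = \<alpha> i \<bullet> coroot (\<alpha> j)"
  by (simp add: cartan_def inner_commute)

lemma cartan_self: "i \<in> {1..d} \<Longrightarrow> A i i = 2"
  by (simp add: cartan_eq inner_coroot_self simple_nonzero)

lemma cartan_zero: "i \<in> {1..d} \<Longrightarrow> j \<in> {1..d} - insert i (N i) \<Longrightarrow> A j i = 0"
  by (auto simp: cartan_eq inner_coroot_eq_0_iff N_iff)

lemma cartan_neg:
  assumes "i \<in> {1..d}" "j \<in> N i"
  shows "A j i < 0"
proof -
  have j: "j \<in> {1..d}" "j \<noteq> i" "\<alpha> i \<bullet> \<alpha> j \<noteq> 0" using assms N_iff by auto
  then have "\<alpha> i \<bullet> \<alpha> j < 0" using simple_obtuse[of i j] assms by auto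
  then show ?thesis
    using simple_nonzero(2)[OF j(1)] by (simp add: cartan_eq coroot_def mult_less_0_iff divide_less_0_iff)
qed

lemma sum_cartan:
  fixes f :: "nat \<Rightarrow> 'a::real_vector"
  assumes i: "i \<in> {1..d}"
  shows "(\<Sum>j\<in>{1..d}. A j i *\<^sub>R f j) = 2 *\<^sub>R f i + (\<Sum>j\<in>N i. A j i *\<^sub>R f j)"
proof -
  have "(\<Sum>j\<in>{1..d}. A j i *\<^sub>R f j) = (\<Sum>j\<in>insert i (N i). A j i *\<^sub>R f j)"
    using i N_subset cartan_zero[OF i] by (intro sum.mono_neutral_right) auto
  then show ?thesis using not_self_N finite_N cartan_self[OF i] by simp
qed

text \<open>The origin of the coefficients of \<open>wall\<close>, and of the index order
  \<open>A j i\<close>: the coordinate at \<omega> j is the pairing with the coroot of \<alpha>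
  j.\<close>

lemma simple_expansion:
  assumes i: "i \<in> {1..d}"
  shows "\<alpha> i = 2 *\<^sub>R \<omega> i + (\<Sum>j\<in>N i. A j i *\<^sub>R \<omega> j)"
proof -
  have "\<alpha> i = (\<Sum>j\<in>{1..d}. A j i *\<^sub>R \<omega> j)"
    unfolding cartan_eq by (intro weight_expansion span_base simple_is_root i)
  then show ?thesis using sum_cartan[OF i] by metis
qed

text \<open>The bend of \<open>h\<close> between the chambers \<open>w D\<close> and
  \<open>w (s i D)\<close>. With \<open>h\<close> as last argument, \<open>wall i w\<close> is
  itself a linear functional, so coincidences among the inequalities become equalities of
  functionals.\<close>

definition wall :: "nat \<Rightarrow> ('v \<Rightarrow> 'v) \<Rightarrow> ('v \<Rightarrow> real) \<Rightarrow> real"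
  where "wall i w h = h (w (\<omega> i)) + h (w (s i (\<omega> i))) + (\<Sum>j\<in>N i. A j i * h (w (\<omega> j)))"

lemma linear_wall: "linear (wall i w)"
  by (rule linearI)
    (simp_all add: wall_def scaleR_fun_def distrib_left sum.distrib sum_distrib_left mult.left_commute)

lemma R_memI: "w \<in> W \<Longrightarrow> i \<in> {1..d} \<Longrightarrow> w (\<omega> i) \<in> R"
  by (auto simp: weight_orbit_def)

lemma R_memE:
  assumes "x \<in> R"
  obtains w i where "w \<in> W" "i \<in> {1..d}" "x = w (\<omega> i)"
  using assms by (auto simp: weight_orbit_def)

lemma finite_R: "finite R"
proof -
  have "R \<subseteq> (\<lambda>(w, i). w (\<omega> i)) ` (W \<times> {1..d})"
    by (auto elim!: R_memE)
  then show ?thesis using finite_W by (auto intro: finite_subset)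
qed

lemma W_inv_cancel: "w \<in> W \<Longrightarrow> inv_into UNIV w (w x) = x" "w \<in> W \<Longrightarrow> w (inv_into UNIV w x) = x"
  using refl_grp_bij[of w \<Phi>] by (auto simp: bij_is_inj bij_is_surj surj_f_inv_f)

lemma W_inv_comp: "w \<in> W \<Longrightarrow> u \<in> W \<Longrightarrow> inv_into UNIV (w \<circ> u) x = inv_into UNIV u (inv_into UNIV w x)"
  by (metis W_inv_cancel comp_apply refl_grp_comp)

lemma W_R: "w \<in> W \<Longrightarrow> x \<in> R \<Longrightarrow> w x \<in> R"
  by (metis R_memE R_memI comp_apply refl_grp_comp)

lemma W_R_iff: "w \<in> W \<Longrightarrow> w x \<in> R \<longleftrightarrow> x \<in> R"
  using W_R[of w] W_R[OF refl_grp_inv, of w] W_inv_cancel by metis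

subsection \<open>Charts\<close>

text \<open>The linear piece belonging to the chamber \<open>w D\<close>: the pairings with the
  coroots are the coordinates of the inverse image of \<open>x\<close> in the weight basis.\<close>

definition chart :: "('v \<Rightarrow> real) \<Rightarrow> ('v \<Rightarrow> 'v) \<Rightarrow> 'v \<Rightarrow> real"
  where "chart h w x = (\<Sum>j\<in>{1..d}. h (w (\<omega> j)) * (inv_into UNIV w x \<bullet> coroot (\<alpha> j)))"

lemma linear_chart:
  assumes "w \<in> W"
  shows "linear (chart h w)"
  using refl_grp_linear[OF refl_grp_inv[OF assms]]
  by (intro linearI)
    (simp_all add: chart_def linear_add linear_scale inner_add_left distrib_left sum.distrib
      sum_distrib_left mult.left_commute)

lemma chart_weight:
  assumes "w \<in> W" "i \<in> {1..d}"
  shows "chart h w (w (\<omega> i)) = h (w (\<omega> i))"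
proof -
  have "chart h w (w (\<omega> i)) = (\<Sum>j\<in>{1..d}. h (w (\<omega> j)) * (if j = i then 1 else 0))"
    unfolding chart_def using assms by (intro sum.cong) (simp_all add: W_inv_cancel weight_coroot)
  then show ?thesis using assms(2) by (simp add: if_distrib[of "(*) _"] cong: if_cong)
qed

text \<open>Transporting from one chamber to the other fixes the dominant image \<open>y\<close> of
  \<open>x\<close>, so it is a product of simple reflections orthogonal to \<open>y\<close>. These
  fix every weight that occurs in \<open>y\<close> with a nonzero coordinate.\<close>

lemma chart_agree:
  assumes "u \<in> W" "w \<in> W" "dominant (inv_into UNIV u x)" "dominant (inv_into UNIV w x)"
  shows "chart h u x = chart h w x"
proof -
  define y where "y = inv_into UNIV w x"
  define v where "v = inv_into UNIV u \<circ> w"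
  have v: "v \<in> W" using assms by (simp add: v_def refl_grp_comp refl_grp_inv del: o_apply)
  have vy: "v y = inv_into UNIV u x" using assms by (simp add: v_def y_def W_inv_cancel)
  have v': "v \<in> refl_grp (\<alpha> ` {k\<in>{1..d}. y \<bullet> \<alpha> k = 0})" and "v y = y"
    using W_dominant[OF v, of y] assms vy by (auto simp: y_def)
  have "h (u (\<omega> j)) * (y \<bullet> coroot (\<alpha> j)) = h (w (\<omega> j)) * (y \<bullet> coroot (\<alpha> j))"
    if j: "j \<in> {1..d}" for j
  proof (cases "y \<bullet> \<alpha> j = 0")
    case False
    have "v (\<omega> j) = \<omega> j"
      using v' by (rule refl_grp_fixes) (use j False weight_simple in auto)
    then have "u (\<omega> j) = w (\<omega> j)"
      using assms(1) by (metis v_def comp_apply W_inv_cancel(2))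
    then show ?thesis by simp
  qed (simp add: inner_coroot_eq_0_iff)
  then show ?thesis
    unfolding chart_def using vy \<open>v y = y\<close> y_def by (intro sum.cong) auto
qed

text \<open>A suitable \<open>w\<close> exists by \<open>ex_dominant\<close>, and by
  \<open>chart_agree\<close> the value does not depend on the choice.\<close>

definition pl_ext :: "('v \<Rightarrow> real) \<Rightarrow> 'v \<Rightarrow> real"
  where "pl_ext h x = chart h (SOME w. w \<in> W \<and> dominant (inv_into UNIV w x)) x"

lemma pl_ext_eq:
  assumes "w \<in> W" "dominant (inv_into UNIV w x)"
  shows "pl_ext h x = chart h w x"
proof -
  have "\<exists>w. w \<in> W \<and> dominant (inv_into UNIV w x)" using assms by blast
  from someI_ex[OF this] show ?thesis
    unfolding pl_ext_def using assms by (intro chart_agree) auto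
qed

text \<open>The two charts agree on the common wall, hence differ by a multiple of the linear form
  vanishing there. The factor is computed from the change of a single weight, \<omega> i to
  \<open>s i (\<omega> i)\<close>.\<close>

lemma chart_cross:
  assumes w: "w \<in> W" and i: "i \<in> {1..d}"
  shows "chart h (w \<circ> s i) x = chart h w x - wall i w h * (inv_into UNIV w x \<bullet> coroot (\<alpha> i))"
proof -
  define y where "y = inv_into UNIV w x"
  define c where "c = y \<bullet> coroot (\<alpha> i)"
  let ?I = "{1..d} - {i}"
  have inv: "inv_into UNIV (w \<circ> s i) x = s i y"
    using W_inv_comp[OF w s_in_W[OF i]] W_inv_cancel(1)[OF s_in_W[OF i]]
    by (metis reflection_involution y_def)
  have sy: "s i y \<bullet> coroot (\<alpha> j) = y \<bullet> coroot (\<alpha> j) - c * A j i" for j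
    by (simp add: reflection_coroot inner_diff_left c_def cartan_eq)
  have "chart h (w \<circ> s i) x = h (w (s i (\<omega> i))) * (c - c * A i i)
      + (\<Sum>j\<in>?I. h (w (s i (\<omega> j))) * (y \<bullet> coroot (\<alpha> j) - c * A j i))"
    unfolding chart_def inv sy using i by (subst sum.remove[of _ i]) (simp_all add: c_def)
  also have "(\<Sum>j\<in>?I. h (w (s i (\<omega> j))) * (y \<bullet> coroot (\<alpha> j) - c * A j i))
      = (\<Sum>j\<in>?I. h (w (\<omega> j)) * (y \<bullet> coroot (\<alpha> j))) - c * (\<Sum>j\<in>?I. A j i * h (w (\<omega> j)))"
    using i by (simp add: s_weight sum_distrib_left right_diff_distrib sum_subtractf mult_ac)
  also have "(\<Sum>j\<in>?I. A j i * h (w (\<omega> j))) = (\<Sum>j\<in>N i. A j i * h (w (\<omega> j)))"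
    using N_subset not_self_N cartan_zero[OF i] by (intro sum.mono_neutral_right) auto
  also have "(\<Sum>j\<in>?I. h (w (\<omega> j)) * (y \<bullet> coroot (\<alpha> j))) = chart h w x - h (w (\<omega> i)) * c"
    unfolding chart_def y_def[symmetric] using i
    by (subst (2) sum.remove[of _ i]) (simp_all add: c_def)
  finally show ?thesis
    using cartan_self[OF i] by (simp add: wall_def c_def y_def algebra_simps comp_def)
qed

text \<open>The passage from local to global convexity: in \<open>chamber_descent\<close> a step is
  taken only where the pairing with the coroot is negative, and there \<open>chart_cross\<close>
  with a nonnegative wall value raises the chart at \<open>x\<close>.\<close>

lemma chart_le_pl_ext:
  assumes walls: "\<And>i w. i \<in> {1..d} \<Longrightarrow> w \<in> W \<Longrightarrow> 0 \<le> wall i w h" and u: "u \<in> W"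
  shows "chart h u x \<le> pl_ext h x"
proof -
  have "\<exists>w\<in>W. chart h u x \<le> chart h w x \<and> dominant (inv_into UNIV w x)"
  proof (rule chamber_descent[OF u])
    fix w i assume *: "w \<in> W" "i \<in> {1..d}" "chart h u x \<le> chart h w x" "x \<bullet> w (\<alpha> i) < 0"
    have "inv_into UNIV w x \<bullet> \<alpha> i < 0"
      using *(4) refl_grp_inner_inv[OF *(1), of "\<alpha> i" x] by (simp add: inner_commute)
    then have "inv_into UNIV w x \<bullet> coroot (\<alpha> i) < 0"
      using simple_nonzero(2)[OF *(2)] by (simp add: coroot_def mult_less_0_iff divide_less_0_iff)
    then have "wall i w h * (inv_into UNIV w x \<bullet> coroot (\<alpha> i)) \<le> 0"
      using walls[OF *(2,1)] by (simp add: mult_nonneg_nonpos)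
    then show "chart h u x \<le> chart h (w \<circ> s i) x"
      using *(3) chart_cross[OF *(1,2), of h x] by linarith
  qed simp
  then show ?thesis using pl_ext_eq by metis
qed

subsection \<open>The chambers\<close>

lemma sign_cell_image:
  assumes "w \<in> W"
  shows "sign_cell \<Phi> (w y) = w ` sign_cell \<Phi> y"
proof -
  have *: "w z \<in> sign_cell \<Phi> (w y)" if "z \<in> sign_cell \<Phi> y" "w \<in> W" for w y z
  proof -
    have "0 \<le> (w y \<bullet> \<beta>) * (w z \<bullet> \<beta>)" if "\<beta> \<in> \<Phi>" for \<beta>
      using \<open>z \<in> _\<close> W_root[OF refl_grp_inv[OF \<open>w \<in> W\<close>] that]
      by (simp add: refl_grp_inner_inv[OF \<open>w \<in> W\<close>] sign_cell_def)
    then show ?thesis using that W_span by (simp add: sign_cell_def)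
  qed
  have "z \<in> w ` sign_cell \<Phi> y" if "z \<in> sign_cell \<Phi> (w y)" for z
    using *[OF that refl_grp_inv[OF assms]] assms by (metis W_inv_cancel image_eqI)
  then show ?thesis using * assms by auto
qed

lemma sign_cell_dominant:
  assumes "dominant y" "\<And>\<beta>. \<beta> \<in> \<Phi> \<Longrightarrow> y \<bullet> \<beta> \<noteq> 0"
  shows "sign_cell \<Phi> y = D"
proof -
  have pos: "y \<bullet> \<beta> > 0" if "\<beta> \<in> pos_roots" for \<beta>
    using dominant_pos_root[OF assms(1) that] assms(2)[of \<beta>] that pos_roots_subset by force
  have "0 \<le> (y \<bullet> \<beta>) * (z \<bullet> \<beta>) \<longleftrightarrow> 0 \<le> (base_point \<bullet> \<beta>) * (z \<bullet> \<beta>)" if "\<beta> \<in> \<Phi>" for z \<beta>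
    using pos_or_neg[OF that]
  proof
    assume "\<beta> \<in> pos_roots"
    then show ?thesis using pos[of \<beta>] by (simp add: pos_roots_def zero_le_mult_iff)
  next
    assume "- \<beta> \<in> pos_roots"
    then show ?thesis using pos[of "- \<beta>"] by (simp add: pos_roots_def zero_le_mult_iff)
  qed
  then have "sign_cell \<Phi> y = sign_cell \<Phi> base_point" by (auto simp: sign_cell_def)
  then show ?thesis using base_point(3) by simp
qed

text \<open>A regular point has a regular dominant image, and every regular dominant point has
  \<open>D\<close> as its sign cell.\<close>

lemma chambers_eq: "chambers \<Phi> = {w ` D | w. w \<in> W}"
proof
  show "{w ` D | w. w \<in> W} \<subseteq> chambers \<Phi>"
  proof clarify
    fix w assume w: "w \<in> W"
    have "w ` D = sign_cell \<Phi> (w base_point)"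
      using sign_cell_image[OF w] base_point(3) by metis
    moreover have "w base_point \<bullet> \<beta> \<noteq> 0" if "\<beta> \<in> \<Phi>" for \<beta>
      using base_point(2) W_root[OF refl_grp_inv[OF w] that] by (simp add: refl_grp_inner_inv[OF w])
    ultimately show "w ` D \<in> chambers \<Phi>"
      unfolding chambers_eq_sign_cells using W_span[OF w base_point(1)] by blast
  qed
next
  show "chambers \<Phi> \<subseteq> {w ` D | w. w \<in> W}"
  proof
    fix C assume "C \<in> chambers \<Phi>"
    then obtain x where x: "C = sign_cell \<Phi> x" "\<And>\<beta>. \<beta> \<in> \<Phi> \<Longrightarrow> x \<bullet> \<beta> \<noteq> 0"
      by (auto simp: chambers_eq_sign_cells)
    obtain w where w: "w \<in> W" "dominant (inv_into UNIV w x)" using ex_dominant by blast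
    have "inv_into UNIV w x \<bullet> \<beta> \<noteq> 0" if "\<beta> \<in> \<Phi>" for \<beta>
      using x(2)[OF W_root[OF w(1) that]] refl_grp_inner_inv[OF w(1), of \<beta> x]
      by (simp add: inner_commute)
    then have "sign_cell \<Phi> (inv_into UNIV w x) = D" using sign_cell_dominant w(2) by blast
    then have "C = w ` D" using sign_cell_image[OF w(1)] x(1) W_inv_cancel(2)[OF w(1)] by metis
    then show "C \<in> {w ` D | w. w \<in> W}" using w by blast
  qed
qed

lemma mem_chamber:
  assumes "w \<in> W"
  shows "x \<in> w ` D \<longleftrightarrow> x \<in> span \<Phi> \<and> dominant (inv_into UNIV w x)"
proof
  assume "x \<in> w ` D"
  then show "x \<in> span \<Phi> \<and> dominant (inv_into UNIV w x)"
    using assms W_span by (auto simp: mem_D W_inv_cancel)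
next
  assume "x \<in> span \<Phi> \<and> dominant (inv_into UNIV w x)"
  then have "inv_into UNIV w x \<in> D" using W_span[OF refl_grp_inv[OF assms]] by (simp add: mem_D)
  then show "x \<in> w ` D" using W_inv_cancel(2)[OF assms] by (metis image_eqI)
qed

lemma convex_chamber:
  assumes "w \<in> W"
  shows "convex (w ` D)"
proof (rule convex_linear_image[OF refl_grp_linear[OF assms]])
  have "D = span \<Phi> \<inter> (\<Inter>i\<in>{1..d}. {x. \<alpha> i \<bullet> x \<ge> 0})"
    by (auto simp: mem_D dominant_def inner_commute)
  moreover have "convex \<dots>"
    by (intro convex_Int convex_INT convex_halfspace_ge subspace_imp_convex subspace_span)
  ultimately show "convex D" by simp
qed

lemma chamber_in_complex: "w \<in> W \<Longrightarrow> w ` D \<in> coxeter_complex \<Phi>"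
  using convex_chamber[of w] chambers_eq base_point_in_D
  by (auto simp: coxeter_complex_def intro: face_of_refl)

subsection \<open>Submodularity as wall inequalities\<close>

text \<open>Convexity is tested at the midpoint \<open>m\<close> of \<omega> i and
  \<open>s i (\<omega> i)\<close>. It lies in \<open>D\<close> because simple roots are pairwise
  obtuse, and by \<open>simple_expansion\<close> it is a combination of the neighbouring weights, on
  which the linear piece of \<open>f\<close> is known.\<close>

lemma submodular_wall:
  assumes h: "submodular \<Phi> d \<alpha> h" and i: "i \<in> {1..d}" and w: "w \<in> W"
  shows "0 \<le> wall i w h"
proof -
  obtain f where f: "piecewise_linear_on_fan \<Phi> f" "\<And>x. x \<in> R \<Longrightarrow> f x = h x" "convex_on (span \<Phi>) f"
    using h unfolding submodular_def by blast
  obtain g where g: "linear g" "\<And>x. x \<in> w ` D \<Longrightarrow> f x = g x"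
    using bspec[OF conjunct2[OF f(1)[unfolded piecewise_linear_on_fan_def]] chamber_in_complex[OF w]]
    by blast
  have lw: "linear w" by (rule refl_grp_linear[OF w])
  define m where "m = \<omega> i - (1/2) *\<^sub>R \<alpha> i"
  have m1: "m = (1 - 1/2) *\<^sub>R \<omega> i + (1/2) *\<^sub>R s i (\<omega> i)"
    using i by (simp add: m_def s_weight scaleR_diff_right flip: scaleR_left_distrib)
  have m2: "m = (\<Sum>j\<in>N i. (- (A j i) / 2) *\<^sub>R \<omega> j)"
  proof -
    have "(1/2) *\<^sub>R \<alpha> i = \<omega> i + (1/2) *\<^sub>R (\<Sum>j\<in>N i. A j i *\<^sub>R \<omega> j)"
      by (subst simple_expansion[OF i]) (simp add: scaleR_add_right)
    then have "m = - ((1/2) *\<^sub>R (\<Sum>j\<in>N i. A j i *\<^sub>R \<omega> j))" by (simp add: m_def)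
    then show ?thesis by (simp add: scaleR_sum_right sum_negf)
  qed
  have "m \<in> D"
  proof -
    have "m \<bullet> \<alpha> k \<ge> 0" if k: "k \<in> {1..d}" for k
    proof (cases "k = i")
      case True
      then show ?thesis using weight_simple_self[OF i] by (simp add: m_def inner_diff_left)
    next
      case False
      then show ?thesis
        using weight_simple[OF i k] simple_obtuse[OF i k] by (simp add: m_def inner_diff_left)
    qed
    then show ?thesis
      using weight_in_span[OF i] simple_is_root[OF i]
      by (auto simp: mem_D dominant_def m_def intro: span_diff span_scale span_base)
  qed
  have "f (w m) \<le> (1 - 1/2) * f (w (\<omega> i)) + (1/2) * f (w (s i (\<omega> i)))"
    using convex_onD[OF f(3), of "1/2" "w (\<omega> i)" "w (s i (\<omega> i))"]
      W_span[OF w] W_span[OF s_in_W[OF i]] weight_in_span[OF i]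
    by (simp add: m1 linear_add[OF lw] linear_scale[OF lw])
  moreover have "f (w (\<omega> i)) = h (w (\<omega> i))" by (intro f(2) R_memI w i)
  moreover have "f (w (s i (\<omega> i))) = h (w (s i (\<omega> i)))"
    using R_memI[OF refl_grp_comp[OF w s_in_W[OF i]] i] by (intro f(2)) simp
  moreover have "f (w m) = (\<Sum>j\<in>N i. (- (A j i) / 2) * h (w (\<omega> j)))"
  proof -
    have gh: "g (w (\<omega> j)) = h (w (\<omega> j))" if "j \<in> N i" for j
    proof -
      have "j \<in> {1..d}" using that N_subset by blast
      then show ?thesis
        using g(2)[of "w (\<omega> j)"] f(2)[OF R_memI[OF w, of j]] weight_in_D[of j] by auto
    qed
    have "f (w m) = g (w m)" using \<open>m \<in> D\<close> by (intro g(2)) auto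
    also have "\<dots> = (\<Sum>j\<in>N i. (- (A j i) / 2) * g (w (\<omega> j)))"
      unfolding m2 by (simp only: linear_sum[OF lw] linear_scale[OF lw] linear_sum[OF g(1)]
          linear_scale[OF g(1)] real_scaleR_def)
    finally show ?thesis using gh by simp
  qed
  moreover have "(\<Sum>j\<in>N i. (- (A j i) / 2) * h (w (\<omega> j))) = - (\<Sum>j\<in>N i. A j i * h (w (\<omega> j))) / 2"
    by (simp add: sum_negf sum_divide_distrib)
  ultimately show ?thesis by (simp add: wall_def)
qed

text \<open>At each point the active chart is a linear minorant of \<open>pl_ext\<close> with
  equality, which gives convexity. Continuity holds since finitely many closed chambers cover the
  span.\<close>

lemma wall_submodular:
  assumes walls: "\<And>i w. i \<in> {1..d} \<Longrightarrow> w \<in> W \<Longrightarrow> 0 \<le> wall i w h"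
  shows "submodular \<Phi> d \<alpha> h"
  unfolding submodular_def
proof (intro exI[of _ "pl_ext h"] conjI ballI)
  fix x assume "x \<in> R"
  then obtain w i where x: "w \<in> W" "i \<in> {1..d}" "x = w (\<omega> i)" by (auto simp: weight_orbit_def)
  then show "pl_ext h x = h x"
    using pl_ext_eq[of w x h] chart_weight[of w i h] weight_is_dominant by (simp add: W_inv_cancel)
next
  have cone: "pl_ext h x = chart h w x" if "x \<in> w ` D" "w \<in> W" for x w
    using that mem_chamber pl_ext_eq by blast
  show "piecewise_linear_on_fan \<Phi> (pl_ext h)"
    unfolding piecewise_linear_on_fan_def
  proof (intro conjI ballI)
    fix C assume "C \<in> coxeter_complex \<Phi>"
    then obtain w where w: "w \<in> W" "C \<subseteq> w ` D"
      using face_of_imp_subset unfolding coxeter_complex_def chambers_eq by blast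
    then show "\<exists>g. linear g \<and> (\<forall>x\<in>C. pl_ext h x = g x)"
      using linear_chart cone by blast
  next
    have cov: "span \<Phi> = (\<Union>w\<in>W. w ` D)"
      using ex_dominant mem_chamber by blast
    show "continuous_on (span \<Phi>) (pl_ext h)"
      unfolding cov
    proof (rule continuous_on_closed_Union)
      fix w assume w: "w \<in> W"
      then have "w ` D \<in> chambers \<Phi>" using chambers_eq by blast
      then show "closed (w ` D)" by (auto simp: chambers_def)
      have "continuous_on (w ` D) (chart h w)"
        using linear_chart[OF w] by (intro linear_continuous_on) (simp add: linear_conv_bounded_linear)
      then show "continuous_on (w ` D) (pl_ext h)"
        using cone w by (subst continuous_on_cong[OF refl, of _ _ "chart h w"]) auto
    qed (rule finite_W)
  qed
next
  show "convex_on (span \<Phi>) (pl_ext h)"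
  proof (rule convex_onI)
    fix t :: real and x y :: 'v assume t: "0 < t" "t < 1"
    let ?z = "(1 - t) *\<^sub>R x + t *\<^sub>R y"
    obtain w where w: "w \<in> W" "dominant (inv_into UNIV w ?z)" using ex_dominant by blast
    have "pl_ext h ?z = chart h w ?z" using pl_ext_eq w by blast
    also have "\<dots> = (1 - t) * chart h w x + t * chart h w y"
      using linear_chart[OF w(1)] by (simp add: linear_add linear_scale)
    also have "\<dots> \<le> (1 - t) * pl_ext h x + t * pl_ext h y"
      using t chart_le_pl_ext[OF walls w(1)] by (intro add_mono mult_left_mono) auto
    finally show "pl_ext h ?z \<le> (1 - t) * pl_ext h x + t * pl_ext h y" .
  qed (intro subspace_imp_convex subspace_span)
qed

definition "fun_space = {h :: 'v \<Rightarrow> real. \<forall>x. x \<notin> R \<longrightarrow> h x = 0}"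

definition "walls = {wall i w | i w. i \<in> {1..d} \<and> w \<in> W}"

lemma SF_eq: "SF \<Phi> d \<alpha> = {h \<in> fun_space. \<forall>l\<in>walls. 0 \<le> l h}"
proof -
  have "submodular \<Phi> d \<alpha> h \<longleftrightarrow> (\<forall>l\<in>walls. 0 \<le> l h)" for h
  proof
    assume "submodular \<Phi> d \<alpha> h"
    then show "\<forall>l\<in>walls. 0 \<le> l h" using submodular_wall by (auto simp: walls_def)
  next
    assume *: "\<forall>l\<in>walls. 0 \<le> l h"
    have "0 \<le> wall i w h" if "i \<in> {1..d}" "w \<in> W" for i w
      using * that unfolding walls_def by blast
    then show "submodular \<Phi> d \<alpha> h" by (rule wall_submodular)
  qed
  then show ?thesis by (simp add: SF_def fun_space_def)
qed

end

section \<open>Facets of the cone of submodular functions\<close>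

lemma sum_apply_fun: "(\<Sum>a\<in>I. f a) x = (\<Sum>a\<in>I. f a x)"
  for f :: "'i \<Rightarrow> 'a \<Rightarrow> 'b::comm_monoid_add"
  by (induction I rule: infinite_finite_induct) simp_all

context rooted_chamber
begin

section \<open>Test functions that separate the wall functionals\<close>

definition orbit_index :: "'v \<Rightarrow> nat"
  where "orbit_index x = (THE k. k \<in> {1..d} \<and> (\<exists>w\<in>W. x = w (\<omega> k)))"

lemma orbit_index: "w \<in> W \<Longrightarrow> k \<in> {1..d} \<Longrightarrow> orbit_index (w (\<omega> k)) = k"
  unfolding orbit_index_def
  by (rule the_equality) (use weight_orbits_disjoint in \<open>blast+\<close>)

lemma R_memI': "w \<in> W \<Longrightarrow> k \<in> {1..d} \<Longrightarrow> w (s k (\<omega> k)) \<in> R"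
  using R_memI[OF refl_grp_comp[OF _ s_in_W], of w k k] by simp

lemma orbit_index': "w \<in> W \<Longrightarrow> k \<in> {1..d} \<Longrightarrow> orbit_index (w (s k (\<omega> k))) = k"
  using orbit_index[OF refl_grp_comp[OF _ s_in_W], of w k k] by simp

text \<open>For dominant \<mu> this is, on the weight orbits, the support function of the orbit
  polytope of \<mu>: in direction \<open>w (\<omega> k)\<close> the vertex \<open>w \<mu>\<close> is
  extremal.\<close>

definition level :: "'v \<Rightarrow> 'v \<Rightarrow> real"
  where "level \<mu> x = (if x \<in> R then \<mu> \<bullet> \<omega> (orbit_index x) else 0)"

lemma wall_level:
  assumes "i \<in> {1..d}" "w \<in> W"
  shows "wall i w (level \<mu>) = \<mu> \<bullet> \<alpha> i"
proof -
  have "level \<mu> (w (\<omega> j)) = \<mu> \<bullet> \<omega> j" if "j \<in> N i" for j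
    using that N_subset R_memI[OF assms(2)] orbit_index[OF assms(2)]
    by (metis level_def subsetD)
  then have "wall i w (level \<mu>) = 2 * (\<mu> \<bullet> \<omega> i) + (\<Sum>j\<in>N i. A j i * (\<mu> \<bullet> \<omega> j))"
    using assms by (simp add: wall_def level_def R_memI R_memI' orbit_index orbit_index')
  also have "\<dots> = \<mu> \<bullet> \<alpha> i"
    using arg_cong[OF simple_expansion[OF assms(1)], of "(\<bullet>) \<mu>"]
    by (simp add: inner_add_right inner_sum_right)
  finally show ?thesis .
qed

definition agree :: "nat \<Rightarrow> ('v \<Rightarrow> 'v) \<Rightarrow> ('v \<Rightarrow> 'v) \<Rightarrow> bool"
  where "agree i u w \<longleftrightarrow> (\<forall>j\<in>N i. w (\<omega> j) = u (\<omega> j))"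

text \<open>The neighbours of \<open>i\<close> enter \<open>wall i w\<close> with the negative
  coefficients \<open>A j i\<close>. Lowering the function at all their images except those under
  \<open>u\<close> thus raises exactly the walls of index \<open>i\<close> that disagree with
  \<open>u\<close>.\<close>

definition dent :: "nat \<Rightarrow> ('v \<Rightarrow> 'v) \<Rightarrow> 'v \<Rightarrow> real"
  where "dent i u x = (if x \<in> R \<and> orbit_index x \<in> N i \<and> x \<noteq> u (\<omega> (orbit_index x)) then - 1 else 0)"

lemma wall_dent:
  assumes i: "i \<in> {1..d}" and w: "w \<in> W"
  shows "wall i w (dent i u) = (\<Sum>j\<in>N i. if w (\<omega> j) = u (\<omega> j) then 0 else - A j i)"
proof -
  have "dent i u (w (\<omega> j)) = (if w (\<omega> j) = u (\<omega> j) then 0 else - 1)" if "j \<in> N i" for j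
  proof -
    have j: "j \<in> {1..d}" using that N_subset by blast
    show ?thesis using that by (simp add: dent_def R_memI[OF w j] orbit_index[OF w j])
  qed
  then have "(\<Sum>j\<in>N i. A j i * dent i u (w (\<omega> j)))
      = (\<Sum>j\<in>N i. if w (\<omega> j) = u (\<omega> j) then 0 else - A j i)"
    by (intro sum.cong) auto
  moreover have "dent i u (w (\<omega> i)) = 0" "dent i u (w (s i (\<omega> i))) = 0"
    using not_self_N by (simp_all add: dent_def orbit_index[OF w i] orbit_index'[OF w i])
  ultimately show ?thesis by (simp add: wall_def)
qed

lemma wall_dent_pos:
  assumes i: "i \<in> {1..d}" and w: "w \<in> W"
  shows "agree i u w \<Longrightarrow> wall i w (dent i u) = 0"
    and "\<not> agree i u w \<Longrightarrow> wall i w (dent i u) > 0"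
proof -
  assume "agree i u w"
  then show "wall i w (dent i u) = 0"
    unfolding wall_dent[OF i w] agree_def by (intro sum.neutral) auto
next
  assume "\<not> agree i u w"
  then obtain j where j: "j \<in> N i" "w (\<omega> j) \<noteq> u (\<omega> j)" by (auto simp: agree_def)
  show "wall i w (dent i u) > 0"
    unfolding wall_dent[OF i w]
    using j cartan_neg[OF i] by (intro sum_pos2[OF finite_N j(1)]) (auto simp: less_imp_le)
qed

text \<open>A generator \<open>s k\<close> with k outside N(i) fixes the neighbouring weights. For k
  = i it exchanges the first two terms; any other such k is orthogonal to \<alpha> i and fixes both
  arguments.\<close>

lemma stabilizer_wall:
  assumes i: "i \<in> {1..d}" and v: "v \<in> refl_grp (\<alpha> ` ({1..d} - N i))"
  shows "u \<in> W \<Longrightarrow> wall i (u \<circ> v) = wall i u"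
  using v
proof (induction arbitrary: u rule: refl_grp_induct)
  case (comp a v)
  then obtain k where k: "k \<in> {1..d}" "k \<notin> N i" "a = \<alpha> k" by auto
  have us: "u \<circ> s k \<in> W" using comp.prems s_in_W[OF k(1)] by (rule refl_grp_comp)
  have N: "s k (\<omega> j) = \<omega> j" if "j \<in> N i" for j
  proof -
    have "j \<in> {1..d}" "j \<noteq> k" using that N_subset k(2) by blast+
    then show ?thesis using s_weight(2)[OF k(1)] by blast
  qed
  have "wall i (u \<circ> s k) = wall i u"
  proof (cases "k = i")
    case True
    then show ?thesis using N by (auto simp: wall_def fun_eq_iff intro!: sum.cong)
  next
    case False
    then have "s k (\<omega> i) = \<omega> i" using s_weight(2)[OF k(1) i] by simp
    moreover have "\<alpha> i \<bullet> \<alpha> k = 0" using N_iff[OF i] k False by auto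
    then have "s k (s i (\<omega> i)) = s i (\<omega> i)"
      using weight_simple[OF i k(1) False] s_weight(1)[OF i]
      by (intro reflection_fixes) (simp add: inner_diff_left)
    ultimately show ?thesis using N by (auto simp: wall_def fun_eq_iff intro!: sum.cong)
  qed
  then show ?case
    using comp.IH[OF us] by (simp only: k(3) comp_assoc)
qed simp

text \<open>Fixing all neighbouring weights implies fixing their sum. This sum is dominant and
  orthogonal to precisely the simple roots outside N(i), so \<open>W_dominant\<close>
  applies.\<close>

lemma agree_imp_stabilizer:
  assumes i: "i \<in> {1..d}" and uw: "u \<in> W" "w \<in> W" and agree: "agree i u w"
  shows "inv_into UNIV u \<circ> w \<in> refl_grp (\<alpha> ` ({1..d} - N i))"
proof -
  define v where "v = inv_into UNIV u \<circ> w"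
  have v: "v \<in> W" unfolding v_def using uw by (intro refl_grp_comp refl_grp_inv)
  define x where "x = (\<Sum>j\<in>N i. \<omega> j)"
  have "v (\<omega> j) = \<omega> j" if "j \<in> N i" for j
    using agree that W_inv_cancel(1)[OF uw(1)] by (simp add: v_def agree_def)
  then have vx: "v x = x"
    unfolding x_def linear_sum[OF refl_grp_linear[OF v]] by (intro sum.cong) auto
  have x: "x \<bullet> \<alpha> k = (if k \<in> N i then \<omega> k \<bullet> \<alpha> k else 0)" if k: "k \<in> {1..d}" for k
  proof -
    have "x \<bullet> \<alpha> k = (\<Sum>j\<in>N i. if j = k then \<omega> k \<bullet> \<alpha> k else 0)"
      unfolding x_def inner_sum_left
    proof (rule sum.cong)
      fix j assume "j \<in> N i"
      then have "j \<in> {1..d}" using N_subset by blast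
      then show "\<omega> j \<bullet> \<alpha> k = (if j = k then \<omega> k \<bullet> \<alpha> k else 0)"
        using weight_simple[OF _ k, of j] by auto
    qed simp
    then show ?thesis using finite_N by simp
  qed
  have "dominant x" unfolding dominant_def using x weight_dominant by simp
  then have "v \<in> refl_grp (\<alpha> ` {k\<in>{1..d}. x \<bullet> \<alpha> k = 0})"
    using W_dominant(1)[OF v] vx by simp
  moreover have "{k\<in>{1..d}. x \<bullet> \<alpha> k = 0} = {1..d} - N i"
    using x weight_simple_self_pos by force
  ultimately show ?thesis unfolding v_def by simp
qed

text \<open>The function \<open>level (\<omega> k)\<close> tells the indices apart: walls of index k
  take a positive value on it, all others vanish.\<close>

lemma wall_eq_index:
  assumes "i \<in> {1..d}" "k \<in> {1..d}" "u \<in> W" "w \<in> W" "wall i u = wall k w"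
  shows "i = k"
proof (rule ccontr)
  assume "i \<noteq> k"
  have "\<omega> k \<bullet> \<alpha> i = \<omega> k \<bullet> \<alpha> k"
    using assms wall_level by metis
  then show False
    using weight_simple[of k i] weight_simple_self_pos[of k] assms \<open>i \<noteq> k\<close> by simp
qed

text \<open>A cycle of implications: the dent at \<open>u\<close> detects agreement, the stabilizer
  theorem turns agreement into a coset condition, and the stabilizer leaves the functional
  unchanged.\<close>

lemma wall_eq_iff:
  assumes i: "i \<in> {1..d}" and uw: "u \<in> W" "w \<in> W"
  shows "wall i u = wall i w \<longleftrightarrow> agree i u w"
    and "wall i u = wall i w \<longleftrightarrow> inv_into UNIV u \<circ> w \<in> refl_grp (\<alpha> ` ({1..d} - N i))"
proof -
  let ?P = "inv_into UNIV u \<circ> w \<in> refl_grp (\<alpha> ` ({1..d} - N i))"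
  have "agree i u w" if "wall i u = wall i w"
  proof -
    have "wall i w (dent i u) = 0"
      using wall_dent_pos(1)[OF i uw(1), of u] that by (simp add: agree_def)
    then show ?thesis using wall_dent_pos(2)[OF i uw(2), of u] by fastforce
  qed
  moreover have "?P" if "agree i u w" using agree_imp_stabilizer[OF i uw that] .
  moreover have "wall i u = wall i w" if ?P
  proof -
    have "u \<circ> (inv_into UNIV u \<circ> w) = w" using W_inv_cancel(2)[OF uw(1)] by (simp add: fun_eq_iff)
    then show ?thesis using stabilizer_wall[OF i that uw(1)] by metis
  qed
  ultimately show "wall i u = wall i w \<longleftrightarrow> agree i u w" "wall i u = wall i w \<longleftrightarrow> ?P"
    by blast+
qed

lemma walls_memI: "i \<in> {1..d} \<Longrightarrow> w \<in> W \<Longrightarrow> wall i w \<in> walls"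
  by (auto simp: walls_def)

lemma walls_memE:
  assumes "l \<in> walls"
  obtains i w where "i \<in> {1..d}" "w \<in> W" "l = wall i w"
  using assms by (auto simp: walls_def)

lemma walls_eq: "walls = (\<Union>i\<in>{1..d}. wall i ` W)"
  unfolding walls_def by blast

lemma finite_walls: "finite walls"
  using finite_W by (simp add: walls_eq)

text \<open>The level function of the sum of the fundamental weights other than \<open>\<omega> i\<close> gives equality in
  exactly the wall inequalities of index \<open>i\<close>; the dent separates these from each other.\<close>

lemma ex_facet_witness:
  assumes "l \<in> walls"
  shows "\<exists>q. q \<in> fun_space \<and> l q = 0 \<and> (\<forall>l'\<in>walls. l' \<noteq> l \<longrightarrow> l' q > 0)"
proof -
  obtain i u where i: "i \<in> {1..d}" and u: "u \<in> W" and l: "l = wall i u"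
    using assms by (rule walls_memE)
  define \<mu> where "\<mu> = (\<Sum>m\<in>{1..d} - {i}. \<omega> m)"
  have \<mu>: "\<mu> \<bullet> \<alpha> k = (if k = i then 0 else \<omega> k \<bullet> \<alpha> k)" if k: "k \<in> {1..d}" for k
  proof -
    have "\<mu> \<bullet> \<alpha> k = (\<Sum>j\<in>{1..d} - {i}. if j = k then \<omega> k \<bullet> \<alpha> k else 0)"
      unfolding \<mu>_def inner_sum_left using weight_simple[OF _ k] by (intro sum.cong) auto
    then show ?thesis using k by simp
  qed
  define L' where "L' = {wall k w | k w. k \<in> {1..d} - {i} \<and> w \<in> W}"
  have "L' \<subseteq> walls" unfolding L'_def walls_def by blast
  then have "finite L'" using finite_walls by (rule finite_subset)
  moreover have "l' (level \<mu>) > 0" if "l' \<in> L'" for l'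
    using that wall_level \<mu> weight_simple_self_pos by (auto simp: L'_def)
  \<comment> \<open>On walls of other indices the dent may be negative. A large multiple of the
    level function outweighs it there and contributes nothing at index \<open>i\<close>.\<close>
  ultimately obtain C where C: "C > 0" "\<forall>l'\<in>L'. C * l' (level \<mu>) + l' (dent i u) > 0"
    using ex_scale_pos[of L' "\<lambda>l. l (level \<mu>)" "\<lambda>l. l (dent i u)"] by blast
  define q where "q = C *\<^sub>R level \<mu> + dent i u"
  have q: "wall k w q = C * wall k w (level \<mu>) + wall k w (dent i u)" for k w
    by (simp add: q_def linear_add[OF linear_wall] linear_scale[OF linear_wall])
  have "q \<in> fun_space"
    by (auto simp: fun_space_def q_def level_def dent_def scaleR_fun_def)
  moreover have "l q = 0"
    using wall_dent_pos(1)[OF i u, of u] wall_level[OF i u] \<mu>[OF i]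
    by (simp add: l q agree_def)
  moreover have "l' q > 0" if l': "l' \<in> walls" "l' \<noteq> l" for l'
  proof -
    obtain k w where k: "k \<in> {1..d}" and w: "w \<in> W" and l'_eq: "l' = wall k w"
      using l'(1) by (rule walls_memE)
    show ?thesis
    proof (cases "k = i")
      case True
      then have "\<not> agree i u w" using wall_eq_iff(1)[OF i u w] l'(2) l l'_eq by metis
      then show ?thesis
        using wall_dent_pos(2)[OF i w] wall_level[OF i w] \<mu>[OF i] by (simp add: l'_eq q True)
    next
      case False
      then have "l' \<in> L'" using k w l'_eq unfolding L'_def by blast
      then show ?thesis using C(2) unfolding l'_eq q by blast
    qed
  qed
  ultimately show ?thesis by blast
qed

section \<open>The facets of the cone and the action of the Weyl group on them\<close>

definition facet_witness :: "(('v \<Rightarrow> real) \<Rightarrow> real) \<Rightarrow> 'v \<Rightarrow> real"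
  where "facet_witness l = (SOME q. q \<in> fun_space \<and> l q = 0 \<and> (\<forall>l'\<in>walls. l' \<noteq> l \<longrightarrow> l' q > 0))"

definition unit_fun :: "'v \<Rightarrow> 'v \<Rightarrow> real" where "unit_fun r x = (if x = r then 1 else 0)"

text \<open>Finiteness of the weight orbits provides the finite spanning set.
  \<open>level \<rho>\<close> is interior because its wall values are the positive numbers
  \<open>\<rho> \<bullet> \<alpha> i\<close>.\<close>

lemma polyhedral_SF: "polyhedral_cone fun_space (unit_fun ` R) walls (level \<rho>) facet_witness"
proof (rule polyhedral_cone.intro)
  show "subspace fun_space"
    by (auto simp: subspace_def fun_space_def scaleR_fun_def)
  show "finite (unit_fun ` R)" using finite_R by simp
  show "fun_space \<subseteq> span (unit_fun ` R)"
  proof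
    fix h assume h: "h \<in> fun_space"
    have "h = (\<Sum>r\<in>R. h r *\<^sub>R unit_fun r)"
    proof
      fix x
      have "(\<Sum>r\<in>R. h r *\<^sub>R unit_fun r) x = (\<Sum>r\<in>R. if x = r then h r else 0)"
        unfolding sum_apply_fun by (intro sum.cong) (auto simp: scaleR_fun_def unit_fun_def)
      also have "\<dots> = h x" using h finite_R by (simp add: fun_space_def)
      finally show "h x = (\<Sum>r\<in>R. h r *\<^sub>R unit_fun r) x" by simp
    qed
    moreover have "(\<Sum>r\<in>R. h r *\<^sub>R unit_fun r) \<in> span (unit_fun ` R)"
      by (intro span_sum span_scale span_base imageI)
    ultimately show "h \<in> span (unit_fun ` R)" by metis
  qed
  show "finite walls" by (rule finite_walls)
  show "linear l" if "l \<in> walls" for l using that linear_wall by (auto elim: walls_memE)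
  show "level \<rho> \<in> fun_space" by (auto simp: fun_space_def level_def)
  show "l (level \<rho>) > 0" if "l \<in> walls" for l
    using that by (auto elim!: walls_memE simp: wall_level \<rho>_simple)
  have wit: "facet_witness l \<in> fun_space \<and> l (facet_witness l) = 0 \<and>
      (\<forall>l'\<in>walls. l' \<noteq> l \<longrightarrow> l' (facet_witness l) > 0)" if "l \<in> walls" for l
    unfolding facet_witness_def using someI_ex[OF ex_facet_witness[OF that]] .
  show "facet_witness l \<in> fun_space" "l (facet_witness l) = 0" if "l \<in> walls" for l
    using wit[OF that] by auto
  show "l' (facet_witness l) > 0" if "l \<in> walls" "l' \<in> walls" "l' \<noteq> l" for l l'
    using wit[OF that(1)] that by auto
qed

definition facet :: "(('v \<Rightarrow> real) \<Rightarrow> real) \<Rightarrow> ('v \<Rightarrow> real) set"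
  where "facet l = {h \<in> SF \<Phi> d \<alpha>. l h = 0}"

lemma cone_facets_SF: "cone_facets (SF \<Phi> d \<alpha>) = facet ` walls"
  and inj_facet: "inj_on facet walls"
proof -
  interpret polyhedral_cone fun_space "unit_fun ` R" walls "level \<rho>" facet_witness
    by (rule polyhedral_SF)
  have K: "K = SF \<Phi> d \<alpha>" unfolding K_def SF_eq ..
  have facet: "facet = (\<lambda>l. {h \<in> K. l h = 0})" by (auto simp: facet_def K fun_eq_iff)
  show "cone_facets (SF \<Phi> d \<alpha>) = facet ` walls" using cone_facets_K unfolding facet K .
  show "inj_on facet walls" using inj_facets unfolding facet .
qed

lemma finite_facets: "finite (cone_facets (SF \<Phi> d \<alpha>))"
  by (simp add: cone_facets_SF finite_walls)

lemma card_facets: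
  "real (card (cone_facets (SF \<Phi> d \<alpha>))) =
    (\<Sum>i=1..d. real (card W) / real (card (refl_grp (\<alpha> ` ({1..d} - N i)))))"
proof -
  have "card (cone_facets (SF \<Phi> d \<alpha>)) = card walls"
    unfolding cone_facets_SF by (rule card_image[OF inj_facet])
  also have "card walls = (\<Sum>i\<in>{1..d}. card (wall i ` W))"
    unfolding walls_eq
  proof (rule card_UN_disjoint)
    show "\<forall>i\<in>{1..d}. \<forall>k\<in>{1..d}. i \<noteq> k \<longrightarrow> wall i ` W \<inter> wall k ` W = {}"
      using wall_eq_index by blast
  qed (use finite_W in auto)
  finally have "real (card (cone_facets (SF \<Phi> d \<alpha>))) = (\<Sum>i=1..d. real (card (wall i ` W)))"
    by simp
  also have "\<dots> = (\<Sum>i=1..d. real (card W) / real (card (refl_grp (\<alpha> ` ({1..d} - N i)))))"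
  proof (rule sum.cong)
    fix i assume i: "i \<in> {1..d}"
    let ?H = "refl_grp (\<alpha> ` ({1..d} - N i))"
    have sub: "?H \<subseteq> W" using simple_is_root by (intro refl_grp_mono) auto
    then have "card ?H > 0" using finite_W by (intro card_refl_grp_pos) (rule finite_subset)
    moreover have "card W = card (wall i ` W) * card ?H"
      by (rule card_image_cosets[OF finite_W sub wall_eq_iff(2)[OF i]])
    ultimately show "real (card (wall i ` W)) = real (card W) / real (card ?H)" by simp
  qed simp
  finally show ?thesis .
qed

lemma wall_act:
  assumes "w \<in> W"
  shows "wall i (w \<circ> u) (act w h) = wall i u h"
  using W_inv_cancel(1)[OF assms] by (simp add: wall_def act_def)

lemma act_SF:
  assumes w: "w \<in> W" and h: "h \<in> SF \<Phi> d \<alpha>"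
  shows "act w h \<in> SF \<Phi> d \<alpha>"
proof -
  have "act w h \<in> fun_space"
    using h W_R_iff[OF refl_grp_inv[OF w]] by (auto simp: SF_eq fun_space_def act_def)
  moreover have "0 \<le> l (act w h)" if "l \<in> walls" for l
    using that
  proof (rule walls_memE)
    fix i u assume l: "i \<in> {1..d}" "u \<in> W" "l = wall i u"
    have "w \<circ> (inv_into UNIV w \<circ> u) = u" using W_inv_cancel(2)[OF w] by (simp add: fun_eq_iff)
    then have "l (act w h) = wall i (inv_into UNIV w \<circ> u) h"
      using wall_act[OF w, of i "inv_into UNIV w \<circ> u" h] l(3) by metis
    moreover have "inv_into UNIV w \<circ> u \<in> W" using w l by (intro refl_grp_comp refl_grp_inv)
    ultimately show ?thesis using h walls_memI[OF l(1)] by (auto simp: SF_eq)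
  qed
  ultimately show ?thesis by (simp add: SF_eq)
qed

lemma act_facet:
  assumes w: "w \<in> W"
  shows "act_set w (facet (wall i u)) = facet (wall i (w \<circ> u))"
proof
  show "act_set w (facet (wall i u)) \<subseteq> facet (wall i (w \<circ> u))"
    using wall_act[OF w] act_SF[OF w] by (auto simp: act_set_def facet_def)
  show "facet (wall i (w \<circ> u)) \<subseteq> act_set w (facet (wall i u))"
  proof
    fix h assume h: "h \<in> facet (wall i (w \<circ> u))"
    define h' where "h' = act (inv_into UNIV w) h"
    have h_eq: "h = act w h'"
      using W_inv_cancel[OF w] W_inv_cancel[OF refl_grp_inv[OF w]]
      by (simp add: h'_def act_def fun_eq_iff)
    have "h' \<in> SF \<Phi> d \<alpha>"
      using h act_SF[OF refl_grp_inv[OF w]] by (simp add: h'_def facet_def)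
    moreover have "wall i u h' = 0"
      using h wall_act[OF w, of i u h'] h_eq by (simp add: facet_def)
    ultimately show "h \<in> act_set w (facet (wall i u))"
      unfolding act_set_def using h_eq by (auto simp: facet_def)
  qed
qed

text \<open>The group permutes the walls by left multiplication, transitively for a fixed index, and
  different indices give different facets.\<close>

lemma card_facet_orbits:
  "card (orbits (reflection_group \<Phi>) (cone_facets (SF \<Phi> d \<alpha>)) act_set) = d"
proof -
  define O' where "O' i = (\<lambda>w. facet (wall i w)) ` W" for i
  have orb: "orbit (reflection_group \<Phi>) act_set (facet (wall i u)) = O' i" if u: "u \<in> W" for i u
  proof -
    have "orbit (reflection_group \<Phi>) act_set (facet (wall i u)) = (\<lambda>w. facet (wall i (w \<circ> u))) ` W"
      unfolding orbit_def image_def using act_facet by (intro Collect_cong) metis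
    also have "\<dots> = (\<lambda>w. facet (wall i w)) ` ((\<lambda>w. w \<circ> u) ` W)" by (simp add: image_image)
    also have "(\<lambda>w. w \<circ> u) ` W = W"
    proof
      show "(\<lambda>w. w \<circ> u) ` W \<subseteq> W" using u refl_grp_comp by blast
      show "W \<subseteq> (\<lambda>w. w \<circ> u) ` W"
      proof
        fix w assume "w \<in> W"
        then have "w \<circ> inv_into UNIV u \<in> W" using u by (intro refl_grp_comp refl_grp_inv)
        moreover have "w = w \<circ> inv_into UNIV u \<circ> u"
          using W_inv_cancel(1)[OF u] by (simp add: fun_eq_iff)
        ultimately show "w \<in> (\<lambda>w. w \<circ> u) ` W" by blast
      qed
    qed
    finally show ?thesis by (simp add: O'_def)
  qed
  have "orbits (reflection_group \<Phi>) (cone_facets (SF \<Phi> d \<alpha>)) act_set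
      = {orbit (reflection_group \<Phi>) act_set (facet (wall i u)) | i u. i \<in> {1..d} \<and> u \<in> W}"
    unfolding orbits_def cone_facets_SF walls_def by blast
  also have "\<dots> = O' ` {1..d}"
    using orb refl_grp_id[of \<Phi>] by (auto simp: image_iff) blast
  finally have "orbits (reflection_group \<Phi>) (cone_facets (SF \<Phi> d \<alpha>)) act_set = O' ` {1..d}" .
  moreover have "inj_on O' {1..d}"
  proof (rule inj_onI)
    fix i k assume ik: "i \<in> {1..d}" "k \<in> {1..d}" "O' i = O' k"
    have "facet (wall i id) \<in> O' i" unfolding O'_def using refl_grp_id by blast
    then obtain w where w: "w \<in> W" "facet (wall i id) = facet (wall k w)"
      unfolding ik(3) by (auto simp: O'_def)
    then have "wall i id = wall k w"
      using inj_onD[OF inj_facet] walls_memI ik refl_grp_id by metis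
    then show "i = k" using wall_eq_index[OF ik(1,2) refl_grp_id w(1)] by blast
  qed
  ultimately show ?thesis by (simp add: card_image)
qed

end

section \<open>Counting facets by a set of vectors\<close>

context rooted_chamber
begin

text \<open>Pair the decomposition with \<omega> k for k other than i: two nonnegative terms add up
  to 0.\<close>

lemma simple_indecomposable:
  assumes i: "i \<in> {1..d}" and \<beta>: "\<beta> \<in> pos_roots" "\<gamma> \<in> pos_roots"
    and c: "c > 0" "c' > 0" "\<alpha> i = c *\<^sub>R \<beta> + c' *\<^sub>R \<gamma>"
  shows "\<beta> = \<alpha> i"
proof (rule pos_root_eq_simple[OF i \<beta>(1)])
  fix k assume k: "k \<in> {1..d} - {i}"
  have "c * (\<beta> \<bullet> \<omega> k) + c' * (\<gamma> \<bullet> \<omega> k) = \<alpha> i \<bullet> \<omega> k"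
    unfolding c(3) by (simp add: inner_add_left)
  also have "\<dots> = 0" using weight_simple[of k i] k i by (auto simp: inner_commute)
  finally have "c * (\<beta> \<bullet> \<omega> k) + c' * (\<gamma> \<bullet> \<omega> k) = 0" .
  moreover have "\<beta> \<bullet> \<omega> k \<ge> 0" "\<gamma> \<bullet> \<omega> k \<ge> 0"
    using k by (auto intro: pos_root_weight \<beta>)
  ultimately show "\<beta> \<bullet> \<omega> k = 0"
    using c(1,2) by (simp add: add_nonneg_eq_0_iff)
qed

text \<open>Recognizes a candidate base. Decomposable positive roots are not simple, so all simple
  roots are candidates. A candidate that is not simple would have a dual vector orthogonal to every
  simple root, hence to its own root.\<close>

lemma simple_roots_eqI:
  assumes pos: "b ` J \<subseteq> pos_roots"
    and dual: "\<And>p. p \<in> J \<Longrightarrow> \<exists>\<tau>. \<tau> \<bullet> b p \<noteq> 0 \<and> (\<forall>q\<in>J - {p}. \<tau> \<bullet> b q = 0)"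
    and dec: "\<And>\<beta>. \<beta> \<in> pos_roots - b ` J \<Longrightarrow>
      \<exists>\<gamma>\<in>pos_roots. \<exists>\<gamma>'\<in>pos_roots. \<exists>c>0. \<exists>c'>0. \<beta> = c *\<^sub>R \<gamma> + c' *\<^sub>R \<gamma>' \<and> \<gamma> \<noteq> \<beta>"
  shows "b ` J = \<alpha> ` {1..d}" "inj_on b J"
proof -
  show "inj_on b J"
    using dual by (intro inj_onI) (metis DiffI singletonD)
  have sub: "\<alpha> i \<in> b ` J" if i: "i \<in> {1..d}" for i
  proof (rule ccontr)
    assume "\<alpha> i \<notin> b ` J"
    then have "\<alpha> i \<in> pos_roots - b ` J" using simple_pos[OF i] by blast
    from dec[OF this] show False using simple_indecomposable[OF i] by metis
  qed
  have "b p \<in> \<alpha> ` {1..d}" if p: "p \<in> J" for p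
  proof (rule ccontr)
    assume "b p \<notin> \<alpha> ` {1..d}"
    obtain \<tau> where \<tau>: "\<tau> \<bullet> b p \<noteq> 0" "\<And>q. q \<in> J - {p} \<Longrightarrow> \<tau> \<bullet> b q = 0"
      using dual[OF p] by blast
    have "orthogonal \<tau> y" if "y \<in> \<alpha> ` {1..d}" for y
      unfolding orthogonal_def using sub that \<open>b p \<notin> \<alpha> ` {1..d}\<close> \<tau>(2) by (metis DiffI imageE singletonD)
    moreover have "b p \<in> span (\<alpha> ` {1..d})"
      unfolding span_simple using pos pos_roots_subset p by (auto intro: span_base)
    ultimately have "orthogonal \<tau> (b p)"
      by (metis orthogonal_to_span)
    then show False using \<tau>(1) by (simp add: orthogonal_def)
  qed
  then show "b ` J = \<alpha> ` {1..d}" using sub by blast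
qed

text \<open>The tags keep apart orbits that contain equal vectors: in type \<open>D\<^sub>n\<close> the two ends of the fork
  have the same orbit.\<close>

lemma card_facets_eq_card:
  fixes J :: "'j set" and T :: "('v \<times> nat) set"
  assumes pos: "b ` J \<subseteq> pos_roots"
    and dual: "\<And>p. p \<in> J \<Longrightarrow> \<exists>\<tau>. \<tau> \<bullet> b p \<noteq> 0 \<and> (\<forall>q\<in>J - {p}. \<tau> \<bullet> b q = 0)"
    and dec: "\<And>\<beta>. \<beta> \<in> pos_roots - b ` J \<Longrightarrow>
      \<exists>\<gamma>\<in>pos_roots. \<exists>\<gamma>'\<in>pos_roots. \<exists>c>0. \<exists>c'>0. \<beta> = c *\<^sub>R \<gamma> + c' *\<^sub>R \<gamma>' \<and> \<gamma> \<noteq> \<beta>"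
    and dom: "\<And>p q. p \<in> J \<Longrightarrow> q \<in> J \<Longrightarrow> t p \<bullet> b q \<ge> 0"
    and nbr: "\<And>p q. p \<in> J \<Longrightarrow> q \<in> J \<Longrightarrow> t p \<bullet> b q = 0 \<longleftrightarrow> q = p \<or> b p \<bullet> b q = 0"
    and stable: "\<And>a y m. a \<in> \<Phi> \<Longrightarrow> (y, m) \<in> T \<Longrightarrow> (reflection a y, m) \<in> T"
    and mem: "\<And>p. p \<in> J \<Longrightarrow> (t p, c p) \<in> T"
    and inj: "inj_on (\<lambda>p. (t p, c p)) J"
    and cover: "\<And>y m. (y, m) \<in> T \<Longrightarrow> (\<And>q. q \<in> J \<Longrightarrow> y \<bullet> b q \<ge> 0) \<Longrightarrow> \<exists>p\<in>J. y = t p \<and> m = c p"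
  shows "card (cone_facets (SF \<Phi> d \<alpha>)) = card T"
proof -
  have b: "b ` J = \<alpha> ` {1..d}" "inj_on b J"
    by (rule simple_roots_eqI[OF pos]; (erule dual | erule dec))+
  have finJ: "finite J" using b by (metis finite_atLeastAtMost finite_imageD finite_imageI)
  \<comment> \<open>The numbering \<alpha> of the given base is arbitrary; \<open>ix\<close> matches
    it with the convenient index set \<open>J\<close>.\<close>
  define ix where "ix p = inv_into {1..d} \<alpha> (b p)" for p
  have ix: "ix p \<in> {1..d}" "\<alpha> (ix p) = b p" if "p \<in> J" for p
    using that b(1) unfolding ix_def by (metis imageI inv_into_into, metis imageI f_inv_into_f)
  have ix_bij: "bij_betw ix J {1..d}"
    unfolding bij_betw_def
  proof
    show "inj_on ix J" using ix(2) b(2) by (metis inj_on_def)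
    show "ix ` J = {1..d}"
    proof
      show "ix ` J \<subseteq> {1..d}" using ix(1) by blast
      show "{1..d} \<subseteq> ix ` J"
      proof
        fix i assume i: "i \<in> {1..d}"
        then obtain p where p: "p \<in> J" "b p = \<alpha> i" using b(1) by (metis imageE imageI)
        then have "ix p = i" using ix[OF p(1)] inj_onD[OF inj_\<alpha>] i by metis
        then show "i \<in> ix ` J" using p(1) by blast
      qed
    qed
  qed
  have dominant_iff: "dominant y \<longleftrightarrow> (\<forall>q\<in>J. y \<bullet> b q \<ge> 0)" for y
  proof -
    have "dominant y \<longleftrightarrow> (\<forall>\<beta>\<in>\<alpha> ` {1..d}. y \<bullet> \<beta> \<ge> 0)" by (simp add: dominant_def)
    also have "\<dots> \<longleftrightarrow> (\<forall>\<beta>\<in>b ` J. y \<bullet> \<beta> \<ge> 0)" by (simp only: b(1))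
    finally show ?thesis by simp
  qed
  have t_dom: "dominant (t p)" if "p \<in> J" for p using dom that by (simp add: dominant_iff)
  have stableW: "(w y, m) \<in> T" if "w \<in> W" "(y, m) \<in> T" for w y m
    using that refl_grp_stable[of w \<Phi> "{y. (y, m) \<in> T}" y] stable by auto
  \<comment> \<open>Condition \<open>nbr\<close> is designed for this: the stabilizer of
    \<open>t p\<close> is the parabolic subgroup in the summand of index
    \<open>ix p\<close>.\<close>
  have stab: "{k\<in>{1..d}. t p \<bullet> \<alpha> k = 0} = {1..d} - N (ix p)" if p: "p \<in> J" for p
  proof -
    have "t p \<bullet> \<alpha> k = 0 \<longleftrightarrow> k \<notin> N (ix p)" if k: "k \<in> {1..d}" for k
    proof -
      obtain q where q: "q \<in> J" "k = ix q" using k ix_bij unfolding bij_betw_def by blast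
      have "t p \<bullet> \<alpha> k = 0 \<longleftrightarrow> q = p \<or> b p \<bullet> b q = 0" using nbr[OF p q(1)] ix(2)[OF q(1)] q(2) by simp
      moreover have "k = ix p \<longleftrightarrow> q = p" using ix_bij p q unfolding bij_betw_def inj_on_def by blast
      ultimately show ?thesis
        using N_iff[OF ix(1)[OF p], of k] k ix(2)[OF p] ix(2)[OF q(1)] q(2) by auto
    qed
    then show ?thesis by blast
  qed
  have card_orb: "real (card ((\<lambda>w. w (t p)) ` W))
      = real (card W) / real (card (refl_grp (\<alpha> ` ({1..d} - N (ix p)))))" if p: "p \<in> J" for p
  proof -
    let ?H = "refl_grp (\<alpha> ` ({1..d} - N (ix p)))"
    have sub: "?H \<subseteq> W" using simple_is_root by (intro refl_grp_mono) auto
    then have "card ?H > 0" using finite_W by (intro card_refl_grp_pos) (rule finite_subset)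
    moreover have "card W = card ((\<lambda>w. w (t p)) ` W) * card ?H"
    proof (rule card_image_cosets[OF finite_W sub])
      fix u w assume uw: "u \<in> W" "w \<in> W"
      have v: "inv_into UNIV u \<circ> w \<in> W" using uw by (intro refl_grp_comp refl_grp_inv)
      have "u (t p) = w (t p) \<longleftrightarrow> (inv_into UNIV u \<circ> w) (t p) = t p"
        using W_inv_cancel[OF uw(1)] by (metis comp_apply)
      also have "\<dots> \<longleftrightarrow> inv_into UNIV u \<circ> w \<in> ?H"
      proof
        assume "(inv_into UNIV u \<circ> w) (t p) = t p"
        then show "inv_into UNIV u \<circ> w \<in> ?H"
          using W_dominant(1)[OF v t_dom[OF p]] t_dom[OF p] stab[OF p] by metis
      next
        assume "inv_into UNIV u \<circ> w \<in> ?H"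
        then show "(inv_into UNIV u \<circ> w) (t p) = t p"
          by (rule refl_grp_fixes) (use stab[OF p] in blast)
      qed
      finally show "u (t p) = w (t p) \<longleftrightarrow> inv_into UNIV u \<circ> w \<in> ?H" .
    qed
    ultimately show ?thesis by simp
  qed
  have T_eq: "T = (\<Union>p\<in>J. (\<lambda>w. w (t p)) ` W \<times> {c p})"
  proof
    show "(\<Union>p\<in>J. (\<lambda>w. w (t p)) ` W \<times> {c p}) \<subseteq> T" using mem stableW by auto
    show "T \<subseteq> (\<Union>p\<in>J. (\<lambda>w. w (t p)) ` W \<times> {c p})"
    proof
      fix z assume "z \<in> T"
      obtain y m where z: "z = (y, m)" by (cases z)
      obtain w where w: "w \<in> W" "dominant (inv_into UNIV w y)" using ex_dominant by blast
      have "(inv_into UNIV w y, m) \<in> T" using stableW[OF refl_grp_inv[OF w(1)]] \<open>z \<in> T\<close> z by blast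
      then obtain p where p: "p \<in> J" "inv_into UNIV w y = t p" "m = c p"
        using cover w(2) dominant_iff by metis
      then have "y = w (t p)" using W_inv_cancel(2)[OF w(1)] by metis
      then show "z \<in> (\<Union>p\<in>J. (\<lambda>w. w (t p)) ` W \<times> {c p})" using p w(1) z by blast
    qed
  qed
  have "card T = (\<Sum>p\<in>J. card ((\<lambda>w. w (t p)) ` W \<times> {c p}))"
    unfolding T_eq
  proof (rule card_UN_disjoint[OF finJ])
    show "\<forall>p\<in>J. \<forall>q\<in>J. p \<noteq> q \<longrightarrow> ((\<lambda>w. w (t p)) ` W \<times> {c p}) \<inter> ((\<lambda>w. w (t q)) ` W \<times> {c q}) = {}"
    proof (intro ballI impI, rule ccontr)
      fix p q assume pq: "p \<in> J" "q \<in> J" "p \<noteq> q"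
        "((\<lambda>w. w (t p)) ` W \<times> {c p}) \<inter> ((\<lambda>w. w (t q)) ` W \<times> {c q}) \<noteq> {}"
      then obtain u w where uw: "u \<in> W" "w \<in> W" "u (t p) = w (t q)" "c p = c q" by auto
      have "(inv_into UNIV w \<circ> u) (t p) = t q" using uw(3) W_inv_cancel(1)[OF uw(2)] by simp
      then have "t p = t q"
        using W_dominant(2)[OF refl_grp_comp[OF refl_grp_inv[OF uw(2)] uw(1)] t_dom[OF pq(1)]]
          t_dom[OF pq(2)] by metis
      then show False using inj_onD[OF inj, of p q] uw(4) pq by simp
    qed
  qed (use finite_W in auto)
  then have "real (card T) = (\<Sum>p\<in>J. real (card ((\<lambda>w. w (t p)) ` W)))"
    by (simp add: card_cartesian_product)
  also have "\<dots> = (\<Sum>p\<in>J. real (card W) / real (card (refl_grp (\<alpha> ` ({1..d} - N (ix p))))))"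
    by (intro sum.cong refl card_orb)
  also have "\<dots> = (\<Sum>i\<in>{1..d}. real (card W) / real (card (refl_grp (\<alpha> ` ({1..d} - N i)))))"
    by (rule sum.reindex_bij_betw[OF ix_bij])
  finally show ?thesis using card_facets by linarith
qed

end

section \<open>Vectors with prescribed numbers of coordinates\<close>

text \<open>One format for two purposes: it describes the roots of types B, C and D as well as the
  unions of orbits to be counted. For symmetric value sets it is closed under signed permutations of
  the coordinates.\<close>

definition vectors :: "real set \<Rightarrow> real set \<Rightarrow> nat \<Rightarrow> (real ^ 'n) set"
  where "vectors Q Q' m = {y. (\<forall>i. y $ i \<in> Q \<union> Q') \<and> card {i. y $ i \<in> Q} = m}"

lemma card_vectors_box: "card {y :: real ^ 'n. \<forall>i. y $ i \<in> B i} = (\<Prod>i\<in>UNIV. card (B i))"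
proof -
  have "bij_betw vec_lambda (Pi\<^sub>E UNIV B) {y :: real ^ 'n. \<forall>i. y $ i \<in> B i}"
    by (rule bij_betwI[where g = vec_nth]) (auto simp: PiE_iff)
  then show ?thesis by (simp add: card_PiE bij_betw_same_card[symmetric])
qed

text \<open>Choose the positions of the entries from \<open>Q\<close>, then the entries;
  disjointness makes the positions recoverable from the vector.\<close>

lemma card_vectors:
  assumes fin: "finite Q" "finite Q'" and disj: "Q \<inter> Q' = {}"
  shows "card (vectors Q Q' m :: (real ^ 'n) set)
    = (CARD('n) choose m) * card Q ^ m * card Q' ^ (CARD('n) - m)"
    and "finite (vectors Q Q' m :: (real ^ 'n) set)"
proof -
  define B where "B P i = (if i \<in> P then Q else Q')" for P and i :: 'n
  define X where "X P = {y :: real ^ 'n. \<forall>i. y $ i \<in> B P i}" for P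
  have eq: "vectors Q Q' m = (\<Union>P\<in>{P. P \<subseteq> UNIV \<and> card P = m}. X P)"
  proof
    show "vectors Q Q' m \<subseteq> (\<Union>P\<in>{P. P \<subseteq> UNIV \<and> card P = m}. X P)"
    proof
      fix y :: "real ^ 'n" assume "y \<in> vectors Q Q' m"
      then have "y \<in> X {i. y $ i \<in> Q}" "card {i. y $ i \<in> Q} = m"
        by (auto simp: vectors_def X_def B_def)
      then show "y \<in> (\<Union>P\<in>{P. P \<subseteq> UNIV \<and> card P = m}. X P)" by blast
    qed
    show "(\<Union>P\<in>{P. P \<subseteq> UNIV \<and> card P = m}. X P) \<subseteq> vectors Q Q' m"
    proof clarify
      fix y P assume y: "y \<in> X P" "m = card P"
      then have *: "y $ i \<in> (if i \<in> P then Q else Q')" for i by (auto simp: X_def B_def)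
      have "y $ i \<in> Q \<longleftrightarrow> i \<in> P" for i
        using *[of i] disj by (cases "i \<in> P") auto
      moreover have "y $ i \<in> Q \<union> Q'" for i using *[of i] by (cases "i \<in> P") auto
      ultimately show "y \<in> vectors Q Q' (card P)" by (simp add: vectors_def)
    qed
  qed
  have finX: "finite (X P)" for P
  proof -
    have "X P = vec_lambda ` (Pi\<^sub>E UNIV (B P))"
    proof
      show "X P \<subseteq> vec_lambda ` (Pi\<^sub>E UNIV (B P))"
        by (auto simp: X_def PiE_iff intro!: image_eqI[of _ _ "vec_nth _"])
    qed (auto simp: X_def PiE_iff)
    then show ?thesis using fin by (simp add: finite_PiE B_def)
  qed
  show "finite (vectors Q Q' m :: (real ^ 'n) set)" unfolding eq using finX by auto
  have cardX: "card (X P) = card Q ^ m * card Q' ^ (CARD('n) - m)" if "card P = m" for P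
  proof -
    have "card (X P) = (\<Prod>i\<in>UNIV. if i \<in> P then card Q else card Q')"
      unfolding X_def card_vectors_box by (intro prod.cong) (auto simp: B_def)
    also have "\<dots> = card Q ^ card P * card Q' ^ card (- P)"
      by (subst prod.If_cases) simp_all
    finally show ?thesis by (simp add: that Compl_eq_Diff_UNIV card_Diff_subset)
  qed
  have "card (vectors Q Q' m :: (real ^ 'n) set) = (\<Sum>P\<in>{P. P \<subseteq> (UNIV :: 'n set) \<and> card P = m}. card (X P))"
    unfolding eq
  proof (rule card_UN_disjoint)
    show "\<forall>P\<in>{P. P \<subseteq> UNIV \<and> card P = m}. \<forall>P'\<in>{P. P \<subseteq> UNIV \<and> card P = m}.
        P \<noteq> P' \<longrightarrow> X P \<inter> X P' = {}"
    proof (intro ballI impI, rule ccontr)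
      fix P P' :: "'n set" assume P: "P \<noteq> P'" "X P \<inter> X P' \<noteq> {}"
      then obtain y where y: "y \<in> X P" "y \<in> X P'" by blast
      have "i \<in> P \<longleftrightarrow> i \<in> P'" for i
      proof -
        have "y $ i \<in> B P i" "y $ i \<in> B P' i" using y by (auto simp: X_def)
        then show ?thesis using disj by (auto simp: B_def split: if_splits)
      qed
      then show False using P(1) by blast
    qed
  qed (use finX in auto)
  also have "\<dots> = (\<Sum>P\<in>{P. P \<subseteq> (UNIV :: 'n set) \<and> card P = m}. card Q ^ m * card Q' ^ (CARD('n) - m))"
    by (intro sum.cong) (auto simp: cardX)
  also have "\<dots> = (CARD('n) choose m) * card Q ^ m * card Q' ^ (CARD('n) - m)"
    using n_subsets[of "UNIV :: 'n set" m] by simp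
  finally show "card (vectors Q Q' m :: (real ^ 'n) set)
    = (CARD('n) choose m) * card Q ^ m * card Q' ^ (CARD('n) - m)" .
qed

text \<open>The hypotheses compare only membership in the value sets, so sign changes are covered
  along with permutations.\<close>

lemma vectors_permute:
  fixes y y' :: "real ^ 'n"
  assumes y: "y \<in> vectors Q Q' m" and \<pi>: "bij \<pi>"
    and Q: "\<And>i. y' $ i \<in> Q \<longleftrightarrow> y $ \<pi> i \<in> Q" "\<And>i. y' $ i \<in> Q' \<longleftrightarrow> y $ \<pi> i \<in> Q'"
  shows "y' \<in> vectors Q Q' m"
proof -
  have "card {i. y' $ i \<in> Q} = card {i. y $ i \<in> Q}"
  proof (rule bij_betw_same_card[of \<pi>])
    have "\<pi> ` {i. y $ \<pi> i \<in> Q} = {i. y $ i \<in> Q}"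
      using bij_is_surj[OF \<pi>] by auto
    then show "bij_betw \<pi> {i. y' $ i \<in> Q} {i. y $ i \<in> Q}"
      using \<pi> Q(1) by (auto simp: bij_betw_def inj_on_def bij_def)
  qed
  then show ?thesis using y Q by (simp add: vectors_def)
qed

definition symmetric_set :: "real set \<Rightarrow> bool" where "symmetric_set Q \<longleftrightarrow> (\<forall>x. - x \<in> Q \<longleftrightarrow> x \<in> Q)"

lemma inner_axis_pair: "y \<bullet> (s *\<^sub>R std_basis i + t *\<^sub>R std_basis j) = s * y $ i + t * y $ j"
  by (simp add: inner_add_right inner_axis)

lemma inner_pair_self:
  fixes i j :: "'n::finite"
  assumes "i \<noteq> j" "s \<in> {1, -1}" "t \<in> {1, -1}"
  shows "(s *\<^sub>R std_basis i + t *\<^sub>R std_basis j) \<bullet> (s *\<^sub>R std_basis i + t *\<^sub>R std_basis j) = 2"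
  unfolding inner_axis_pair using assms by (auto simp: axis_def)

lemma reflection_pair:
  fixes y :: "real ^ 'n"
  assumes "i \<noteq> j" "s \<in> {1, -1}" "t \<in> {1, -1}"
  shows "reflection (s *\<^sub>R std_basis i + t *\<^sub>R std_basis j) y $ k
    = (if k = i \<or> k = j then - s * t else 1) * y $ (Transposition.transpose i j k)"
proof -
  let ?a = "s *\<^sub>R std_basis i + t *\<^sub>R std_basis j :: real ^ 'n"
  have st: "s * s = 1" "t * t = 1" using assms by auto
  have "?a \<bullet> ?a = 2"
    using assms by (rule inner_pair_self)
  then have "reflection ?a y $ k = y $ k - (s * y $ i + t * y $ j) * ?a $ k"
    by (simp add: reflection_def inner_axis_pair)
  also have "\<dots> = (if k = i \<or> k = j then - s * t else 1) * y $ (Transposition.transpose i j k)"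
  proof -
    consider "k = i" | "k = j" "k \<noteq> i" | "k \<noteq> i" "k \<noteq> j" by blast
    then show ?thesis
    proof cases
      case 1
      have "y $ i - (s * y $ i + t * y $ j) * s = y $ i - (s * s) * y $ i - s * t * y $ j"
        by (simp add: algebra_simps)
      then show ?thesis using 1 assms(1) st by (simp add: axis_def)
    next
      case 2
      have "y $ j - (s * y $ i + t * y $ j) * t = y $ j - (t * t) * y $ j - s * t * y $ i"
        by (simp add: algebra_simps)
      then show ?thesis using 2 assms(1) st by (simp add: axis_def)
    next
      case 3
      then show ?thesis by (simp add: axis_def transpose_apply_other)
    qed
  qed
  finally show ?thesis .
qed

lemma reflection_axis:
  fixes y :: "real ^ 'n"
  assumes "c \<noteq> 0"
  shows "reflection (c *\<^sub>R std_basis i) y $ k = (if k = i then - y $ k else y $ k)"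
proof -
  let ?a = "c *\<^sub>R std_basis i :: real ^ 'n"
  have "y \<bullet> ?a = c * y $ i" "?a \<bullet> ?a = c * c" by (simp_all add: inner_axis)
  then have "reflection ?a y = y - (2 * (c * y $ i) / (c * c)) *\<^sub>R ?a"
    by (simp only: reflection_def)
  then have "reflection ?a y $ k = y $ k - 2 * (c * y $ i) / (c * c) * ?a $ k"
    by (simp only: vector_minus_component vector_scaleR_component real_scaleR_def)
  also have "?a $ k = (if k = i then c else 0)" by (simp add: axis_def)
  finally show ?thesis using assms by simp
qed

lemma vectors_reflection_D:
  fixes y :: "real ^ 'n"
  assumes "symmetric_set Q" "symmetric_set Q'" "a \<in> roots_D" "y \<in> vectors Q Q' m"
  shows "reflection a y \<in> vectors Q Q' m"
proof -
  obtain s t i j where a: "a = s *\<^sub>R std_basis i + t *\<^sub>R std_basis j" "s \<in> {1, -1}" "t \<in> {1, -1}" "i \<noteq> j"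
    using assms(3) unfolding roots_D_def by blast
  have "reflection a y $ k = y $ Transposition.transpose i j k \<or>
      reflection a y $ k = - y $ Transposition.transpose i j k" for k
    unfolding a(1) reflection_pair[OF a(4,2,3)] using a(2,3) by auto
  then show ?thesis
    using assms(1,2) unfolding symmetric_set_def
    by (intro vectors_permute[OF assms(4), of "Transposition.transpose i j"]) (simp, metis+)
qed

lemma vectors_reflection_axis:
  fixes y :: "real ^ 'n"
  assumes "symmetric_set Q" "symmetric_set Q'" "c \<noteq> 0" "y \<in> vectors Q Q' m"
  shows "reflection (c *\<^sub>R std_basis i) y \<in> vectors Q Q' m"
  using assms unfolding symmetric_set_def
  by (intro vectors_permute[OF assms(4), of id]) (auto simp: reflection_axis)

lemma roots_A_subset_D: "roots_A \<subseteq> roots_D"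
proof
  fix a :: "real ^ 'n" assume "a \<in> roots_A"
  then obtain s i j where a: "a = s *\<^sub>R (std_basis i - std_basis j)" "s \<in> {1, -1}" "i \<noteq> j"
    unfolding roots_A_def by blast
  then have "a = s *\<^sub>R std_basis i + (- s) *\<^sub>R std_basis j" by (simp add: scaleR_diff_right)
  moreover have "- s \<in> {1, -1}" using a(2) by auto
  ultimately show "a \<in> roots_D" using a(2,3) unfolding roots_D_def by blast
qed

lemma reflection_A:
  fixes y :: "real ^ 'n"
  assumes "a \<in> roots_A"
  obtains i j where "\<And>k. reflection a y $ k = y $ Transposition.transpose i j k"
proof -
  obtain s i j where a: "a = s *\<^sub>R (std_basis i - std_basis j)" "s \<in> {1, -1}" "i \<noteq> j"
    using assms unfolding roots_A_def by blast
  then have eq: "a = s *\<^sub>R std_basis i + (- s) *\<^sub>R std_basis j" by (simp add: scaleR_diff_right)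
  have s: "- s \<in> {1, -1}" "- s * - s = 1" using a(2) by auto
  have "reflection a y $ k = y $ Transposition.transpose i j k" for k
    unfolding eq reflection_pair[OF a(3,2) s(1)] using s(2) by auto
  then show ?thesis using that by blast
qed

lemma vectors_reflection_A:
  fixes y :: "real ^ 'n"
  assumes "a \<in> roots_A" "y \<in> vectors Q Q' m"
  shows "reflection a y \<in> vectors Q Q' m"
proof -
  obtain i j where "\<And>k. reflection a y $ k = y $ Transposition.transpose i j k"
    using reflection_A[OF assms(1)] by blast
  then show ?thesis by (intro vectors_permute[OF assms(2), of "Transposition.transpose i j"]) simp_all
qed

subsection \<open>The classical root systems\<close>

lemma roots_D_eq: "(roots_D :: (real ^ 'n) set) = vectors {1, -1} {0} 2"
proof
  show "(roots_D :: (real ^ 'n) set) \<subseteq> vectors {1, -1} {0} 2"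
  proof
    fix a :: "real ^ 'n" assume "a \<in> roots_D"
    then obtain s t i j where a: "a = s *\<^sub>R std_basis i + t *\<^sub>R std_basis j" "s \<in> {1, -1}" "t \<in> {1, -1}" "i \<noteq> j"
      unfolding roots_D_def by blast
    have nth: "a $ k = (if k = i then s else if k = j then t else 0)" for k
      using a(4) by (simp add: a(1) axis_def)
    have "{k. a $ k \<in> {1, -1}} = {i, j}" using a(2-4) by (auto simp: nth)
    then show "a \<in> vectors {1, -1} {0} 2"
      using a(2-4) by (auto simp: vectors_def nth)
  qed
  show "vectors {1, -1} {0} 2 \<subseteq> (roots_D :: (real ^ 'n) set)"
  proof
    fix a :: "real ^ 'n" assume a: "a \<in> vectors {1, -1} {0} 2"
    then obtain i j where ij: "{k. a $ k \<in> {1, -1}} = {i, j}" "i \<noteq> j"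
      unfolding vectors_def card_2_iff by blast
    have "a $ k = 0" if "k \<notin> {i, j}" for k
      using a that ij(1) by (auto simp: vectors_def)
    then have "a = (a $ i) *\<^sub>R std_basis i + (a $ j) *\<^sub>R std_basis j"
      using ij(2) by (auto simp: vec_eq_iff axis_def)
    moreover have "a $ i \<in> {1, -1}" "a $ j \<in> {1, -1}" using ij(1) by blast+
    ultimately show "a \<in> roots_D" using ij(2) unfolding roots_D_def by blast
  qed
qed

lemma axis_roots_eq:
  assumes "c \<noteq> 0"
  shows "{(c * s) *\<^sub>R std_basis i | s i. s \<in> {1, -1}} = (vectors {c, -c} {0} 1 :: (real ^ 'n) set)"
proof
  show "{(c * s) *\<^sub>R std_basis i | s i. s \<in> {1, -1}} \<subseteq> (vectors {c, -c} {0} 1 :: (real ^ 'n) set)"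
  proof
    fix a :: "real ^ 'n" assume "a \<in> {(c * s) *\<^sub>R std_basis i | s i. s \<in> {1, -1}}"
    then obtain s i where a: "a = (c * s) *\<^sub>R std_basis i" "s \<in> {1, -1}" by blast
    have nth: "a $ k = (if k = i then c * s else 0)" for k by (simp add: a(1) axis_def)
    have "{k. a $ k \<in> {c, -c}} = {i}" using a(2) assms by (auto simp: nth)
    then show "a \<in> vectors {c, -c} {0} 1" using a(2) by (auto simp: vectors_def nth)
  qed
  show "(vectors {c, -c} {0} 1 :: (real ^ 'n) set) \<subseteq> {(c * s) *\<^sub>R std_basis i | s i. s \<in> {1, -1}}"
  proof
    fix a :: "real ^ 'n" assume a: "a \<in> vectors {c, -c} {0} 1"
    then obtain i where i: "{k. a $ k \<in> {c, -c}} = {i}"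
      unfolding vectors_def using card_1_singletonE by blast
    have "a $ k = 0" if "k \<noteq> i" for k using a that i by (auto simp: vectors_def)
    then have "a = (a $ i) *\<^sub>R std_basis i" by (auto simp: vec_eq_iff axis_def)
    moreover have "a $ i \<in> {c, -c}" using i by blast
    then have "a $ i = c * (a $ i / c) \<and> a $ i / c \<in> {1, -1}" using assms by auto
    then obtain s where "a $ i = c * s" "s \<in> {1, -1}" by blast
    ultimately have "a = (c * s) *\<^sub>R std_basis i" "s \<in> {1, -1}" by metis+
    then show "a \<in> {(c * s) *\<^sub>R std_basis i | s i. s \<in> {1, -1}}" by blast
  qed
qed

lemma symmetric_sets: "symmetric_set {0}" "symmetric_set {c, -c}" "symmetric_set {0, c, -c}"
  by (auto simp: symmetric_set_def)

lemma vectors_minus: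
  fixes y :: "real ^ 'n"
  assumes "symmetric_set Q" "symmetric_set Q'" "y \<in> vectors Q Q' m"
  shows "- y \<in> vectors Q Q' m"
  using assms unfolding symmetric_set_def by (intro vectors_permute[OF assms(3), of id]) auto

text \<open>Reflections in these roots permute coordinates and preserve their sum, so closure can be
  inherited from type D.\<close>

lemma roots_A_eq: "(roots_A :: (real ^ 'n) set) = {a \<in> roots_D. (\<Sum>i\<in>UNIV. a $ i) = 0}"
proof
  show "(roots_A :: (real ^ 'n) set) \<subseteq> {a \<in> roots_D. (\<Sum>i\<in>UNIV. a $ i) = 0}"
  proof
    fix a :: "real ^ 'n" assume a: "a \<in> roots_A"
    then obtain s i j where "a = s *\<^sub>R (std_basis i - std_basis j)" unfolding roots_A_def by blast
    then have "(\<Sum>i\<in>UNIV. a $ i) = 0"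
      by (simp add: axis_def sum_subtractf flip: sum_distrib_left)
    then show "a \<in> {a \<in> roots_D. (\<Sum>i\<in>UNIV. a $ i) = 0}" using a roots_A_subset_D by blast
  qed
  show "{a \<in> roots_D. (\<Sum>i\<in>UNIV. a $ i) = 0} \<subseteq> (roots_A :: (real ^ 'n) set)"
  proof
    fix a :: "real ^ 'n" assume a: "a \<in> {a \<in> roots_D. (\<Sum>i\<in>UNIV. a $ i) = 0}"
    then obtain s t i j where st: "a = s *\<^sub>R std_basis i + t *\<^sub>R std_basis j" "s \<in> {1, -1}" "i \<noteq> j"
      unfolding roots_D_def by blast
    have "(\<Sum>i\<in>UNIV. a $ i) = s + t"
      by (simp add: st(1) axis_def sum.distrib flip: sum_distrib_left)
    then have "t = - s" using a by simp
    then have "a = s *\<^sub>R (std_basis i - std_basis j)" using st(1) by (simp add: scaleR_diff_right)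
    then show "a \<in> roots_A" using st(2,3) unfolding roots_A_def by blast
  qed
qed

section \<open>The root system axioms for the classical types\<close>

lemma vectors_zero_notin: "m > 0 \<Longrightarrow> 0 \<notin> Q \<Longrightarrow> 0 \<notin> vectors Q Q' m"
  by (auto simp: vectors_def)

lemma root_systemI:
  assumes "finite \<Phi>" "0 \<notin> \<Phi>"
    and "\<And>a. a \<in> \<Phi> \<Longrightarrow> - a \<in> \<Phi>" "\<And>a b. a \<in> \<Phi> \<Longrightarrow> b \<in> \<Phi> \<Longrightarrow> reflection a b \<in> \<Phi>"
    and "\<And>a c. a \<in> \<Phi> \<Longrightarrow> c *\<^sub>R a \<in> \<Phi> \<Longrightarrow> c = 1 \<or> c = -1"
  shows "root_system \<Phi>"
proof -
  have "\<Phi> \<inter> range (\<lambda>c. c *\<^sub>R a) = {a, - a}" if "a \<in> \<Phi>" for a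
  proof
    show "\<Phi> \<inter> range (\<lambda>c. c *\<^sub>R a) \<subseteq> {a, - a}"
      using assms(5)[OF that] by clarify fastforce
    have "a = 1 *\<^sub>R a" "- a = (- 1) *\<^sub>R a" by simp_all
    then show "{a, - a} \<subseteq> \<Phi> \<inter> range (\<lambda>c. c *\<^sub>R a)"
      using assms(3)[OF that] that by blast
  qed
  then show ?thesis using assms unfolding root_system_def by blast
qed

lemma vectors_nonzero_coordinate:
  assumes "y \<in> vectors Q Q' m" "m > 0"
  obtains i where "y $ i \<in> Q"
  using assms by (fastforce simp: vectors_def card_gt_0_iff)

lemma root_system_D: "root_system (roots_D :: (real ^ 'n) set)"
proof (rule root_systemI)
  let ?D = "roots_D :: (real ^ 'n) set"
  show "finite ?D" "0 \<notin> ?D"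
    unfolding roots_D_eq by (auto simp: card_vectors(2) vectors_zero_notin)
  show "- a \<in> ?D" if "a \<in> ?D" for a
    using that vectors_minus symmetric_sets unfolding roots_D_eq by blast
  show "reflection a b \<in> ?D" if "a \<in> ?D" "b \<in> ?D" for a b
    using that vectors_reflection_D symmetric_sets roots_D_eq by metis
  fix a c assume a: "a \<in> ?D" "c *\<^sub>R a \<in> ?D"
  then obtain i where "a $ i \<in> {1, -1}"
    using vectors_nonzero_coordinate[of a "{1, -1}" "{0}" 2] unfolding roots_D_eq by auto
  moreover have "(c *\<^sub>R a) $ i \<in> {1, -1, 0}" using a(2) unfolding roots_D_eq vectors_def by blast
  moreover have "c \<noteq> 0" using a(2) vectors_zero_notin[of 2 "{1, -1}" "{0}"] unfolding roots_D_eq by auto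
  ultimately show "c = 1 \<or> c = -1" by auto
qed

lemma root_system_A: "root_system (roots_A :: (real ^ 'n) set)"
proof (rule root_systemI)
  let ?A = "roots_A :: (real ^ 'n) set"
  note D = root_system_D[where 'n = 'n, unfolded root_system_def]
  show "finite ?A" "0 \<notin> ?A" using D roots_A_subset_D by (auto intro: finite_subset)
  show "- a \<in> ?A" if "a \<in> ?A" for a
    using that vectors_minus[of "{1, -1}" "{0}" a 2] symmetric_sets
    by (auto simp: roots_A_eq roots_D_eq sum_negf)
  show "reflection a b \<in> ?A" if ab: "a \<in> ?A" "b \<in> ?A" for a b
  proof -
    obtain i j where r: "\<And>k. reflection a b $ k = b $ Transposition.transpose i j k"
      using reflection_A[OF ab(1)] by blast
    have "(\<Sum>k\<in>UNIV. reflection a b $ k) = (\<Sum>k\<in>UNIV. b $ k)"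
      unfolding r by (rule sum.reindex_bij_betw) simp
    moreover have "reflection a b \<in> roots_D"
      using ab vectors_reflection_A[of a b "{1, -1}" "{0}" 2] roots_A_subset_D by (auto simp: roots_D_eq)
    ultimately show ?thesis using ab(2) by (simp add: roots_A_eq)
  qed
  fix a c assume a: "a \<in> ?A" "c *\<^sub>R a \<in> ?A"
  then have "a \<in> roots_D" "c *\<^sub>R a \<in> roots_D" using roots_A_subset_D by blast+
  then have "c *\<^sub>R a = a \<or> c *\<^sub>R a = - a" using D by blast
  moreover have "a \<noteq> 0" using \<open>a \<in> roots_D\<close> D by blast
  moreover have "- a = (- 1) *\<^sub>R a" by simp
  ultimately show "c = 1 \<or> c = -1" by (metis scaleR_cancel_right scaleR_one)
qed

lemma root_system_BC:
  assumes c: "c = 1 \<or> c = 2"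
  shows "root_system (vectors {1, -1} {0} 2 \<union> vectors {c, -c} {0} 1 :: (real ^ 'n) set)"
proof (rule root_systemI)
  let ?V = "vectors {1, -1} {0} 2 \<union> vectors {c, -c} {0} 1 :: (real ^ 'n) set"
  have c0: "c \<noteq> 0" using c by auto
  show "finite ?V" using c by (auto intro!: card_vectors(2))
  show "0 \<notin> ?V" using c by (auto dest: vectors_zero_notin[THEN notE, rotated 2])
  show "- a \<in> ?V" if "a \<in> ?V" for a
    using that vectors_minus symmetric_sets by blast
  show "reflection a b \<in> ?V" if ab: "a \<in> ?V" "b \<in> ?V" for a b
  proof (cases "a \<in> vectors {1, -1} {0} 2")
    case True
    then show ?thesis using ab(2) vectors_reflection_D symmetric_sets roots_D_eq by (metis UnCI UnE)
  next
    case False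
    then have "a \<in> vectors {c, -c} {0} 1" using ab by blast
    then obtain s i where "a = (c * s) *\<^sub>R std_basis i" "s \<in> {1, -1}"
      unfolding axis_roots_eq[OF c0, symmetric] by blast
    moreover have "c * s \<noteq> 0" using c calculation(2) by auto
    ultimately show ?thesis using ab(2) vectors_reflection_axis symmetric_sets by (metis UnCI UnE)
  qed
  fix a x assume a: "a \<in> ?V" "x *\<^sub>R a \<in> ?V"
  \<comment> \<open>Two constraints on a scaling factor \<open>x\<close> between roots: norms allow
    only 1, 2 and 1/2 for its square, a nonzero coordinate only 1, 4 and 1/4. The common value is
    1.\<close>
  have norm: "b \<bullet> b = 2 \<or> b \<bullet> b = c * c" if "b \<in> ?V" for b
    using that
  proof
    assume "b \<in> vectors {1, -1} {0} 2"
    then obtain s t i j where "b = s *\<^sub>R std_basis i + t *\<^sub>R std_basis j" "s \<in> {1, -1}" "t \<in> {1, -1}" "i \<noteq> j"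
      unfolding roots_D_eq[symmetric] roots_D_def by blast
    then show ?thesis using inner_pair_self by blast
  next
    assume "b \<in> vectors {c, -c} {0} 1"
    then obtain s i where "b = (c * s) *\<^sub>R std_basis i" "s \<in> {1, -1}"
      unfolding axis_roots_eq[OF c0, symmetric] by blast
    then show ?thesis by (auto simp: inner_axis)
  qed
  have x0: "x \<noteq> 0" using a(2) \<open>0 \<notin> ?V\<close> by auto
  obtain i where i: "a $ i \<in> {1, -1, c, -c}"
    using a(1) vectors_nonzero_coordinate[of a "{1, -1}" "{0}" 2]
      vectors_nonzero_coordinate[of a "{c, -c}" "{0}" 1] by auto
  have "(x *\<^sub>R a) $ i \<in> {1, -1, c, -c, 0}" using a(2) unfolding vectors_def by blast
  then have "x * a $ i \<in> {1, -1, c, -c}" using x0 i c by auto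
  moreover have "z * z \<in> {1, 4}" if "z \<in> {1, -1, c, -c}" for z using that c by auto
  ultimately have "(x * a $ i) * (x * a $ i) \<in> {1, 4}" "a $ i * a $ i \<in> {1, 4}" using i by blast+
  moreover have "x * x * (a $ i * a $ i) = (x * a $ i) * (x * a $ i)" by simp
  moreover have "P \<in> {1, 4, 1/4}" if "P * A = Q" "Q \<in> {1, 4}" "A \<in> {1, 4}" for P A Q :: real
    using that by auto
  ultimately have "x * x \<in> {1, 4, 1/4}" by metis
  moreover have "x * x * (a \<bullet> a) = (x *\<^sub>R a) \<bullet> (x *\<^sub>R a)" by simp
  then have "x * x \<in> {1, 2, 1/2}" using norm[OF a(1)] norm[OF a(2)] c by auto
  ultimately have "x * x = 1" by auto
  then show "x = 1 \<or> x = -1" by (simp add: square_eq_1_iff)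
qed

subsection \<open>Sorted signed bases\<close>

text \<open>Applied to the coordinates of \<open>base_point\<close>, or to their absolute values,
  this renames the coordinates so that the given chamber takes its standard form.\<close>

lemma ex_decreasing_enumeration:
  fixes \<kappa> :: "'n::finite \<Rightarrow> real"
  assumes "inj \<kappa>"
  shows "\<exists>e. bij_betw e {..<CARD('n)} UNIV \<and> (\<forall>i j. i < j \<longrightarrow> j < CARD('n) \<longrightarrow> \<kappa> (e j) < \<kappa> (e i))"
proof -
  define xs where "xs = rev (sorted_list_of_set (range \<kappa>))"
  define e where "e k = inv_into UNIV \<kappa> (xs ! k)" for k
  have set: "set xs = range \<kappa>" and dist: "distinct xs" by (simp_all add: xs_def)
  have len: "length xs = CARD('n)"
    using distinct_card[OF dist] card_image[OF assms] by (simp add: set)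
  have \<kappa>e: "\<kappa> (e k) = xs ! k" if "k < CARD('n)" for k
    using that set len by (metis e_def f_inv_into_f nth_mem)
  have "sorted_wrt (\<lambda>x y. y < x) xs"
    unfolding xs_def by (simp add: sorted_wrt_rev)
  then have "\<kappa> (e j) < \<kappa> (e i)" if "i < j" "j < CARD('n)" for i j
    using that len sorted_wrt_nth_less[of "\<lambda>x y. y < x" xs i j] by (simp add: \<kappa>e)
  moreover have "bij_betw e {..<CARD('n)} UNIV"
  proof -
    have "bij_betw ((!) xs) {..<CARD('n)} (range \<kappa>)"
      using bij_betw_nth[OF dist, of "{..<CARD('n)}" "range \<kappa>"] len set by simp
    moreover have "bij_betw (inv_into UNIV \<kappa>) (range \<kappa>) UNIV"
      using assms by (simp add: bij_betw_inv_into inj_imp_bij_betw_inv)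
    ultimately show ?thesis using bij_betw_trans by (fastforce simp: e_def[abs_def] comp_def)
  qed
  ultimately show ?thesis by blast
qed

text \<open>The sequence drops by 1 just before \<open>p\<close> and just after
  \<open>Suc p\<close>. It therefore pairs nontrivially with the difference of consecutive basis
  vectors at k only if k and p are consecutive, like a sum of the weights neighbouring node
  \<open>p\<close>.\<close>

definition step :: "nat \<Rightarrow> nat \<Rightarrow> real"
  where "step p k = (if k < p then 2 else if k \<le> Suc p then 1 else 0)"

lemma antimono_of_steps:
  fixes y :: "nat \<Rightarrow> real"
  assumes "\<And>k. Suc k < n \<Longrightarrow> y (Suc k) \<le> y k" "i \<le> j" "j < n"
  shows "y j \<le> y i"
  using assms(2,3)
proof (induction rule: dec_induct)
  case (step k)
  then show ?case using assms(1)[of k] by simp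
qed simp

text \<open>Monotonicity forces the two ones to be adjacent, with twos before and zeros after
  them.\<close>

lemma antimono_two_ones:
  fixes y :: "nat \<Rightarrow> real"
  assumes anti: "\<And>k. Suc k < n \<Longrightarrow> y (Suc k) \<le> y k"
    and val: "\<And>k. k < n \<Longrightarrow> y k \<in> {0, 1, 2}" and card: "card {k. k < n \<and> y k = 1} = 2"
  shows "\<exists>p. Suc p < n \<and> (\<forall>k<n. y k = step p k)"
proof -
  obtain a b where ab: "{k. k < n \<and> y k = 1} = {a, b}" "a < b"
    using card unfolding card_2_iff by (metis insert_commute linorder_neqE_nat)
  have y1: "k < n \<Longrightarrow> y k = 1 \<longleftrightarrow> k = a \<or> k = b" for k using ab(1) by blast
  have a: "a < n" "y a = 1" and b: "b < n" "y b = 1" using ab(1) by blast+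
  note mono = antimono_of_steps[of n y, OF anti]
  have "b = Suc a"
  proof (rule ccontr)
    assume "b \<noteq> Suc a"
    then have "Suc a < b" using ab(2) by simp
    then have "y (Suc a) \<le> y a" "y b \<le> y (Suc a)" using b(1) by (auto intro: mono)
    then have "y (Suc a) = 1" using a(2) b(2) by simp
    then show False using y1[of "Suc a"] \<open>Suc a < b\<close> b(1) by simp
  qed
  moreover have "y k = step a k" if k: "k < n" for k
  proof -
    consider "k < a" | "k = a \<or> k = Suc a" | "Suc a < k" by linarith
    then show ?thesis
    proof cases
      case 1
      then have "y a \<le> y k" using a(1) by (intro mono) simp_all
      then show ?thesis using 1 val[OF k] a(2) y1[OF k] \<open>b = Suc a\<close> by (auto simp: step_def)
    next
      case 2
      then show ?thesis using a b \<open>b = Suc a\<close> by (auto simp: step_def)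
    next
      case 3
      then have "y k \<le> y b" using k \<open>b = Suc a\<close> by (intro mono) simp_all
      then show ?thesis using 3 val[OF k] b(2) y1[OF k] \<open>b = Suc a\<close> by (auto simp: step_def)
    qed
  qed
  ultimately show ?thesis using b(1) by blast
qed

lemma antimono_zeros:
  fixes y :: "nat \<Rightarrow> real"
  assumes anti: "\<And>k. Suc k < n \<Longrightarrow> y (Suc k) \<le> y k"
    and val: "\<And>k. k < n \<Longrightarrow> y k \<in> {0, 1}" and card: "card {k. k < n \<and> y k = 0} = m" and m: "m > 0"
  shows "\<forall>k<n. y k = (if k < n - m then 1 else 0)"
proof -
  let ?Z = "{k. k < n \<and> y k = 0}"
  note mono = antimono_of_steps[of n y, OF anti]
  define a where "a = Min ?Z"
  have fin: "finite ?Z" by simp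
  then have ne: "?Z \<noteq> {}" using card m by (metis card.empty less_irrefl)
  have a: "a \<in> ?Z" "\<And>k. k \<in> ?Z \<Longrightarrow> a \<le> k" 
    unfolding a_def using Min_in[OF fin ne] Min_le[OF fin] by blast+
  have Z: "?Z = {a..<n}"
  proof
    show "?Z \<subseteq> {a..<n}" using a(2) by auto
    show "{a..<n} \<subseteq> ?Z"
    proof
      fix k assume k: "k \<in> {a..<n}"
      then have "y k \<le> y a" by (intro mono) simp_all
      then show "k \<in> ?Z" using k a(1) val[of k] by auto
    qed
  qed
  have "m = n - a" using card unfolding Z by simp
  moreover have "a < n" using a(1) by blast
  ultimately have a_eq: "n - m = a" by simp
  have "y k = (if k < n - m then 1 else 0)" if k: "k < n" for k
  proof -
    have "k \<in> ?Z \<longleftrightarrow> k \<in> {a..<n}" by (simp only: Z)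
    then have "y k = 0 \<longleftrightarrow> a \<le> k" using k by simp
    then show ?thesis using val[OF k] unfolding a_eq by auto
  qed
  then show ?thesis by blast
qed

text \<open>An orthonormal basis adapted to a chamber: the standard basis, reordered and with signs.
  Type A takes all signs equal to 1.\<close>

locale signed_basis =
  fixes e :: "nat \<Rightarrow> 'n::finite" and \<epsilon> :: "nat \<Rightarrow> real" and n :: nat
  assumes n: "n = CARD('n)" and e: "bij_betw e {..<n} UNIV" and \<epsilon>: "\<And>k. \<epsilon> k \<in> {1, -1}"
begin

definition f :: "nat \<Rightarrow> real ^ 'n" where "f k = \<epsilon> k *\<^sub>R std_basis (e k)"

lemma \<epsilon>_square: "\<epsilon> k * \<epsilon> k = 1"
  using \<epsilon>[of k] by auto

lemma inner_f: "y \<bullet> f k = \<epsilon> k * y $ e k"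
  by (simp add: f_def inner_axis)

lemma nth_e: "y $ e k = \<epsilon> k * (y \<bullet> f k)"
  using \<epsilon>_square[of k] by (simp add: inner_f flip: mult.assoc)

lemma e_eq_iff: "i < n \<Longrightarrow> j < n \<Longrightarrow> e i = e j \<longleftrightarrow> i = j"
  using e by (auto simp: bij_betw_def inj_on_def)

lemma ex_e: "\<exists>k<n. i = e k"
  using e by (auto simp: bij_betw_def)

lemma f_f: "i < n \<Longrightarrow> j < n \<Longrightarrow> f i \<bullet> f j = (if i = j then 1 else 0)"
  unfolding inner_f using \<epsilon>_square by (auto simp: f_def axis_def e_eq_iff)

lemma std_basis_e: "std_basis (e k) = \<epsilon> k *\<^sub>R f k"
  by (simp add: f_def \<epsilon>_square)

lemma f_ext:
  assumes "\<And>k. k < n \<Longrightarrow> y \<bullet> f k = z \<bullet> f k"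
  shows "y = z"
  unfolding vec_eq_iff using assms nth_e ex_e by metis

definition mk :: "(nat \<Rightarrow> real) \<Rightarrow> real ^ 'n" where "mk g = (\<Sum>k<n. g k *\<^sub>R f k)"

lemma mk_f: "k < n \<Longrightarrow> mk g \<bullet> f k = g k"
proof -
  assume k: "k < n"
  have "mk g \<bullet> f k = (\<Sum>i<n. if i = k then g i else 0)"
    unfolding mk_def inner_sum_left using k by (intro sum.cong) (auto simp: f_f)
  then show ?thesis using k by simp
qed

text \<open>Lets coordinates be read in the adapted basis: reordering preserves the numbers of
  entries, and signs are harmless when the value sets are symmetric or all signs are 1.\<close>

lemma vectors_iff:
  assumes "(symmetric_set Q \<and> symmetric_set Q') \<or> (\<forall>k. \<epsilon> k = 1)"
  shows "y \<in> vectors Q Q' m \<longleftrightarrow>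
    (\<forall>k<n. y \<bullet> f k \<in> Q \<union> Q') \<and> card {k. k < n \<and> y \<bullet> f k \<in> Q} = m"
proof -
  have Q: "y \<bullet> f k \<in> Q \<longleftrightarrow> y $ e k \<in> Q" and Q': "y \<bullet> f k \<in> Q' \<longleftrightarrow> y $ e k \<in> Q'" for k
    using assms \<epsilon>[of k] by (auto simp: inner_f symmetric_set_def)
  have "card {k. k < n \<and> y \<bullet> f k \<in> Q} = card {i. y $ i \<in> Q}"
  proof (rule bij_betw_same_card[of e])
    have "e ` {k. k < n \<and> y $ e k \<in> Q} = {i. y $ i \<in> Q}"
    proof
      show "{i. y $ i \<in> Q} \<subseteq> e ` {k. k < n \<and> y $ e k \<in> Q}"
      proof
        fix i assume i: "i \<in> {i. y $ i \<in> Q}"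
        obtain k where "k < n" "i = e k" using ex_e by blast
        then show "i \<in> e ` {k. k < n \<and> y $ e k \<in> Q}" using i by blast
      qed
    qed auto
    then show "bij_betw e {k. k < n \<and> y \<bullet> f k \<in> Q} {i. y $ i \<in> Q}"
      using e unfolding Q bij_betw_def by (auto intro: inj_on_subset)
  qed
  moreover have "(\<forall>k<n. y \<bullet> f k \<in> Q \<union> Q') \<longleftrightarrow> (\<forall>i. y $ i \<in> Q \<union> Q')"
    unfolding Un_iff Q Q' using ex_e by metis
  ultimately show ?thesis by (simp add: vectors_def)
qed

lemma roots_D_I:
  assumes "s \<in> {1, -1}" "t \<in> {1, -1}" "a < n" "b < n" "a \<noteq> b"
  shows "s *\<^sub>R f a + t *\<^sub>R f b \<in> roots_D"
proof -
  have "s *\<^sub>R f a + t *\<^sub>R f b = (s * \<epsilon> a) *\<^sub>R std_basis (e a) + (t * \<epsilon> b) *\<^sub>R std_basis (e b)"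
    by (simp add: f_def)
  moreover have "s * \<epsilon> a \<in> {1, -1}" "t * \<epsilon> b \<in> {1, -1}"
    using assms(1,2) \<epsilon>[of a] \<epsilon>[of b] by auto
  moreover have "e a \<noteq> e b" using assms by (simp add: e_eq_iff)
  ultimately show ?thesis unfolding roots_D_def by blast
qed

lemma roots_D_E:
  assumes "\<beta> \<in> roots_D"
  obtains s t a b where "s \<in> {1, -1}" "t \<in> {1, -1}" "a < b" "b < n" "\<beta> = s *\<^sub>R f a + t *\<^sub>R f b"
proof -
  obtain s t i j where st: "\<beta> = s *\<^sub>R std_basis i + t *\<^sub>R std_basis j" "s \<in> {1, -1}" "t \<in> {1, -1}" "i \<noteq> j"
    using assms unfolding roots_D_def by blast
  obtain a b where ab: "a < n" "i = e a" "b < n" "j = e b" using ex_e by metis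
  have \<beta>: "\<beta> = (s * \<epsilon> a) *\<^sub>R f a + (t * \<epsilon> b) *\<^sub>R f b"
    unfolding st(1) ab std_basis_e by simp
  have sg: "s * \<epsilon> a \<in> {1, -1}" "t * \<epsilon> b \<in> {1, -1}"
    using st(2,3) \<epsilon>[of a] \<epsilon>[of b] by auto
  have "a \<noteq> b" using st(4) ab by auto
  then consider "a < b" | "b < a" by linarith
  then show ?thesis
  proof cases
    case 1
    then show ?thesis using that[OF sg 1 ab(3) \<beta>] by blast
  next
    case 2
    have "\<beta> = (t * \<epsilon> b) *\<^sub>R f b + (s * \<epsilon> a) *\<^sub>R f a" using \<beta> by simp
    then show ?thesis using that[OF sg(2,1) 2 ab(1)] by blast
  qed
qed

lemma f_diff_root_D: "a < n \<Longrightarrow> b < n \<Longrightarrow> a \<noteq> b \<Longrightarrow> f a - f b \<in> roots_D"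
  using roots_D_I[of 1 "-1" a b] by simp

lemma f_sum_root_D: "a < n \<Longrightarrow> b < n \<Longrightarrow> a \<noteq> b \<Longrightarrow> f a + f b \<in> roots_D"
  using roots_D_I[of 1 1 a b] by simp

lemma f_neq: "a < n \<Longrightarrow> b < n \<Longrightarrow> a \<noteq> b \<Longrightarrow> f a \<noteq> f b"
  using f_f[of a a] f_f[of a b] by auto

lemma axis_roots_f:
  "{(c * s) *\<^sub>R (std_basis i :: real ^ 'n) | s i. s \<in> {1, -1}} = {(c * s) *\<^sub>R f k | s k. s \<in> {1, -1} \<and> k < n}"
proof (rule equalityI; rule subsetI)
  fix \<beta> assume "\<beta> \<in> {(c * s) *\<^sub>R (std_basis i :: real ^ 'n) | s i. s \<in> {1, -1}}"
  then obtain s i where "\<beta> = (c * s) *\<^sub>R std_basis i" "s \<in> {1, -1}" by blast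
  moreover obtain k where k: "k < n" "i = e k" using ex_e by blast
  ultimately have "\<beta> = (c * (s * \<epsilon> k)) *\<^sub>R f k" "s * \<epsilon> k \<in> {1, -1}"
    using \<epsilon>[of k] by (auto simp: std_basis_e)
  then show "\<beta> \<in> {(c * s) *\<^sub>R f k | s k. s \<in> {1, -1} \<and> k < n}" using k(1) by blast
next
  fix \<beta> assume "\<beta> \<in> {(c * s) *\<^sub>R f k | s k. s \<in> {1, -1} \<and> k < n}"
  then obtain s k where "\<beta> = (c * s) *\<^sub>R f k" "s \<in> {1, -1}" by blast
  then have "\<beta> = (c * (s * \<epsilon> k)) *\<^sub>R std_basis (e k)" "s * \<epsilon> k \<in> {1, -1}"
    using \<epsilon>[of k] by (auto simp: f_def)
  then show "\<beta> \<in> {(c * s) *\<^sub>R (std_basis i :: real ^ 'n) | s i. s \<in> {1, -1}}" by blast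
qed

lemma mk_inj: "mk g = mk g' \<Longrightarrow> k < n \<Longrightarrow> g k = g' k"
  by (metis mk_f)

lemma step_inj:
  assumes "mk (step p) = mk (step q)" "p < n" "q < n"
  shows "p = q"
proof (rule ccontr)
  assume "p \<noteq> q"
  then consider "p < q" | "q < p" by linarith
  then show False
    using mk_inj[OF assms(1), of p] mk_inj[OF assms(1), of q] assms(2,3)
    by cases (auto simp: step_def)
qed

lemma card_step:
  assumes "Suc p < n"
  shows "card {k. k < n \<and> step p k = 1} = 2"
proof -
  have "{k. k < n \<and> step p k = 1} = {p, Suc p}" using assms by (auto simp: step_def)
  then show ?thesis by simp
qed

lemma card_zeros:
  assumes "m \<le> n"
  shows "card {k. k < n \<and> (if k < n - m then 1 else 0 :: real) = 0} = m"
proof -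
  have "{k. k < n \<and> (if k < n - m then 1 else 0 :: real) = 0} = {n - m..<n}" by auto
  then show ?thesis using assms by simp
qed

end

text \<open>Regularity for type D says that the coordinates have distinct absolute values. Sorting
  these and absorbing the signs gives decreasing nonnegative coordinates, of which only the last can
  be 0.\<close>

lemma ex_signed_basis:
  fixes x :: "real ^ 'n"
  assumes reg: "\<And>\<beta>. \<beta> \<in> roots_D \<Longrightarrow> x \<bullet> \<beta> \<noteq> 0"
  shows "\<exists>(e :: nat \<Rightarrow> 'n) \<epsilon>. signed_basis e \<epsilon> CARD('n) \<and> (\<forall>k. 0 \<le> x \<bullet> signed_basis.f e \<epsilon> k) \<and>
    (\<forall>i j. i < j \<longrightarrow> j < CARD('n) \<longrightarrow> x \<bullet> signed_basis.f e \<epsilon> j < x \<bullet> signed_basis.f e \<epsilon> i)"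
proof -
  have "inj (\<lambda>i. \<bar>x $ i\<bar>)"
  proof (rule injI, rule ccontr)
    fix i j assume "\<bar>x $ i\<bar> = \<bar>x $ j\<bar>" and ij: "i \<noteq> j"
    then have "x $ i = x $ j \<or> x $ i = - x $ j" by linarith
    moreover have "1 *\<^sub>R std_basis i + 1 *\<^sub>R std_basis j \<in> (roots_D :: (real ^ 'n) set)"
      "1 *\<^sub>R std_basis i + (-1) *\<^sub>R std_basis j \<in> (roots_D :: (real ^ 'n) set)"
      unfolding roots_D_def using ij by blast+
    from this[THEN reg] have "x $ i + x $ j \<noteq> 0" "x $ i - x $ j \<noteq> 0"
      unfolding inner_axis_pair by simp_all
    ultimately show False by auto
  qed
  from ex_decreasing_enumeration[OF this] obtain e where e: "bij_betw e {..<CARD('n)} UNIV"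
    "\<forall>i j. i < j \<longrightarrow> j < CARD('n) \<longrightarrow> \<bar>x $ e j\<bar> < \<bar>x $ e i\<bar>"
    by blast
  define \<epsilon> :: "nat \<Rightarrow> real" where "\<epsilon> k = (if x $ e k \<ge> 0 then 1 else - 1)" for k
  have sb: "signed_basis e \<epsilon> CARD('n)" by unfold_locales (use e(1) in \<open>auto simp: \<epsilon>_def\<close>)
  have "x \<bullet> signed_basis.f e \<epsilon> k = \<bar>x $ e k\<bar>" for k
    unfolding signed_basis.inner_f[OF sb] by (auto simp: \<epsilon>_def)
  then show ?thesis using sb e(2) by (intro exI[of _ e] exI[of _ \<epsilon>]) simp
qed

section \<open>Facet numbers of the classical types\<close>

text \<open>The orbit of \<open>mk (step p)\<close> consists of the vectors with p entries 2, two
  entries 1 and the rest 0; letting p vary gives the counted set. These vectors lie off the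
  hyperplane of the roots, which does no harm since dominance is defined on the whole space.\<close>

lemma card_facets_A:
  assumes ch: "chamber_with_simple_roots (roots_A :: (real ^ 'n) set) r D \<alpha>"
  shows "card (cone_facets (SF (roots_A :: (real ^ 'n) set) r \<alpha>)) = card (vectors {1} {0, 2} 2 :: (real ^ 'n) set)"
proof -
  interpret rooted_chamber "roots_A :: (real ^ 'n) set" r D \<alpha>
    using root_system_A ch by unfold_locales
  have "inj (\<lambda>i. base_point $ i)"
  proof (rule injI, rule ccontr)
    fix i j assume ij: "base_point $ i = base_point $ j" "i \<noteq> j"
    then have "1 *\<^sub>R (std_basis i - std_basis j) \<in> (roots_A :: (real ^ 'n) set)"
      unfolding roots_A_def by blast
    from base_point(2)[OF this] show False using ij(1) by (simp add: inner_diff_right inner_axis)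
  qed
  from ex_decreasing_enumeration[OF this] obtain e where en: "bij_betw e {..<CARD('n)} UNIV"
    "\<And>i j. i < j \<Longrightarrow> j < CARD('n) \<Longrightarrow> base_point $ e j < base_point $ e i" by blast
  interpret signed_basis e "\<lambda>_. 1" "CARD('n)" by unfold_locales (use en in auto)
  have X: "base_point \<bullet> f i > base_point \<bullet> f j" if "i < j" "j < CARD('n)" for i j
    using en(2)[OF that] by (simp add: inner_f)
  have f_A: "f a - f b \<in> roots_A" if "a < CARD('n)" "b < CARD('n)" "a \<noteq> b" for a b
  proof -
    have "f a - f b = 1 *\<^sub>R (std_basis (e a) - std_basis (e b))" by (simp add: f_def)
    moreover have "e a \<noteq> e b" using that by (simp add: e_eq_iff)
    ultimately show ?thesis unfolding roots_A_def by blast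
  qed
  have pos_I: "f a - f b \<in> pos_roots" if "a < b" "b < CARD('n)" for a b
    using f_A[of a b] X[OF that] that by (auto simp: pos_roots_def inner_diff_right)
  have pos_E: "\<exists>a b. a < b \<and> b < CARD('n) \<and> \<beta> = f a - f b" if \<beta>: "\<beta> \<in> pos_roots" for \<beta>
  proof -
    obtain s i j where s: "\<beta> = s *\<^sub>R (std_basis i - std_basis j)" "s \<in> {1, -1}" "i \<noteq> j"
      using subsetD[OF pos_roots_subset \<beta>] unfolding roots_A_def by blast
    obtain a b where ab: "a < CARD('n)" "i = e a" "b < CARD('n)" "j = e b" using ex_e by metis
    have "\<beta> = s *\<^sub>R (f a - f b)" using s(1) by (simp add: ab f_def)
    moreover have "a \<noteq> b" using s(3) ab by auto
    ultimately obtain a' b' where *: "a' < CARD('n)" "b' < CARD('n)" "a' \<noteq> b'" "\<beta> = f a' - f b'"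
      using s(2) ab(1,3) by (metis (no_types) insertE minus_diff_eq scaleR_minus1_left scaleR_one singletonD)
    have "a' < b'"
      using \<beta> X[of b' a'] * by (auto simp: pos_roots_def inner_diff_right not_less linorder_neq_iff)
    then show ?thesis using * by blast
  qed
  define b where "b p = f p - f (Suc p)" for p
  define J where "J = {p. Suc p < CARD('n)}"
  define T where "T = (vectors {1} {0, 2} 2 :: (real ^ 'n) set) \<times> {0 :: nat}"
  have mkb: "mk g \<bullet> b q = g q - g (Suc q)" if "q \<in> J" for g q
    using that by (simp add: b_def J_def inner_diff_right mk_f)
  have mem_V: "y \<in> vectors {1} {0, 2} 2 \<longleftrightarrow>
      (\<forall>k<CARD('n). y \<bullet> f k \<in> {0, 1, 2}) \<and> card {k. k < CARD('n) \<and> y \<bullet> f k = 1} = 2" for y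
    by (subst vectors_iff) auto
  have "card (cone_facets (SF (roots_A :: (real ^ 'n) set) r \<alpha>)) = card T"
  proof (rule card_facets_eq_card[where b = b and J = J and t = "\<lambda>p. mk (step p)" and c = "\<lambda>_. 0"])
    show "b ` J \<subseteq> pos_roots" using pos_I by (auto simp: b_def J_def)
    \<comment> \<open>The dual vector is the indicator of the first \<open>Suc p\<close>
      coordinates, a fundamental weight up to a multiple of the all-ones vector.\<close>
    show "\<exists>\<tau>. \<tau> \<bullet> b p \<noteq> 0 \<and> (\<forall>q\<in>J - {p}. \<tau> \<bullet> b q = 0)" if "p \<in> J" for p
      using that by (intro exI[of _ "mk (\<lambda>k. if k \<le> p then 1 else 0)"]) (auto simp: mkb)
    show "\<exists>\<gamma>\<in>pos_roots. \<exists>\<gamma>'\<in>pos_roots. \<exists>c>0. \<exists>c'>0. \<beta> = c *\<^sub>R \<gamma> + c' *\<^sub>R \<gamma>' \<and> \<gamma> \<noteq> \<beta>"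
      if \<beta>: "\<beta> \<in> pos_roots - b ` J" for \<beta>
    proof -
      obtain i j where ij: "i < j" "j < CARD('n)" "\<beta> = f i - f j" using pos_E \<beta> by blast
      have "Suc i \<noteq> j" using \<beta> ij by (auto simp: b_def J_def)
      then have "Suc i < j" using ij(1) by simp
      then have "f i - f (Suc i) \<in> pos_roots" "f (Suc i) - f j \<in> pos_roots" "f (Suc i) \<noteq> f j"
        using ij by (auto intro: pos_I simp: f_neq)
      then show ?thesis
        by (intro bexI[of _ "f i - f (Suc i)"] bexI[of _ "f (Suc i) - f j"] exI[of _ 1] conjI)
          (auto simp: ij(3))
    qed
    show "mk (step p) \<bullet> b q \<ge> 0" if "p \<in> J" "q \<in> J" for p q
      using that by (simp add: mkb step_def)
    show "mk (step p) \<bullet> b q = 0 \<longleftrightarrow> q = p \<or> b p \<bullet> b q = 0" if "p \<in> J" "q \<in> J" for p q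
    proof -
      have "b p \<bullet> b q = (if p = q then 2 else if p = Suc q \<or> q = Suc p then -1 else 0)"
        using that by (auto simp: b_def J_def inner_diff_left inner_diff_right f_f)
      then show ?thesis using that by (auto simp: mkb step_def)
    qed
    show "(reflection a y, m) \<in> T" if "a \<in> roots_A" "(y, m) \<in> T" for a y m
      using that vectors_reflection_A by (auto simp: T_def)
    show "(mk (step p), 0) \<in> T" if "p \<in> J" for p
    proof -
      have eq: "{k. k < CARD('n) \<and> mk (step p) \<bullet> f k = 1} = {k. k < CARD('n) \<and> step p k = 1}"
        by (auto simp: mk_f)
      have "mk (step p) \<in> vectors {1} {0, 2} 2"
        unfolding mem_V
      proof
        show "\<forall>k<CARD('n). mk (step p) \<bullet> f k \<in> {0, 1, 2}" by (simp add: mk_f step_def)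
        show "card {k. k < CARD('n) \<and> mk (step p) \<bullet> f k = 1} = 2"
          unfolding eq using that by (intro card_step) (simp add: J_def)
      qed
      then show ?thesis by (simp add: T_def)
    qed
    show "inj_on (\<lambda>p. (mk (step p), 0)) J"
      using step_inj by (auto simp: inj_on_def J_def)
    show "\<exists>p\<in>J. y = mk (step p) \<and> m = 0" if y: "(y, m) \<in> T" "\<And>q. q \<in> J \<Longrightarrow> y \<bullet> b q \<ge> 0" for y m
    proof -
      have "\<exists>p. Suc p < CARD('n) \<and> (\<forall>k<CARD('n). y \<bullet> f k = step p k)"
      proof (rule antimono_two_ones)
        show "y \<bullet> f (Suc k) \<le> y \<bullet> f k" if "Suc k < CARD('n)" for k
          using y(2)[of k] that by (simp add: J_def b_def inner_diff_right)
      qed (use y(1) in \<open>auto simp: T_def mem_V\<close>)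
      then obtain p where p: "Suc p < CARD('n)" "\<And>k. k < CARD('n) \<Longrightarrow> y \<bullet> f k = step p k" by blast
      have "y = mk (step p)" using p(2) by (intro f_ext) (simp add: mk_f)
      then show ?thesis using p(1) y(1) by (auto simp: J_def T_def)
    qed
  qed
  also have "card T = card (vectors {1} {0, 2} 2 :: (real ^ 'n) set)"
    by (simp add: T_def card_cartesian_product)
  finally show ?thesis .
qed

section \<open>Dominant representatives for types B, C and D\<close>

context signed_basis
begin

lemma dominant_two_ones:
  assumes y: "y \<in> vectors {1, -1} {0, 2, -2} 2" and nonneg: "\<And>k. k < n \<Longrightarrow> 0 \<le> y \<bullet> f k"
    and anti: "\<And>k. Suc k < n \<Longrightarrow> y \<bullet> f (Suc k) \<le> y \<bullet> f k"
  shows "\<exists>p. Suc p < n \<and> y = mk (step p)"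
proof -
  have val: "\<forall>k<n. y \<bullet> f k \<in> {1, -1} \<union> {0, 2, -2}" and card: "card {k. k < n \<and> y \<bullet> f k \<in> {1, -1}} = 2"
    using y vectors_iff[of "{1, -1}" "{0, 2, -2}" y 2] symmetric_sets by blast+
  have eq: "{k. k < n \<and> y \<bullet> f k \<in> {1, -1}} = {k. k < n \<and> y \<bullet> f k = 1}"
    using nonneg by force
  have "\<exists>p. Suc p < n \<and> (\<forall>k<n. y \<bullet> f k = step p k)"
  proof (rule antimono_two_ones[where y = "\<lambda>k. y \<bullet> f k"])
    show "y \<bullet> f (Suc k) \<le> y \<bullet> f k" if "Suc k < n" for k by (rule anti[OF that])
    show "y \<bullet> f k \<in> {0, 1, 2}" if "k < n" for k using nonneg[OF that] val that by force
    show "card {k. k < n \<and> y \<bullet> f k = 1} = 2" using card unfolding eq .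
  qed
  then obtain p where p: "Suc p < n" "\<forall>k<n. y \<bullet> f k = step p k" by blast
  have "y = mk (step p)" using p(2) by (intro f_ext) (simp add: mk_f)
  then show ?thesis using p(1) by blast
qed

lemma dominant_zeros:
  assumes y: "y \<in> vectors {0} {1, -1} m" "m > 0" and nonneg: "\<And>k. k < n \<Longrightarrow> 0 \<le> y \<bullet> f k"
    and anti: "\<And>k. Suc k < n \<Longrightarrow> y \<bullet> f (Suc k) \<le> y \<bullet> f k"
  shows "y = mk (\<lambda>k. if k < n - m then 1 else 0)"
proof -
  have val: "\<forall>k<n. y \<bullet> f k \<in> {0} \<union> {1, -1}" and card: "card {k. k < n \<and> y \<bullet> f k \<in> {0}} = m"
    using y vectors_iff[of "{0}" "{1, -1}" y m] symmetric_sets by blast+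
  have "\<forall>k<n. y \<bullet> f k = (if k < n - m then 1 else 0)"
  proof (rule antimono_zeros[where y = "\<lambda>k. y \<bullet> f k"])
    show "y \<bullet> f (Suc k) \<le> y \<bullet> f k" if "Suc k < n" for k by (rule anti[OF that])
    show "y \<bullet> f k \<in> {0, 1}" if "k < n" for k using nonneg[OF that] val that by force
    show "card {k. k < n \<and> y \<bullet> f k = 0} = m" using card by simp
  qed (rule y(2))
  then show ?thesis by (intro f_ext) (simp add: mk_f)
qed

lemma mk_step_mem:
  assumes "Suc p < n"
  shows "mk (step p) \<in> vectors {1, -1} {0, 2, -2} 2"
proof -
  have eq: "{k. k < n \<and> mk (step p) \<bullet> f k \<in> {1, -1}} = {k. k < n \<and> step p k = 1}"
    by (auto simp: mk_f step_def split: if_splits)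
  have "\<forall>k<n. mk (step p) \<bullet> f k \<in> {1, -1} \<union> {0, 2, -2}" by (simp add: mk_f step_def)
  moreover have "card {k. k < n \<and> mk (step p) \<bullet> f k \<in> {1, -1}} = 2"
    unfolding eq by (rule card_step[OF assms])
  ultimately show ?thesis using vectors_iff symmetric_sets by blast
qed

lemma mk_zeros_mem:
  assumes "m \<le> n"
  shows "mk (\<lambda>k. if k < n - m then 1 else 0) \<in> vectors {0} {1, -1} m"
proof -
  let ?g = "\<lambda>k. if k < n - m then 1 else 0 :: real"
  have eq: "{k. k < n \<and> mk ?g \<bullet> f k \<in> {0}} = {k. k < n \<and> ?g k = 0}"
    by (auto simp: mk_f)
  have "\<forall>k<n. mk ?g \<bullet> f k \<in> {0} \<union> {1, -1}" by (simp add: mk_f)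
  moreover have "card {k. k < n \<and> mk ?g \<bullet> f k \<in> {0}} = m"
    unfolding eq by (rule card_zeros[OF assms])
  ultimately show ?thesis using vectors_iff symmetric_sets by blast
qed

lemma pos_root_D:
  assumes x: "\<And>i j. i < j \<Longrightarrow> j < n \<Longrightarrow> x \<bullet> f j < x \<bullet> f i" "\<And>i. 0 \<le> x \<bullet> f i"
    and \<beta>: "\<beta> \<in> roots_D" "x \<bullet> \<beta> > 0"
  shows "\<exists>a b. a < b \<and> b < n \<and> (\<beta> = f a - f b \<or> \<beta> = f a + f b)"
proof -
  obtain s t a b where st: "s \<in> {1, -1}" "t \<in> {1, -1}" "a < b" "b < n" "\<beta> = s *\<^sub>R f a + t *\<^sub>R f b"
    using \<beta>(1) by (rule roots_D_E)
  have "x \<bullet> \<beta> = s * (x \<bullet> f a) + t * (x \<bullet> f b)" by (simp add: st(5) inner_add_right)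
  then have "s = 1" using st(1,2) \<beta>(2) x(1)[OF st(3,4)] x(2)[of b] by auto
  then have "\<beta> = f a - f b \<or> \<beta> = f a + f b" using st(2,5) by auto
  then show ?thesis using st(3,4) by blast
qed

end

text \<open>Types B and C differ only in the length \<open>c\<close> of the axis roots, absorbed by
  the positive coefficients allowed in decompositions. The last node has the single neighbour before
  it and contributes the vectors with one zero and all other entries 1 or -1.\<close>

lemma card_facets_BC:
  fixes c :: real
  defines "\<Phi> \<equiv> roots_D \<union> {(c * s) *\<^sub>R std_basis i | s i. s \<in> {1, -1}} :: (real ^ 'n) set"
  assumes c: "c = 1 \<or> c = 2" and ch: "chamber_with_simple_roots \<Phi> r D \<alpha>"
  shows "card (cone_facets (SF \<Phi> r \<alpha>)) =
    card (vectors {1, -1} {0, 2, -2} 2 :: (real ^ 'n) set) + card (vectors {0} {1, -1} 1 :: (real ^ 'n) set)"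
proof -
  have c0: "c > 0" using c by auto
  have \<Phi>_eq: "\<Phi> = vectors {1, -1} {0} 2 \<union> vectors {c, -c} {0} 1"
    unfolding \<Phi>_def roots_D_eq using axis_roots_eq[of c, where 'n = 'n] c0 by simp
  interpret rooted_chamber \<Phi> r D \<alpha>
    using root_system_BC[OF c, where 'n = 'n] ch unfolding \<Phi>_eq by unfold_locales
  have D_sub: "\<beta> \<in> \<Phi>" if "\<beta> \<in> roots_D" for \<beta> using that unfolding \<Phi>_def by blast
  from ex_signed_basis[of base_point] base_point(2)[OF D_sub] obtain e \<epsilon>
    where sb: "signed_basis (e :: nat \<Rightarrow> 'n) \<epsilon> CARD('n)"
      and X0': "\<And>k. 0 \<le> base_point \<bullet> signed_basis.f e \<epsilon> k"
      and X': "\<And>i j. i < j \<Longrightarrow> j < CARD('n) \<Longrightarrow>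
        base_point \<bullet> signed_basis.f e \<epsilon> j < base_point \<bullet> signed_basis.f e \<epsilon> i"
    by blast
  define n where "n = CARD('n)"
  interpret signed_basis e \<epsilon> n unfolding n_def by (rule sb)
  note X0 = X0' and X = X'[folded n_def]
  have axis: "c *\<^sub>R f k \<in> \<Phi>" if "k < n" for k
  proof -
    have "(c * 1) *\<^sub>R f k \<in> {(c * s) *\<^sub>R f k | s k. s \<in> {1, -1} \<and> k < n}" using that by blast
    then show ?thesis unfolding \<Phi>_def axis_roots_f by simp
  qed
  have Xpos: "0 < base_point \<bullet> f i" if "i < n" for i
    using base_point(2)[OF axis[OF that]] X0[of i] by simp
  have pos_diff: "f a - f b \<in> pos_roots" if "a < b" "b < n" for a b
    using D_sub[OF f_diff_root_D[of a b]] X[OF that] that by (simp add: pos_roots_def inner_diff_right)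
  have pos_axis: "c *\<^sub>R f a \<in> pos_roots" if "a < n" for a
    using axis[OF that] Xpos[OF that] c0 by (simp add: pos_roots_def)
  have pos_E: "(\<exists>a b. a < b \<and> b < n \<and> (\<beta> = f a - f b \<or> \<beta> = f a + f b)) \<or> (\<exists>a<n. \<beta> = c *\<^sub>R f a)"
    if \<beta>: "\<beta> \<in> pos_roots" for \<beta>
  proof (cases "\<beta> \<in> roots_D")
    case True
    then show ?thesis using pos_root_D[OF X X0, of \<beta>] \<beta> by (simp add: pos_roots_def)
  next
    case False
    have "\<beta> \<in> \<Phi>" "base_point \<bullet> \<beta> > 0" using \<beta> by (simp_all add: pos_roots_def)
    then have "\<beta> \<in> {(c * s) *\<^sub>R f k | s k. s \<in> {1, -1} \<and> k < n}"
      using False unfolding \<Phi>_def axis_roots_f by blast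
    then obtain s k where sk: "\<beta> = (c * s) *\<^sub>R f k" "s \<in> {1, -1}" "k < n" by blast
    then have "s = 1"
      using \<open>base_point \<bullet> \<beta> > 0\<close> Xpos[OF sk(3)] c0 by (auto simp: zero_less_mult_iff)
    then show ?thesis using sk by auto
  qed
  define b where "b p = (if Suc p < n then f p - f (Suc p) else c *\<^sub>R f p)" for p
  define t where "t p = (if Suc p < n then mk (step p) else mk (\<lambda>k. if k < n - 1 then 1 else 0))" for p
  \<comment> \<open>In rank 3 the two end nodes share their only neighbour and the vector (1,1,0);
    the tag counts this orbit twice.\<close>
  define tag where "tag p = (if Suc p < n then 0 else 1 :: nat)" for p
  define V where "V = (vectors {1, -1} {0, 2, -2} 2 :: (real ^ 'n) set)"
  define V' where "V' = (vectors {0} {1, -1} 1 :: (real ^ 'n) set)"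
  define T where "T = V \<times> {0 :: nat} \<union> V' \<times> {1}"
  have mkb: "mk g \<bullet> b q = (if Suc q < n then g q - g (Suc q) else c * g q)" if "q < n" for g q
    using that by (simp add: b_def inner_diff_right mk_f)
  have npos: "n > 0" by (simp add: n_def)
  have "card (cone_facets (SF \<Phi> r \<alpha>)) = card T"
  proof (rule card_facets_eq_card[where b = b and J = "{..<n}" and t = t and c = tag])
    show "b ` {..<n} \<subseteq> pos_roots" using pos_diff pos_axis by (auto simp: b_def)
    show "\<exists>\<tau>. \<tau> \<bullet> b p \<noteq> 0 \<and> (\<forall>q\<in>{..<n} - {p}. \<tau> \<bullet> b q = 0)" if "p \<in> {..<n}" for p
      using that c0 by (intro exI[of _ "mk (\<lambda>k. if k \<le> p then 1 else 0)"]) (auto simp: mkb)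
    show "\<exists>\<gamma>\<in>pos_roots. \<exists>\<gamma>'\<in>pos_roots. \<exists>c>0. \<exists>c'>0. \<beta> = c *\<^sub>R \<gamma> + c' *\<^sub>R \<gamma>' \<and> \<gamma> \<noteq> \<beta>"
      if \<beta>: "\<beta> \<in> pos_roots - b ` {..<n}" for \<beta>
    proof -
      have "\<beta> \<in> pos_roots" using \<beta> by simp
      from pos_E[OF this] consider i j where "i < j" "j < n" "\<beta> = f i - f j"
        | i j where "i < j" "j < n" "\<beta> = f i + f j" | i where "i < n" "\<beta> = c *\<^sub>R f i"
        by blast
      then show ?thesis
      proof cases
        case (1 i j)
        have "Suc i \<noteq> j" using \<beta> 1 by (auto simp: b_def)
        then have "f i - f (Suc i) \<in> pos_roots" "f (Suc i) - f j \<in> pos_roots" "f (Suc i) \<noteq> f j"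
          using 1 by (auto intro: pos_diff simp: f_neq)
        then show ?thesis
          by (intro bexI[of _ "f i - f (Suc i)"] bexI[of _ "f (Suc i) - f j"] exI[of _ 1] conjI)
            (auto simp: 1(3))
      next
        case (2 i j)
        have "\<beta> \<bullet> f j \<noteq> (c *\<^sub>R f i) \<bullet> f j" using 2 by (simp add: inner_add_left f_f)
        then have "c *\<^sub>R f i \<noteq> \<beta>" by metis
        moreover have "\<beta> = (1 / c) *\<^sub>R (c *\<^sub>R f i) + (1 / c) *\<^sub>R (c *\<^sub>R f j)"
          using 2(3) c0 by simp
        ultimately show ?thesis
          using pos_axis[of i] pos_axis[of j] 2 c0
          by (intro bexI[of _ "c *\<^sub>R f i"] bexI[of _ "c *\<^sub>R f j"] exI[of _ "1 / c"] conjI) auto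
      next
        case (3 i)
        have "Suc i < n"
        proof (rule ccontr)
          assume "\<not> Suc i < n"
          then have "b i = \<beta>" using 3 by (simp add: b_def)
          then show False using \<beta> 3(1) by blast
        qed
        then have i: "i < n - 1" "n - 1 < n" by auto
        have "\<beta> \<bullet> f (n - 1) \<noteq> (f i - f (n - 1)) \<bullet> f (n - 1)"
          using 3 i by (simp add: inner_diff_left f_f)
        then have "f i - f (n - 1) \<noteq> \<beta>" by metis
        moreover have "\<beta> = c *\<^sub>R (f i - f (n - 1)) + 1 *\<^sub>R (c *\<^sub>R f (n - 1))"
          using 3 by (simp add: scaleR_diff_right)
        ultimately show ?thesis
          using pos_diff[OF i] pos_axis[OF i(2)] c0
          by (intro bexI[of _ "f i - f (n - 1)"] bexI[of _ "c *\<^sub>R f (n - 1)"] exI[of _ c] exI[of _ 1] conjI) auto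
      qed
    qed
    show "t p \<bullet> b q \<ge> 0" if "p \<in> {..<n}" "q \<in> {..<n}" for p q
      using that c0 by (auto simp: t_def mkb step_def)
    show "t p \<bullet> b q = 0 \<longleftrightarrow> q = p \<or> b p \<bullet> b q = 0" if pq: "p \<in> {..<n}" "q \<in> {..<n}" for p q
    proof -
      have "b p \<bullet> b q = (if p = q then (if Suc p < n then 2 else c * c)
          else if p = Suc q then (if Suc p < n then - 1 else - c)
          else if q = Suc p then (if Suc q < n then - 1 else - c) else 0)"
        using pq by (auto simp: b_def inner_diff_left inner_diff_right f_f)
      moreover have "t p \<bullet> b q = (if Suc p < n
          then (if Suc q < n then step p q - step p (Suc q) else c * step p q)
          else (if Suc q < n then (if Suc q < n - 1 then 0 else 1) else 0))"
        using pq by (auto simp: t_def mkb)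
      ultimately show ?thesis using pq c0 by (auto simp: step_def)
    qed
    show "(reflection a y, m) \<in> T" if a: "a \<in> \<Phi>" and ym: "(y, m) \<in> T" for a y m
    proof -
      have "reflection a z \<in> vectors Q Q' k"
        if "symmetric_set Q" "symmetric_set Q'" "z \<in> vectors Q Q' k" for Q Q' k z
      proof (cases "a \<in> roots_D")
        case True
        then show ?thesis using vectors_reflection_D that by blast
      next
        case False
        then obtain s i where "a = (c * s) *\<^sub>R std_basis i" "s \<in> {1, -1}"
          using a unfolding \<Phi>_def by blast
        moreover have "c * s \<noteq> 0" using c0 calculation(2) by auto
        ultimately show ?thesis using vectors_reflection_axis that by blast
      qed
      then show ?thesis using ym symmetric_sets unfolding T_def V_def V'_def by blast
    qed
    show "(t p, tag p) \<in> T" if "p \<in> {..<n}" for p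
      using mk_step_mem[of p] mk_zeros_mem[of 1] npos by (auto simp: t_def tag_def T_def V_def V'_def)
    show "inj_on (\<lambda>p. (t p, tag p)) {..<n}"
    proof (rule inj_onI)
      fix p q assume pq: "p \<in> {..<n}" "q \<in> {..<n}" "(t p, tag p) = (t q, tag q)"
      then have "Suc p < n \<longleftrightarrow> Suc q < n" by (auto simp: tag_def split: if_splits)
      then show "p = q" using pq step_inj[of p q] by (cases "Suc p < n") (auto simp: t_def)
    qed
    show "\<exists>p\<in>{..<n}. y = t p \<and> m = tag p"
      if y: "(y, m) \<in> T" "\<And>q. q \<in> {..<n} \<Longrightarrow> y \<bullet> b q \<ge> 0" for y m
    proof -
      have anti: "y \<bullet> f (Suc k) \<le> y \<bullet> f k" if "Suc k < n" for k
        using y(2)[of k] that by (simp add: b_def inner_diff_right)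
      have "0 \<le> y \<bullet> b (n - 1)" using npos by (intro y(2)) simp
      then have last: "0 \<le> y \<bullet> f (n - 1)" using c0 npos by (simp add: b_def zero_le_mult_iff)
      have nonneg: "0 \<le> y \<bullet> f k" if "k < n" for k
        using antimono_of_steps[of n "\<lambda>k. y \<bullet> f k" k "n - 1"] anti last that by force
      consider "y \<in> V" "m = 0" | "y \<in> V'" "m = 1" using y(1) by (auto simp: T_def)
      then show ?thesis
      proof cases
        case 1
        then obtain p where "Suc p < n" "y = mk (step p)"
          using dominant_two_ones[OF _ nonneg anti] unfolding V_def by blast
        then show ?thesis using 1 by (intro bexI[of _ p]) (auto simp: t_def tag_def)
      next
        case 2
        then have "y = mk (\<lambda>k. if k < n - 1 then 1 else 0)"
          using dominant_zeros[of y 1, OF _ _ nonneg anti] unfolding V'_def by simp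
        then show ?thesis using 2 npos by (intro bexI[of _ "n - 1"]) (auto simp: t_def tag_def)
      qed
    qed
  qed
  also have "card T = card V + card V'"
  proof -
    have "finite V" "finite V'" by (auto simp: V_def V'_def intro!: card_vectors(2))
    then show ?thesis
      unfolding T_def by (subst card_Un_disjoint) (auto simp: card_cartesian_product)
  qed
  finally show ?thesis unfolding V_def V'_def .
qed

text \<open>Nodes off the fork contribute vectors \<open>mk (step p)\<close> ending in 0; both fork
  ends contribute the same orbit, that of (1,...,1,0,0), whence the factor 2. A zero coordinate
  absorbs a sign change, so the even sign changes of type D reach all sign patterns.\<close>

lemma card_facets_D:
  assumes ch: "chamber_with_simple_roots (roots_D :: (real ^ 'n) set) r D \<alpha>"
  shows "card (cone_facets (SF (roots_D :: (real ^ 'n) set) r \<alpha>)) =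
    card (vectors {1, -1} {0, 2, -2} 2 - vectors {1, -1} {2, -2} 2 :: (real ^ 'n) set)
      + 2 * card (vectors {0} {1, -1} 2 :: (real ^ 'n) set)"
proof -
  interpret rooted_chamber "roots_D :: (real ^ 'n) set" r D \<alpha>
    using root_system_D ch by unfold_locales
  from ex_signed_basis[of base_point] base_point(2) obtain e \<epsilon>
    where sb: "signed_basis (e :: nat \<Rightarrow> 'n) \<epsilon> CARD('n)"
      and X0': "\<And>k. 0 \<le> base_point \<bullet> signed_basis.f e \<epsilon> k"
      and X': "\<And>i j. i < j \<Longrightarrow> j < CARD('n) \<Longrightarrow>
        base_point \<bullet> signed_basis.f e \<epsilon> j < base_point \<bullet> signed_basis.f e \<epsilon> i"
    by blast
  define n where "n = CARD('n)"
  interpret signed_basis e \<epsilon> n unfolding n_def by (rule sb)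
  note X0 = X0' and X = X'[folded n_def]
  have pos_diff: "f a - f b \<in> pos_roots" if "a < b" "b < n" for a b
    using f_diff_root_D[of a b] X[OF that] that by (simp add: pos_roots_def inner_diff_right)
  have pos_sum: "f a + f b \<in> pos_roots" if "a < b" "b < n" for a b
    using f_sum_root_D[of a b] X[OF that] X0[of b] that by (simp add: pos_roots_def inner_add_right)
  have pos_E: "\<exists>a b. a < b \<and> b < n \<and> (\<beta> = f a - f b \<or> \<beta> = f a + f b)" if \<beta>: "\<beta> \<in> pos_roots" for \<beta>
    using pos_root_D[OF X X0, of \<beta>] \<beta> by (simp add: pos_roots_def)
  \<comment> \<open>For dimension 1 the root system is empty of rank 0, and so must be the index
    set.\<close>
  define J where "J = {p. p < n \<and> n \<ge> 2}"
  define b where "b p = (if Suc p < n then f p - f (Suc p) else f (p - 1) + f p)" for p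
  define t where "t p = (if Suc (Suc p) < n then mk (step p) else mk (\<lambda>k. if k < n - 2 then 1 else 0))" for p
  define tag where "tag p = (if Suc (Suc p) < n then 0 else if Suc p < n then 1 else 2 :: nat)" for p
  \<comment> \<open>Vectors without a zero coordinate are removed, as they belong to no node off the
    fork.\<close>
  define V where "V = (vectors {1, -1} {0, 2, -2} 2 - vectors {1, -1} {2, -2} 2 :: (real ^ 'n) set)"
  define V' where "V' = (vectors {0} {1, -1} 2 :: (real ^ 'n) set)"
  define T where "T = V \<times> {0 :: nat} \<union> V' \<times> {1, 2}"
  have mkb: "mk g \<bullet> b q = (if Suc q < n then g q - g (Suc q) else g (q - 1) + g q)" if "q \<in> J" for g q
    using that by (auto simp: b_def J_def inner_diff_right inner_add_right mk_f)
  have V_iff: "y \<in> V \<longleftrightarrow> y \<in> vectors {1, -1} {0, 2, -2} 2 \<and> (\<exists>k<n. y \<bullet> f k = 0)" for y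
    unfolding V_def Diff_iff using symmetric_sets
    by (auto simp: vectors_iff[of "{1, -1}" "{0, 2, -2}"] vectors_iff[of "{1, -1}" "{2, -2}"])
  have "card (cone_facets (SF (roots_D :: (real ^ 'n) set) r \<alpha>)) = card T"
  proof (rule card_facets_eq_card[where b = b and J = J and t = t and c = tag])
    show "b ` J \<subseteq> pos_roots"
    proof clarify
      fix p assume p: "p \<in> J"
      show "b p \<in> pos_roots"
      proof (cases "Suc p < n")
        case False
        then have "p - 1 < p" "p < n" using p by (auto simp: J_def)
        then show ?thesis using False pos_sum by (simp add: b_def)
      qed (use pos_diff in \<open>simp add: b_def\<close>)
    qed
    show "\<exists>\<tau>. \<tau> \<bullet> b p \<noteq> 0 \<and> (\<forall>q\<in>J - {p}. \<tau> \<bullet> b q = 0)" if p: "p \<in> J" for p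
    proof -
      \<comment> \<open>The dual vectors are multiples of fundamental weights; those of the fork
        ends are (1,...,1,-1) and (1,...,1,1).\<close>
      consider "Suc (Suc p) < n" | "Suc (Suc p) = n" | "Suc p = n" using p by (force simp: J_def)
      then show ?thesis
      proof cases
        case 1
        let ?g = "\<lambda>k. (if k < n - 2 then (if k \<le> p then 1 else 0) else 0 :: real)"
        show ?thesis using 1 p by (intro exI[of _ "mk ?g"]) (auto simp: mkb J_def)
      next
        case 2
        let ?g = "\<lambda>k. (if k = n - 1 then - 1 else 1 :: real)"
        show ?thesis using 2 p by (intro exI[of _ "mk ?g"]) (auto simp: mkb J_def)
      next
        case 3
        show ?thesis using 3 p by (intro exI[of _ "mk (\<lambda>_. 1)"]) (auto simp: mkb J_def)
      qed
    qed
    show "\<exists>\<gamma>\<in>pos_roots. \<exists>\<gamma>'\<in>pos_roots. \<exists>c>0. \<exists>c'>0. \<beta> = c *\<^sub>R \<gamma> + c' *\<^sub>R \<gamma>' \<and> \<gamma> \<noteq> \<beta>"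
      if \<beta>: "\<beta> \<in> pos_roots - b ` J" for \<beta>
    proof -
      have split: ?thesis if "\<beta> = \<gamma> + \<gamma>'" "\<gamma> \<in> pos_roots" "\<gamma>' \<in> pos_roots" for \<gamma> \<gamma>'
      proof -
        have "0 \<notin> pos_roots" using zero_not_root pos_roots_subset by blast
        then have "\<gamma> \<noteq> \<beta>" using that by auto
        then show ?thesis using that
          by (intro bexI[of _ \<gamma>] bexI[of _ \<gamma>'] exI[of _ 1] conjI) auto
      qed
      have "\<beta> \<in> pos_roots" using \<beta> by simp
      from pos_E[OF this] obtain i j where ij: "i < j" "j < n" "\<beta> = f i - f j \<or> \<beta> = f i + f j"
        by blast
      have iJ: "i \<in> J" "j \<in> J" using ij by (auto simp: J_def)
      show ?thesis
        using ij(3)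
      proof
        assume eq: "\<beta> = f i - f j"
        have "Suc i \<noteq> j"
        proof
          assume "Suc i = j"
          then have "\<beta> = b i" using eq ij by (simp add: b_def)
          then show False using \<beta> iJ by blast
        qed
        then show ?thesis
          using ij by (intro split[of "f i - f (Suc i)" "f (Suc i) - f j"] pos_diff) (auto simp: eq)
      next
        assume eq: "\<beta> = f i + f j"
        show ?thesis
        \<comment> \<open>If \<open>j\<close> is not last, the last basis vector is subtracted from
          one summand and added to the other. Otherwise insert the basis vector after
          \<open>i\<close>, which fails only for the simple root at the fork.\<close>
        proof (cases "Suc j < n")
          case True
          then have "n - 1 < n" "i < n - 1" "j < n - 1" using ij by auto
          then show ?thesis
            by (intro split[of "f i - f (n - 1)" "f j + f (n - 1)"] pos_diff pos_sum) (auto simp: eq)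
        next
          case False
          have "Suc i \<noteq> j"
          proof
            assume "Suc i = j"
            then have "\<beta> = b j" using eq False by (auto simp: b_def)
            then show False using \<beta> iJ by blast
          qed
          then show ?thesis
            using ij by (intro split[of "f i - f (Suc i)" "f (Suc i) + f j"] pos_diff pos_sum) (auto simp: eq)
        qed
      qed
    qed
    have t_b: "t p \<bullet> b q = (if Suc (Suc p) < n
        then (if Suc q < n then step p q - step p (Suc q) else step p (q - 1) + step p q)
        else (if Suc (Suc q) = n - 1 then 1 else 0))" if pq: "p \<in> J" "q \<in> J" for p q
      using pq by (auto simp: t_def mkb)
    show "t p \<bullet> b q \<ge> 0" if "p \<in> J" "q \<in> J" for p q
      unfolding t_b[OF that] by (simp add: step_def)
    show "t p \<bullet> b q = 0 \<longleftrightarrow> q = p \<or> b p \<bullet> b q = 0" if pq: "p \<in> J" "q \<in> J" for p q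
    proof -
      have bb: "b p \<bullet> b q = (if p = q then 2
          else if Suc p < n \<and> Suc q < n \<and> (p = Suc q \<or> q = Suc p) then - 1
          else if Suc p = n \<and> Suc (Suc q) = p then - 1
          else if Suc q = n \<and> Suc (Suc p) = q then - 1 else 0)"
      proof -
        have "n \<ge> 2" using pq(1) by (simp add: J_def)
        \<comment> \<open>Writing n as m + 2 removes the truncated subtraction in \<open>b\<close>
          before the case analysis.\<close>
        then obtain m where m: "n = Suc (Suc m)"
          by (metis add_2_eq_Suc le_Suc_ex)
        have le: "p \<le> Suc m" "q \<le> Suc m" using pq by (simp_all add: J_def m)
        have b_m: "b k = (if k = Suc m then f m + f (Suc m) else f k - f (Suc k))" if "k \<le> Suc m" for k
          using that by (auto simp: b_def m)
        have f_m: "f i \<bullet> f j = (if i = j then 1 else 0)" if "i \<le> Suc m" "j \<le> Suc m" for i j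
          using that by (intro f_f) (simp_all add: m)
        note inner = inner_diff_left inner_diff_right inner_add_left inner_add_right
        consider "p = Suc m" "q = Suc m" | "p = Suc m" "q \<le> m" | "p \<le> m" "q = Suc m" | "p \<le> m" "q \<le> m"
          using le by linarith
        then show ?thesis
          by cases (auto simp: m b_m inner f_m)
      qed
      show ?thesis
        unfolding bb t_b[OF pq] using pq by (auto simp: step_def J_def)
    qed
    show "(reflection a y, m) \<in> T" if a: "a \<in> roots_D" and ym: "(y, m) \<in> T" for a y m
    proof -
      have st: "reflection a z \<in> vectors Q Q' k"
        if "symmetric_set Q" "symmetric_set Q'" "z \<in> vectors Q Q' k" for Q Q' k z
        using vectors_reflection_D[OF that(1,2) a that(3)] .
      \<comment> \<open>The reflection is an involution, so it also preserves the complement of a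
        stable set; this is what \<open>V\<close> requires.\<close>
      have "reflection a y \<notin> vectors {1, -1} {2, -2} 2" if "y \<notin> vectors {1, -1} {2, -2} 2"
        using st[of "{1, -1}" "{2, -2}" "reflection a y" 2] symmetric_sets that by auto
      then show ?thesis using ym st symmetric_sets unfolding T_def V_def V'_def by blast
    qed
    show "(t p, tag p) \<in> T" if p: "p \<in> J" for p
    proof (cases "Suc (Suc p) < n")
      case True
      then have "mk (step p) \<in> vectors {1, -1} {0, 2, -2} 2" by (intro mk_step_mem) simp
      moreover have "mk (step p) \<bullet> f (n - 1) = 0" using True by (simp add: mk_f step_def)
      ultimately have "mk (step p) \<in> V" unfolding V_iff using True by (intro conjI exI[of _ "n - 1"]) auto
      then show ?thesis using True by (simp add: t_def tag_def T_def)
    next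
      case False
      then show ?thesis
        using mk_zeros_mem[of 2] p by (auto simp: t_def tag_def T_def V'_def J_def)
    qed
    show "inj_on (\<lambda>p. (t p, tag p)) J"
    proof (rule inj_onI)
      fix p q assume pq: "p \<in> J" "q \<in> J" "(t p, tag p) = (t q, tag q)"
      then have "tag p = tag q" "t p = t q" by auto
      then show "p = q" using pq(1,2) step_inj[of p q]
        by (auto simp: t_def tag_def J_def split: if_splits)
    qed
    show "\<exists>p\<in>J. y = t p \<and> m = tag p"
      if y: "(y, m) \<in> T" "\<And>q. q \<in> J \<Longrightarrow> y \<bullet> b q \<ge> 0" for y m
    proof -
      have zeros_V': "\<exists>k<n. y \<bullet> f k = 0" "n \<ge> 2" if "y \<in> V'"
      proof -
        have "card {k. k < n \<and> y \<bullet> f k \<in> {0}} = 2"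
          using that vectors_iff[of "{0}" "{1, -1}" y 2] symmetric_sets unfolding V'_def by blast
        moreover have "card {k. k < n \<and> y \<bullet> f k \<in> {0}} \<le> card {..<n}" by (intro card_mono) auto
        ultimately show "n \<ge> 2" "\<exists>k<n. y \<bullet> f k = 0"
          by (simp, metis (no_types, lifting) card.empty empty_Collect_eq singletonD zero_neq_numeral)
      qed
      have n2_V: "n \<ge> 2" if "y \<in> V"
      proof -
        have "card {k. k < n \<and> y \<bullet> f k \<in> {1, -1}} = 2"
          using that vectors_iff[of "{1, -1}" "{0, 2, -2}" y 2] symmetric_sets unfolding V_def by blast
        moreover have "card {k. k < n \<and> y \<bullet> f k \<in> {1, -1}} \<le> card {..<n}" by (intro card_mono) auto
        ultimately show ?thesis by simp
      qed
      have yV: "y \<in> V \<and> m = 0 \<or> y \<in> V' \<and> m \<in> {1, 2}" using y(1) by (auto simp: T_def)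
      have n2: "n \<ge> 2" using yV n2_V zeros_V'(2) by blast
      obtain z where z: "z < n" "y \<bullet> f z = 0" using yV zeros_V'(1) V_iff by blast
      have anti: "y \<bullet> f (Suc k) \<le> y \<bullet> f k" if "Suc k < n" for k
        using y(2)[of k] that by (simp add: J_def b_def inner_diff_right)
      have "n - 1 \<in> J" "n - 2 \<in> J" using n2 by (auto simp: J_def)
      have ge: "y \<bullet> f (n - 2) + y \<bullet> f (n - 1) \<ge> 0"
        using y(2)[OF \<open>n - 1 \<in> J\<close>] n2 by (simp add: b_def inner_add_right numeral_2_eq_2)
      note mono = antimono_of_steps[of n "\<lambda>k. y \<bullet> f k", OF anti]
      \<comment> \<open>If a zero occurs earlier, the last two coordinates are decreasing and at
        most 0, while their sum is nonnegative by the simple root at the fork; so both vanish.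
        Without a zero coordinate the last entry could be negative.\<close>
      have last: "y \<bullet> f (n - 1) = 0"
      proof (cases "z = n - 1")
        case False
        then have "y \<bullet> f (n - 2) \<le> y \<bullet> f z" "y \<bullet> f (n - 1) \<le> y \<bullet> f (n - 2)"
          using z(1) n2 by (auto intro!: mono)
        then show ?thesis using z(2) ge by linarith
      qed (use z in simp)
      have nonneg: "0 \<le> y \<bullet> f k" if "k < n" for k
        using mono[of k "n - 1"] last that by simp
      show ?thesis
        using yV
      proof
        assume yV: "y \<in> V \<and> m = 0"
        then obtain p where p: "Suc p < n" "y = mk (step p)"
          using dominant_two_ones[OF _ nonneg anti] V_iff by blast
        have "Suc (Suc p) < n"
        proof (rule ccontr)
          assume "\<not> Suc (Suc p) < n"
          then have "n - 1 = Suc p" using p(1) by simp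
          then have "y \<bullet> f (n - 1) = 1" using p by (simp add: mk_f step_def)
          then show False using last by simp
        qed
        then show ?thesis using p yV by (intro bexI[of _ p]) (auto simp: t_def tag_def J_def)
      next
        assume yV': "y \<in> V' \<and> m \<in> {1, 2}"
        then have "y = mk (\<lambda>k. if k < n - 2 then 1 else 0)"
          using dominant_zeros[of y 2, OF _ _ nonneg anti] unfolding V'_def by simp
        moreover have "m = 1 \<or> m = 2" using yV' by blast
        ultimately show ?thesis
          using n2 \<open>n - 1 \<in> J\<close> \<open>n - 2 \<in> J\<close>
          by (auto simp: t_def tag_def intro: bexI[of _ "n - 1"] bexI[of _ "n - 2"])
      qed
    qed
  qed
  also have "card T = card V + 2 * card V'"
  proof -
    have "finite V" "finite V'" by (auto simp: V_def V'_def intro!: card_vectors(2) finite_Diff)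
    then show ?thesis
      unfolding T_def by (subst card_Un_disjoint) (auto simp: card_cartesian_product)
  qed
  finally show ?thesis unfolding V_def V'_def .
qed

lemma real_choose_2: "real (n choose 2) = real n * (real n - 1) / 2"
  by (cases n) (simp_all add: choose_two real_of_nat_div field_simps)

theorem theorem7p2:
  shows "(\<forall>(\<Phi> :: 'v::euclidean_space set) d D \<alpha>.
      root_system \<Phi> \<and> chamber_with_simple_roots \<Phi> d D \<alpha> \<longrightarrow>
        finite (cone_facets (SF \<Phi> d \<alpha>)) \<and>
        real (card (cone_facets (SF \<Phi> d \<alpha>))) =
          (\<Sum>i=1..d. real (order (reflection_group \<Phi>)) /
            real (order (reflection_group (\<alpha> ` ({1..d} - dynkin_neighbors d \<alpha> i))))) \<and>
        card (orbits (reflection_group \<Phi>) (cone_facets (SF \<Phi> d \<alpha>)) act_set) = d) \<and>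
    (\<forall>r D \<alpha>. chamber_with_simple_roots (roots_A :: (real ^ 'n) set) r D \<alpha> \<longrightarrow>
      real (card (cone_facets (SF (roots_A :: (real ^ 'n) set) r \<alpha>))) =
        real CARD('n) * (real CARD('n) - 1) * 2 powi (int CARD('n) - 3)) \<and>
    (\<forall>r D \<alpha>. chamber_with_simple_roots (roots_B :: (real ^ 'n) set) r D \<alpha> \<longrightarrow>
      real (card (cone_facets (SF (roots_B :: (real ^ 'n) set) r \<alpha>))) =
        2 * real CARD('n) * (real CARD('n) - 1) * 3 powi (int CARD('n) - 2)
          + real CARD('n) * 2 powi (int CARD('n) - 1)) \<and>
    (\<forall>r D \<alpha>. chamber_with_simple_roots (roots_C :: (real ^ 'n) set) r D \<alpha> \<longrightarrow>
      real (card (cone_facets (SF (roots_C :: (real ^ 'n) set) r \<alpha>))) =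
        2 * real CARD('n) * (real CARD('n) - 1) * 3 powi (int CARD('n) - 2)
          + real CARD('n) * 2 powi (int CARD('n) - 1)) \<and>
    (\<forall>r D \<alpha>. chamber_with_simple_roots (roots_D :: (real ^ 'n) set) r D \<alpha> \<longrightarrow>
      real (card (cone_facets (SF (roots_D :: (real ^ 'n) set) r \<alpha>))) =
        2 * real CARD('n) * (real CARD('n) - 1) * 3 powi (int CARD('n) - 2)
          - real CARD('n) * (real CARD('n) - 1) * 2 powi (int CARD('n) - 2))"
proof (intro conjI allI impI)
  fix \<Phi> :: "'v set" and d D \<alpha>
  assume "root_system \<Phi> \<and> chamber_with_simple_roots \<Phi> d D \<alpha>"
  then interpret rooted_chamber \<Phi> d D \<alpha> by unfold_locales auto
  show "finite (cone_facets (SF \<Phi> d \<alpha>))" by (rule finite_facets)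
  show "real (card (cone_facets (SF \<Phi> d \<alpha>))) =
      (\<Sum>i=1..d. real (order (reflection_group \<Phi>)) /
        real (order (reflection_group (\<alpha> ` ({1..d} - dynkin_neighbors d \<alpha> i)))))"
    unfolding order_def by (rule card_facets)
  show "card (orbits (reflection_group \<Phi>) (cone_facets (SF \<Phi> d \<alpha>)) act_set) = d"
    by (rule card_facet_orbits)
next
  let ?n = "CARD('n)"
  have n: "?n \<ge> 1" by (simp add: Suc_leI)
  \<comment> \<open>The exponents of the statement are integers, those of the counting lemmas are
    natural numbers. They are reconciled only from 2 on, where the natural subtraction does not
    truncate.\<close>
  have pow: "x powi (int ?n - 2) = x ^ (?n - 2)" "x powi (int ?n - 3) = x ^ (?n - 2) / x"
    if "?n \<ge> 2" "x > 0" for x :: real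
  proof -
    have "int ?n - 2 = int (?n - 2)" using that(1) by simp
    then show *: "x powi (int ?n - 2) = x ^ (?n - 2)" by (simp only: power_int_of_nat)
    have "x powi (int ?n - 3) = x powi ((int ?n - 2) - 1)" by simp
    also have "\<dots> = x powi (int ?n - 2) / x"
      using that(2) by (subst power_int_diff) auto
    finally show "x powi (int ?n - 3) = x ^ (?n - 2) / x" using * by simp
  qed
  have pow1: "2 powi (int ?n - 1) = (2 :: real) ^ (?n - 1)"
  proof -
    have "int ?n - 1 = int (?n - 1)" using n by simp
    then show ?thesis by (simp only: power_int_of_nat)
  qed
  have cardA: "real (card (vectors {1} {0, 2} 2 :: (real ^ 'n) set)) = real (?n choose 2) * 2 ^ (?n - 2)"
    by (subst card_vectors(1)) auto
  have card1: "real (card (vectors {1, -1} {0, 2, -2} 2 :: (real ^ 'n) set)) = real (?n choose 2) * 4 * 3 ^ (?n - 2)"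
    by (subst card_vectors(1)) auto
  have card2: "real (card (vectors {1, -1} {2, -2} 2 :: (real ^ 'n) set)) = real (?n choose 2) * 4 * 2 ^ (?n - 2)"
    by (subst card_vectors(1)) auto
  have card3: "real (card (vectors {0} {1, -1} 1 :: (real ^ 'n) set)) = real ?n * 2 ^ (?n - 1)"
    by (subst card_vectors(1)) auto
  have card4: "real (card (vectors {0} {1, -1} 2 :: (real ^ 'n) set)) = real (?n choose 2) * 2 ^ (?n - 2)"
    by (subst card_vectors(1)) auto
  have diff: "real (card (vectors {1, -1} {0, 2, -2} 2 - vectors {1, -1} {2, -2} 2 :: (real ^ 'n) set))
      = real (?n choose 2) * 4 * 3 ^ (?n - 2) - real (?n choose 2) * 4 * 2 ^ (?n - 2)"
  proof -
    have sub: "vectors {1, -1} {2, -2} 2 \<subseteq> (vectors {1, -1} {0, 2, -2} 2 :: (real ^ 'n) set)"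
      by (auto simp: vectors_def)
    have fin: "finite (vectors {1, -1} {0, 2, -2} 2 :: (real ^ 'n) set)"
      "finite (vectors {1, -1} {2, -2} 2 :: (real ^ 'n) set)"
      by (rule card_vectors(2); simp)+
    show ?thesis
      unfolding card1[symmetric] card2[symmetric]
      using card_Diff_subset[OF fin(2) sub] card_mono[OF fin(1) sub] by simp
  qed
  \<comment> \<open>In dimension 1 the powers with negative exponent are multiplied by
    \<open>CARD('n) - 1\<close>, which is 0, matching the vanishing binomial coefficient.\<close>
  have one: "?n = 1 \<or> ?n \<ge> 2" using n by linarith
  {
    fix r D and \<alpha> :: "nat \<Rightarrow> real ^ 'n"
    assume "chamber_with_simple_roots (roots_A :: (real ^ 'n) set) r D \<alpha>"
    then have A: "real (card (cone_facets (SF (roots_A :: (real ^ 'n) set) r \<alpha>))) = real (?n choose 2) * 2 ^ (?n - 2)"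
      using card_facets_A cardA by metis
    show "real (card (cone_facets (SF (roots_A :: (real ^ 'n) set) r \<alpha>))) =
        real ?n * (real ?n - 1) * 2 powi (int ?n - 3)"
    proof (cases "?n \<ge> 2")
      case True
      show ?thesis unfolding A real_choose_2 pow(2)[OF True zero_less_numeral] by simp
    next
      case False
      then have "?n = 1" using n by linarith
      then show ?thesis unfolding A by simp
    qed
  next
    have BC: "real (card (vectors {1, -1} {0, 2, -2} 2 :: (real ^ 'n) set) + card (vectors {0} {1, -1} 1 :: (real ^ 'n) set))
        = 2 * real ?n * (real ?n - 1) * 3 powi (int ?n - 2) + real ?n * 2 powi (int ?n - 1)"
      unfolding of_nat_add card1 card3 pow1 using one pow(1)[of 3] by (auto simp: real_choose_2)
    fix r D and \<alpha> :: "nat \<Rightarrow> real ^ 'n"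
    show "real (card (cone_facets (SF (roots_B :: (real ^ 'n) set) r \<alpha>))) =
        2 * real ?n * (real ?n - 1) * 3 powi (int ?n - 2) + real ?n * 2 powi (int ?n - 1)"
      if "chamber_with_simple_roots (roots_B :: (real ^ 'n) set) r D \<alpha>"
      using card_facets_BC[of 1 r D \<alpha>] that BC by (simp add: roots_B_def)
    show "real (card (cone_facets (SF (roots_C :: (real ^ 'n) set) r \<alpha>))) =
        2 * real ?n * (real ?n - 1) * 3 powi (int ?n - 2) + real ?n * 2 powi (int ?n - 1)"
      if "chamber_with_simple_roots (roots_C :: (real ^ 'n) set) r D \<alpha>"
      using card_facets_BC[of 2 r D \<alpha>] that BC by (simp add: roots_C_def)
  next
    fix r D and \<alpha> :: "nat \<Rightarrow> real ^ 'n"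
    assume "chamber_with_simple_roots (roots_D :: (real ^ 'n) set) r D \<alpha>"
    then have F: "real (card (cone_facets (SF (roots_D :: (real ^ 'n) set) r \<alpha>)))
        = (real (?n choose 2) * 4 * 3 ^ (?n - 2) - real (?n choose 2) * 4 * 2 ^ (?n - 2))
          + 2 * (real (?n choose 2) * 2 ^ (?n - 2))"
      by (simp only: card_facets_D of_nat_add of_nat_mult of_nat_numeral diff card4)
    show "real (card (cone_facets (SF (roots_D :: (real ^ 'n) set) r \<alpha>))) =
        2 * real ?n * (real ?n - 1) * 3 powi (int ?n - 2)
          - real ?n * (real ?n - 1) * 2 powi (int ?n - 2)"
    proof (cases "?n \<ge> 2")
      case True
      show ?thesis unfolding F real_choose_2 pow(1)[OF True zero_less_numeral] by (simp add: field_simps)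
    next
      case False
      then have "?n = 1" using n by linarith
      then show ?thesis unfolding F by simp
    qed
  }
qed

end
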